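(* Let $r\in(1,\infty)$. Almost surely, simultaneously for every $[\alpha,\beta]\subset[0,1]$ (with $\alpha\le\beta$), the set $E_r(\alpha,\beta)$ is nonempty if and only if $[\alpha,\beta]\subset I(r)$, and in this case $E_r(\alpha,\beta)$ is a dense subset of $\partial\mathcal T$ with Hausdorff dimension $$\dim_{\mathrm H}E_r(\alpha,\beta)=\ln r-\max\{L^*(\alpha),L^*(\beta)\}.$$ In particular, for every $\alpha\in I(r)$, $\dim_{\mathrm H}E_r(\alpha)=\ln r-L^*(\alpha)$; and $\dim_{\mathrm H}\partial\mathcal T=\dim_{\mathrm H}E_r(\mathtt C_{\mathrm{RW}})$.
   Context: Let $d\ge 2$ and let $\mathbb F$ be the free group of rank $d$ with identity $e$ and symmetric generating set $\mathcal A=\{a_1,\dots,a_d,a_1^{-1},\dots,a_d^{-1}\}$; $|x|$ is the word length of $x\in\mathbb F$. Let $\mu$ be a probability measure on $\mathcal A\cup\{e\}$ with $\mu(a)=\mu(a^{-1})>0$ for all $a\in\mathcal A$. Let $(Z_n)_{n\ge0}$ be the $\mu$-random walk on $\mathbb F$ ($Z_0=e$, i.i.d. right multiplications with law $\mu$). Its rate of escape is $\mathtt C_{\mathrm{RW}}=\lim_n|Z_n|/n$ (almost sure constant limit, positive). $L^*:\mathbb R\to[0,\infty]$ is the (lower semicontinuous) large-deviation rate function of $|Z_n|/n$: for every Borel $B\subset\mathbb R$, $-\inf_{B^\circ}L^*\le\liminf_n\frac1n\ln\mathbf P(|Z_n|/n\in B)\le\limsup_n\frac1n\ln\mathbf P(|Z_n|/n\in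 B)\le-\inf_{\overline B}L^*$. It is known that $L^*$ is convex and finite precisely on $[0,1]$. For $r>1$ set $I(r)=\{q\in[0,1]:L^*(q)\le\ln r\}$. Branching random walk: $\mathcal T$ is a Galton–Watson tree with root $\emptyset$ and offspring distribution $(p_k)_{k\ge0}$ with $p_0=0$, $\sum_k e^{sk}p_k<\infty$ for some $s>0$, and mean $r=\sum_k kp_k$. Given $\mathcal T$, let $(Y_u)_{u\in\mathcal T\setminus\{\emptyset\}}$ be i.i.d. with law $\mu$; put $V(\emptyset)=e$ and $V(u)=Y_{u_1}\cdots Y_{u_n}$ where $(\emptyset,u_1,\dots,u_n=u)$ is the geodesic from $\emptyset$ to $u$. $\partial\mathcal T$ is the set of rays $t=(t_n)_{n\ge0}$ in $\mathcal T$ from the root, with metric $\mathrm d(t,t')=e^{-|t\wedge t'|}$ for $t\neq t'$, where $|t\wedge t'|$ is the generation of the last common vertex; $\dim_{\mathrm H}$ is Hausdorff dimension for this metric. For $0\le\alpha\le\beta\le1$, $$E_r(\alpha,\beta)=\Bigl\{t\in\partial\mathcal T:\liminf_{n\to\infty}\tfrac{|V(t_n)|}{n}=\alpha,\ \limsup_{n\to\infty}\tfrac{|V(t_n)|}{n}=\beta\Bigr\},\qquad E_r(\alpha)=E_r(\alpha,\alpha).$$ *)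

theory Defs
  imports "HOL-Probability.Probability" "HOL-Algebra.Group"
begin

section \<open>Free groups and word length\<close>

text \<open>
  The letter \<^term>\<open>(i, False)\<close> stands for the generator \<open>a\<^sub>i\<close> and \<^term>\<open>(i, True)\<close> for its inverse.
  Generators are numbered from 0, and group elements are reduced words.
\<close>

type_synonym letter = "nat \<times> bool"
type_synonym fword = "letter list"

definition flip :: "letter \<Rightarrow> letter" where
  "flip x = (fst x, \<not> snd x)"

fun reduced :: "fword \<Rightarrow> bool" where
  "reduced (x # y # w) \<longleftrightarrow> y \<noteq> flip x \<and> reduced (y # w)"
| "reduced _ \<longleftrightarrow> True"

fun cancel_cons :: "letter \<Rightarrow> fword \<Rightarrow> fword" where
  "cancel_cons x [] = [x]"
| "cancel_cons x (y # w) = (if y = flip x then w else x # y # w)"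

definition free_group :: "nat \<Rightarrow> fword monoid" where
  "free_group d =
     \<lparr>carrier = {w. reduced w \<and> fst ` set w \<subseteq> {..<d}},
      mult = (\<lambda>v w. foldr cancel_cons v w),
      one = []\<rparr>"

definition free_gens :: "nat \<Rightarrow> fword set" where
  "free_gens d = {[x] | x. fst x < d}"

definition list_prod :: "('a, 'b) monoid_scheme \<Rightarrow> 'a list \<Rightarrow> 'a" where
  "list_prod G xs = foldr (\<otimes>\<^bsub>G\<^esub>) xs \<one>\<^bsub>G\<^esub>"

text \<open>Intended for sets \<open>S\<close> that are closed under inverses and generate \<open>G\<close>.\<close>

definition word_length :: "('a, 'b) monoid_scheme \<Rightarrow> 'a set \<Rightarrow> 'a \<Rightarrow> nat" where
  "word_length G S x = (LEAST n. \<exists>ws. length ws = n \<and> set ws \<subseteq> S \<and> list_prod G ws = x)"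

abbreviation fnorm :: "nat \<Rightarrow> fword \<Rightarrow> nat" where
  "fnorm d \<equiv> word_length (free_group d) (free_gens d)"

lemma flip_flip [simp]: "flip (flip x) = x"
  by (simp add: flip_def)

lemma fst_flip [simp]: "fst (flip x) = fst x"
  by (simp add: flip_def)

lemma flip_neq [simp]: "flip x \<noteq> x" "x \<noteq> flip x"
  by (auto simp: flip_def prod_eq_iff)

lemma reduced_tl: "reduced (x # w) \<Longrightarrow> reduced w"
  by (cases w) auto

lemma reduced_cancel_cons: "reduced w \<Longrightarrow> reduced (cancel_cons x w)"
  by (cases w) (auto dest: reduced_tl)

lemma set_cancel_cons: "set (cancel_cons x w) \<subseteq> insert x (set w)"
  by (cases w) auto

lemma cancel_cons_reduced: "reduced (x # w) \<Longrightarrow> cancel_cons x w = x # w"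
  by (cases w) auto

lemma cancel_cons_flip: "reduced w \<Longrightarrow> cancel_cons x (cancel_cons (flip x) w) = w"
  by (cases w rule: reduced.cases) auto

lemma reduced_foldr: "reduced w \<Longrightarrow> reduced (foldr cancel_cons v w)"
  by (induction v) (auto intro: reduced_cancel_cons)

lemma set_foldr: "set (foldr cancel_cons v w) \<subseteq> set v \<union> set w"
proof (induction v)
  case (Cons x v)
  then show ?case using set_cancel_cons[of x "foldr cancel_cons v w"] by auto
qed simp

lemma length_cancel_cons: "length (cancel_cons x w) \<le> Suc (length w)"
  by (cases w) auto

lemma foldr_cancel_cons:
  assumes "reduced w"
  shows "foldr cancel_cons (cancel_cons x v) w = cancel_cons x (foldr cancel_cons v w)"
proof (cases v)
  case (Cons y v')
  then show ?thesis
    using cancel_cons_flip[of "foldr cancel_cons v' w" x] reduced_foldr[OF assms] by auto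
qed simp

lemma foldr_assoc:
  "reduced w \<Longrightarrow> foldr cancel_cons (foldr cancel_cons u v) w = foldr cancel_cons u (foldr cancel_cons v w)"
  by (induction u) (auto simp: foldr_cancel_cons)

lemma foldr_Nil: "reduced w \<Longrightarrow> foldr cancel_cons w [] = w"
proof (induction w)
  case (Cons x w)
  then show ?case using reduced_tl[OF Cons.prems] by (simp add: cancel_cons_reduced)
qed simp

lemma foldr_inverse: "reduced w \<Longrightarrow> foldr cancel_cons (rev (map flip v)) (foldr cancel_cons v w) = w"
proof (induction v)
  case (Cons x v)
  then show ?case
    using cancel_cons_flip[of "foldr cancel_cons v w" "flip x"] reduced_foldr[of w v] by simp
qed simp

lemma reduced_snoc: "reduced (w @ [x]) \<longleftrightarrow> reduced w \<and> (w = [] \<or> last w \<noteq> flip x)"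
  by (induction w rule: reduced.induct) auto

lemma reduced_inverse: "reduced w \<Longrightarrow> reduced (rev (map flip w))"
proof (induction w)
  case (Cons x w)
  show ?case
  proof (cases w)
    case (Cons y w')
    then have "reduced (rev (map flip w))" "last (rev (map flip w)) = flip y" "y \<noteq> flip x"
      using Cons.IH Cons.prems reduced_tl[of x w] by auto
    then show ?thesis
      using reduced_snoc[of "rev (map flip w)" "flip x"] by (metis flip_flip list.simps(9) rev.simps(2))
  qed simp
qed simp

theorem group_free_group: "group (free_group d)"
proof (rule groupI)
  fix v w assume "v \<in> carrier (free_group d)" "w \<in> carrier (free_group d)"
  then show "v \<otimes>\<^bsub>free_group d\<^esub> w \<in> carrier (free_group d)"
    using set_foldr[of v w] by (fastforce simp: free_group_def reduced_foldr)
next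
  show "\<one>\<^bsub>free_group d\<^esub> \<in> carrier (free_group d)"
    by (simp add: free_group_def)
next
  fix u v w
  assume "u \<in> carrier (free_group d)" "v \<in> carrier (free_group d)" "w \<in> carrier (free_group d)"
  then show "u \<otimes>\<^bsub>free_group d\<^esub> v \<otimes>\<^bsub>free_group d\<^esub> w = u \<otimes>\<^bsub>free_group d\<^esub> (v \<otimes>\<^bsub>free_group d\<^esub> w)"
    by (simp add: free_group_def foldr_assoc)
next
  fix w assume "w \<in> carrier (free_group d)"
  then show "\<one>\<^bsub>free_group d\<^esub> \<otimes>\<^bsub>free_group d\<^esub> w = w"
    by (simp add: free_group_def)
next
  fix w assume w: "w \<in> carrier (free_group d)"
  have "foldr cancel_cons (rev (map flip w)) w = []"
    using foldr_inverse[of "[]" w] w by (simp add: free_group_def foldr_Nil)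
  with w show "\<exists>v\<in>carrier (free_group d). v \<otimes>\<^bsub>free_group d\<^esub> w = \<one>\<^bsub>free_group d\<^esub>"
    by (intro bexI[of _ "rev (map flip w)"]) (auto simp: free_group_def reduced_inverse)
qed

lemma list_prod_letters:
  "reduced w \<Longrightarrow> list_prod (free_group d) (map (\<lambda>x. [x]) w) = w"
proof (induction w)
  case (Cons x w)
  then show ?case using reduced_tl[OF Cons.prems]
    by (simp add: list_prod_def free_group_def cancel_cons_reduced)
qed (simp add: list_prod_def free_group_def)

text \<open>Every element is a product of letters by \<open>list_prod_letters\<close>, so the homomorphism is unique.\<close>

theorem free_group_universal:
  assumes "group H" and f: "\<And>i. i < d \<Longrightarrow> f i \<in> carrier H"
  shows "\<exists>h\<in>hom (free_group d) H. \<forall>i<d. h [(i, False)] = f i"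
proof -
  interpret H: group H by fact
  define val where "val x = (if snd x then inv\<^bsub>H\<^esub> f (fst x) else f (fst x))" for x :: letter
  define h where "h w = foldr (\<lambda>x a. val x \<otimes>\<^bsub>H\<^esub> a) w \<one>\<^bsub>H\<^esub>" for w
  have val: "val x \<in> carrier H" "val (flip x) \<in> carrier H"
    "val x \<otimes>\<^bsub>H\<^esub> val (flip x) = \<one>\<^bsub>H\<^esub>" if "fst x < d" for x
    using f[OF that] by (auto simp: val_def flip_def)
  have h_closed: "h w \<in> carrier H" if "fst ` set w \<subseteq> {..<d}" for w
    using that by (induction w) (auto simp: h_def val)
  have h_cons: "h (cancel_cons x w) = val x \<otimes>\<^bsub>H\<^esub> h w" if "fst x < d" "fst ` set w \<subseteq> {..<d}" for x w
  proof (cases w)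
    case (Cons y w')
    have "h w' \<in> carrier H" using that Cons by (intro h_closed) auto
    then have "val x \<otimes>\<^bsub>H\<^esub> (val (flip x) \<otimes>\<^bsub>H\<^esub> h w') = h w'"
      using val[OF that(1)] by (simp add: H.m_assoc[symmetric])
    then show ?thesis using Cons by (auto simp: h_def)
  qed (simp add: h_def)
  have "h (foldr cancel_cons v w) = h v \<otimes>\<^bsub>H\<^esub> h w"
    if "fst ` set v \<subseteq> {..<d}" "fst ` set w \<subseteq> {..<d}" for v w
    using that(1)
  proof (induction v)
    case Nil
    then show ?case using h_closed[OF that(2)] by (simp add: h_def)
  next
    case (Cons x v)
    have "fst ` set (foldr cancel_cons v w) \<subseteq> {..<d}"
      using Cons.prems that(2) set_foldr[of v w] by fastforce
    then have "h (foldr cancel_cons (x # v) w) = val x \<otimes>\<^bsub>H\<^esub> (h v \<otimes>\<^bsub>H\<^esub> h w)"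
      using Cons by (simp add: h_cons)
    also have "\<dots> = h (x # v) \<otimes>\<^bsub>H\<^esub> h w"
      using Cons.prems h_closed[OF that(2)] h_closed[of v] val[of x]
      by (simp add: h_def H.m_assoc)
    finally show ?case .
  qed
  then have "h \<in> hom (free_group d) H"
    by (auto simp: hom_def free_group_def h_closed)
  moreover have "\<forall>i<d. h [(i, False)] = f i"
    by (auto simp: h_def val_def f)
  ultimately show ?thesis by blast
qed

theorem fnorm_eq_length:
  assumes "w \<in> carrier (free_group d)"
  shows "fnorm d w = length w"
  unfolding word_length_def
proof (rule Least_equality)
  have "reduced w" "fst ` set w \<subseteq> {..<d}" using assms by (auto simp: free_group_def)
  then show "\<exists>ws. length ws = length w \<and> set ws \<subseteq> free_gens d \<and> list_prod (free_group d) ws = w"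
    by (intro exI[of _ "map (\<lambda>x. [x]) w"]) (auto simp: list_prod_letters free_gens_def)
next
  fix n
  assume "\<exists>ws. length ws = n \<and> set ws \<subseteq> free_gens d \<and> list_prod (free_group d) ws = w"
  then obtain ws where ws: "length ws = n" "set ws \<subseteq> free_gens d" "list_prod (free_group d) ws = w"
    by blast
  have "length (list_prod (free_group d) ws) \<le> length ws" if "set ws \<subseteq> free_gens d"
    using that
  proof (induction ws)
    case (Cons v ws)
    then obtain x where "v = [x]" by (auto simp: free_gens_def)
    then show ?case
      using Cons length_cancel_cons[of x "list_prod (free_group d) ws"]
      by (simp add: list_prod_def free_group_def)
  qed (simp add: list_prod_def free_group_def)
  with ws show "length w \<le> n" by simp
qed

lemma inv_free_gens: "fst x < d \<Longrightarrow> inv\<^bsub>free_group d\<^esub> [x] = [flip x]"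
  by (rule group.inv_equality[OF group_free_group]) (auto simp: free_group_def)


section \<open>Random walk and large deviations\<close>

definition has_law :: "'o measure \<Rightarrow> ('o \<Rightarrow> 'a) \<Rightarrow> 'a measure \<Rightarrow> bool" where
  "has_law P X K \<longleftrightarrow> X \<in> measurable P K \<and> distr P K X = K"

text \<open>The step from time \<open>n\<close> to time \<open>n + 1\<close> is \<open>x n\<close>.\<close>

definition walk :: "nat \<Rightarrow> (nat \<Rightarrow> fword) \<Rightarrow> nat \<Rightarrow> fword" where
  "walk d x n = list_prod (free_group d) (map x [0..<n])"

text \<open>\<^const>\<open>ln\<close> takes a junk value at 0; here the logarithm of 0 is \<open>-\<infinity>\<close>.\<close>

definition ln_ereal :: "real \<Rightarrow> ereal" where
  "ln_ereal p = (if p \<le> 0 then -\<infinity> else ereal (ln p))"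

text \<open>
  A lower semicontinuous \<open>L\<close> with the two bounds is unique, so this predicate pins down the
  large-deviation rate function.
\<close>

definition ldp_rate_function ::
  "'o measure \<Rightarrow> (nat \<Rightarrow> 'o \<Rightarrow> real) \<Rightarrow> (real \<Rightarrow> ereal) \<Rightarrow> bool" where
  "ldp_rate_function P W L \<longleftrightarrow>
     (\<forall>x. 0 \<le> L x) \<and>
     (\<forall>c. closed {x. L x \<le> c}) \<and>
     (\<forall>B\<in>sets borel.
        - (INF x\<in>interior B. L x)
          \<le> liminf (\<lambda>n. ln_ereal (measure P {\<omega>\<in>space P. W n \<omega> \<in> B}) / ereal (real n)) \<and>
        limsup (\<lambda>n. ln_ereal (measure P {\<omega>\<in>space P. W n \<omega> \<in> B}) / ereal (real n))
          \<le> - (INF x\<in>closure B. L x))"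

definition I_set :: "(real \<Rightarrow> ereal) \<Rightarrow> real \<Rightarrow> real set" where
  "I_set L r = {q\<in>{0..1}. L q \<le> ereal (ln r)}"


section \<open>Branching random walk\<close>

text \<open>
  Ulam--Harris coding: vertices are finite sequences of naturals, and the children of \<open>u\<close> are
  \<open>u @ [k]\<close> for \<open>k < N u\<close>, where \<open>N u\<close> is the offspring number of \<open>u\<close>.
\<close>

definition gw_tree :: "(nat list \<Rightarrow> nat) \<Rightarrow> nat list set" where
  "gw_tree N = {u. \<forall>k<length u. u ! k < N (take k u)}"

text \<open>\<open>y u\<close> is the step along the edge from the parent of \<open>u\<close> to \<open>u\<close>.\<close>

definition position :: "nat \<Rightarrow> (nat list \<Rightarrow> fword) \<Rightarrow> nat list \<Rightarrow> fword" where
  "position d y u = list_prod (free_group d) (map (\<lambda>k. y (take k u)) [1..<Suc (length u)])"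

text \<open>
  Offspring numbers are i.i.d. with law \<open>p\<close>, steps are i.i.d. with law \<open>\<mu>\<close>, and the two families
  are independent. They are indexed by all potential vertices, only those in the tree being used;
  this realises the steps as i.i.d. with law \<open>\<mu>\<close> given the tree.
\<close>

definition branching_walk_law :: "nat pmf \<Rightarrow> fword pmf \<Rightarrow>
    ((nat list \<Rightarrow> nat) \<times> (nat list \<Rightarrow> fword)) measure" where
  "branching_walk_law p \<mu> =
     (\<Pi>\<^sub>M u\<in>UNIV. measure_pmf p) \<Otimes>\<^sub>M (\<Pi>\<^sub>M u\<in>{u. u \<noteq> []}. measure_pmf \<mu>)"

definition boundary :: "nat list set \<Rightarrow> (nat \<Rightarrow> nat list) set" where
  "boundary T = {t. t 0 = [] \<and> (\<forall>n. t n \<in> T \<and> (\<exists>k. t (Suc n) = t n @ [k]))}"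

definition ray_dist :: "(nat \<Rightarrow> nat list) \<Rightarrow> (nat \<Rightarrow> nat list) \<Rightarrow> real" where
  "ray_dist t t' = (if t = t' then 0 else exp (- real (GREATEST n. t n = t' n)))"

definition boundary_metric :: "nat list set \<Rightarrow> (nat \<Rightarrow> nat list) metric" where
  "boundary_metric T = metric (boundary T, ray_dist)"

definition E_set :: "nat \<Rightarrow> nat list set \<Rightarrow> (nat list \<Rightarrow> fword) \<Rightarrow> real \<Rightarrow> real \<Rightarrow>
    (nat \<Rightarrow> nat list) set" where
  "E_set d T y \<alpha> \<beta> =
     {t\<in>boundary T.
        liminf (\<lambda>n. ereal (real (fnorm d (position d y (t n))) / real n)) = ereal \<alpha> \<and>
        limsup (\<lambda>n. ereal (real (fnorm d (position d y (t n))) / real n)) = ereal \<beta>}"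

lemma boundary_prefix:
  assumes "t \<in> boundary T" "m \<le> n"
  shows "t m = take m (t n)" "length (t n) = n"
proof -
  have len: "length (t n) = n" for n
  proof (induction n)
    case (Suc n)
    obtain k where "t (Suc n) = t n @ [k]" using assms(1) by (auto simp: boundary_def)
    with Suc show ?case by simp
  qed (use assms(1) in \<open>simp add: boundary_def\<close>)
  then show "length (t n) = n" .
  show "t m = take m (t n)"
    using assms(2)
  proof (induction n rule: dec_induct)
    case (step n)
    obtain k where "t (Suc n) = t n @ [k]" using assms(1) by (auto simp: boundary_def)
    then show ?case using step.IH step.hyps by (simp add: len)
  qed (simp add: len)
qed

lemma boundary_agree_mono:
  assumes "t \<in> boundary T" "t' \<in> boundary T" "t n = t' n" "m \<le> n"
  shows "t m = t' m"
  by (metis assms boundary_prefix(1))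

lemma boundary_meet:
  assumes t: "t \<in> boundary T" and t': "t' \<in> boundary T" and "t \<noteq> t'"
  shows "t n = t' n \<longleftrightarrow> n \<le> (GREATEST n. t n = t' n)"
proof -
  from \<open>t \<noteq> t'\<close> obtain b where b: "t b \<noteq> t' b" by auto
  have bound: "n \<le> b" if "t n = t' n" for n
  proof (rule ccontr)
    assume "\<not> n \<le> b"
    then have "b \<le> n" by simp
    from boundary_agree_mono[OF t t' that this] b show False by simp
  qed
  have "t 0 = t' 0" using t t' by (simp add: boundary_def)
  then have "t (GREATEST n. t n = t' n) = t' (GREATEST n. t n = t' n)"
    using bound by (intro GreatestI_nat[where P = "\<lambda>n. t n = t' n"]) auto
  moreover have "t n = t' n \<Longrightarrow> n \<le> (GREATEST n. t n = t' n)"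
    using bound by (intro Greatest_le_nat) auto
  ultimately show ?thesis using boundary_agree_mono[OF t t'] by blast
qed

theorem Metric_space_boundary: "Metric_space (boundary T) ray_dist"
proof
  fix t t' s
  show "0 \<le> ray_dist t t'" by (simp add: ray_dist_def)
  show "ray_dist t t' = ray_dist t' t" by (simp add: ray_dist_def eq_commute)
  show "ray_dist t t' = 0 \<longleftrightarrow> t = t'" by (simp add: ray_dist_def)
  assume mem: "t \<in> boundary T" "t' \<in> boundary T" "s \<in> boundary T"
  show "ray_dist t s \<le> ray_dist t t' + ray_dist t' s"
  proof (cases "t = t' \<or> t' = s \<or> t = s")
    case False
    define a where "a = (GREATEST n. t n = t' n)"
    define b where "b = (GREATEST n. t' n = s n)"
    define c where "c = (GREATEST n. t n = s n)"
    have "t (min a b) = t' (min a b)" "t' (min a b) = s (min a b)"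
      using boundary_meet[of t T t' "min a b"] boundary_meet[of t' T s "min a b"] mem False
      by (auto simp: a_def b_def)
    then have "min a b \<le> c"
      using boundary_meet[of t T s "min a b"] mem False by (auto simp: c_def)
    then have "exp (- real c) \<le> exp (- real a) \<or> exp (- real c) \<le> exp (- real b)"
      by (auto simp: min_def split: if_splits)
    then have "exp (- real c) \<le> exp (- real a) + exp (- real b)"
      using exp_gt_zero[of "- real a"] exp_gt_zero[of "- real b"] by linarith
    then show ?thesis using False by (simp add: ray_dist_def a_def b_def c_def)
  qed (auto simp: ray_dist_def)
qed

lemma boundary_metric_simps [simp]:
  "mspace (boundary_metric T) = boundary T"
  "mdist (boundary_metric T) = ray_dist"
  using Metric_space.mspace_metric[OF Metric_space_boundary]
    Metric_space.mdist_metric[OF Metric_space_boundary]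
  by (auto simp: boundary_metric_def)


section \<open>Hausdorff dimension\<close>

definition ediam :: "'a metric \<Rightarrow> 'a set \<Rightarrow> ennreal" where
  "ediam m U = (SUP x\<in>U. SUP y\<in>U. ennreal (mdist m x y))"

text \<open>
  The \<open>s\<close>-th power of the diameter, with the usual convention that the 0-th power is 1 for every
  nonempty set (whereas \<^term>\<open>0 powr 0 = (0::real)\<close>). It is only used for sets of finite diameter.
\<close>

definition diam_pow :: "'a metric \<Rightarrow> real \<Rightarrow> 'a set \<Rightarrow> ennreal" where
  "diam_pow m s U =
     (if U = {} then 0 else if s = 0 then 1 else ennreal (enn2real (ediam m U) powr s))"

definition hausdorff_content :: "'a metric \<Rightarrow> real \<Rightarrow> real \<Rightarrow> 'a set \<Rightarrow> ennreal" where
  "hausdorff_content m s \<delta> E =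
     Inf {(\<Sum>i. diam_pow m s (U i)) | U :: nat \<Rightarrow> 'a set.
            (\<forall>i. U i \<subseteq> mspace m \<and> ediam m (U i) \<le> ennreal \<delta>) \<and> E \<subseteq> (\<Union>i. U i)}"

definition hausdorff_measure :: "'a metric \<Rightarrow> real \<Rightarrow> 'a set \<Rightarrow> ennreal" where
  "hausdorff_measure m s E = (SUP \<delta>\<in>{0<..}. hausdorff_content m s \<delta> E)"

definition hausdorff_dim :: "'a metric \<Rightarrow> 'a set \<Rightarrow> ereal" where
  "hausdorff_dim m E = (INF s\<in>{s. 0 \<le> s \<and> hausdorff_measure m s E = 0}. ereal s)"

end

theory Submission
  imports Defs "HOL-Real_Asymp.Real_Asymp"
begin

text \<open>Upper bounds are first moment bounds: for \<open>s < L q\<close> the expected number of vertices in generation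
  \<open>n\<close> of speed near \<open>q\<close> is at most \<open>exp (n (ln r - s))\<close>, and every ray of \<open>E \<alpha> \<beta>\<close> visits speeds near
  \<open>\<alpha>\<close> and near \<open>\<beta>\<close> infinitely often, so these vertices give economical covers.

  For the lower bounds, words that begin and end with the same letter multiply without cancellation.
  Hence blocks of length \<open>l\<close> and displacement \<open>j\<close> can be chained freely, and they form a supercritical
  Galton-Watson process as soon as the rate at \<open>j / l\<close> is below \<open>ln r\<close>. If one block type survives, every
  other type almost surely survives from vertices in infinitely many generations, so one can switch
  between countably many types and build, simultaneously for all \<open>\<alpha>\<close> and \<open>\<beta>\<close>, rays whose speed
  oscillates between \<open>\<alpha>\<close> and \<open>\<beta>\<close>. The dimension comes from percolation: after keeping each edge with
  probability \<open>exp (- k)\<close> the construction still works when the rates at \<open>\<alpha>\<close> and \<open>\<beta>\<close> are below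
  \<open>ln r - k\<close>, and a set of rays that meets the percolated tree with positive probability has dimension at
  least \<open>k\<close>.\<close>

section \<open>Words in the free group\<close>

text \<open>Simultaneity in \<open>\<alpha>\<close> and \<open>\<beta>\<close> is the main obstacle,
  since uncountably many almost sure events cannot be intersected. All that is asked of the random
  tree is therefore packed into one predicate, \<open>good\<close>, which quantifies only over
  rationals, vertices and the countably many block types; for a tree that satisfies it the spectrum
  is derived with no further randomness of the tree. Block types are indexed by a growth rate
  \<open>h = ln r - k\<close> because keeping edges with probability \<open>exp (- k)\<close> turns
  the mean offspring \<open>r\<close> into \<open>r * exp (- k)\<close>; the case
  \<open>k = 0\<close> gives existence and density, the case \<open>k > 0\<close> the dimension.
  Percolation stands in for a measure on each \<open>E \<alpha> \<beta>\<close>. Its bits are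
  independent of the tree, so by Fubini they can be studied on a fixed tree, where it is enough
  that, below a single vertex, an open ray of the set exists with positive probability. Restricting
  to words with prescribed end letters is free on the exponential scale: it takes four extra steps
  per block, hence a constant factor.\<close>

abbreviation lp :: "nat \<Rightarrow> fword list \<Rightarrow> fword" where
  "lp d \<equiv> list_prod (free_group d)"

abbreviation steps :: "nat \<Rightarrow> fword set" where
  "steps d \<equiv> free_gens d \<union> {[]}"

lemma lp_simps [simp]:
  "lp d [] = []" "lp d (e # es) = foldr cancel_cons e (lp d es)"
  by (simp_all add: list_prod_def free_group_def)

lemma lp_carrier:
  assumes "set es \<subseteq> steps d"
  shows "reduced (lp d es)" "fst ` set (lp d es) \<subseteq> {..<d}"
proof -
  have "reduced (lp d es) \<and> fst ` set (lp d es) \<subseteq> {..<d}"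
    using assms
  proof (induction es)
    case (Cons e es)
    then have "e = [] \<or> (\<exists>x. e = [x] \<and> fst x < d)" by (auto simp: free_gens_def)
    then show ?case
      using Cons set_cancel_cons[of _ "lp d es"] by (fastforce simp: reduced_cancel_cons)
  qed simp
  then show "reduced (lp d es)" "fst ` set (lp d es) \<subseteq> {..<d}" by auto
qed

lemma lp_fnorm: "set es \<subseteq> steps d \<Longrightarrow> fnorm d (lp d es) = length (lp d es)"
  using lp_carrier[of es d] by (intro fnorm_eq_length) (simp add: free_group_def)

lemma lp_append:
  assumes "set fs \<subseteq> steps d"
  shows "lp d (es @ fs) = foldr cancel_cons (lp d es) (lp d fs)"
  by (induction es) (simp_all add: foldr_assoc lp_carrier[OF assms])

lemma length_mult: "length (foldr cancel_cons v w) \<le> length v + length w"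
proof (induction v)
  case (Cons x v)
  then show ?case using length_cancel_cons[of x "foldr cancel_cons v w"] by simp
qed simp

text \<open>Multiplying \<open>v w\<close> on the right by the inverse word \<open>?i\<close> of
  \<open>w\<close> gives back \<open>v\<close>, so this is the triangle inequality for that
  product.\<close>

lemma length_mult_lower:
  assumes "reduced v" "reduced w"
  shows "length v \<le> length (foldr cancel_cons v w) + length w"
proof -
  let ?i = "rev (map flip w)"
  have "foldr cancel_cons ?i (foldr cancel_cons w []) = []"
    by (rule foldr_inverse) simp
  then have i: "foldr cancel_cons ?i w = []" using assms by (simp add: foldr_Nil)
  have ri: "reduced ?i" by (rule reduced_inverse) fact
  have "foldr cancel_cons (rev (map flip ?i)) (foldr cancel_cons ?i []) = []"
    by (rule foldr_inverse) simp
  then have wi: "foldr cancel_cons w ?i = []"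
    using foldr_Nil[OF ri] by (simp add: rev_map comp_def)
  have "foldr cancel_cons (foldr cancel_cons v w) ?i = v"
    using assms ri by (simp add: foldr_assoc wi foldr_Nil)
  then show ?thesis using length_mult[of "foldr cancel_cons v w" ?i] by simp
qed

lemma lp_length_le: "set es \<subseteq> steps d \<Longrightarrow> length (lp d es) \<le> length es"
proof (induction es)
  case (Cons e es)
  then have "length e \<le> 1" by (auto simp: free_gens_def)
  then show ?case using Cons length_mult[of e "lp d es"] by simp
qed simp

text \<open>The word length is 1-Lipschitz along the walk: a step adds or cancels at most one
  letter.\<close>

lemma lp_length_append:
  assumes "set es \<subseteq> steps d" "set fs \<subseteq> steps d"
  shows "\<bar>real (length (lp d (es @ fs))) - real (length (lp d es))\<bar> \<le> real (length fs)"
proof -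
  have "length (lp d fs) \<le> length fs" using assms by (simp add: lp_length_le)
  moreover have "length (lp d (es @ fs)) \<le> length (lp d es) + length (lp d fs)"
    using assms by (simp add: lp_append length_mult)
  moreover have "length (lp d es) \<le> length (lp d (es @ fs)) + length (lp d fs)"
    using assms by (simp add: lp_append length_mult_lower lp_carrier)
  ultimately show ?thesis by linarith
qed

lemma reduced_append:
  "reduced (v @ w) \<longleftrightarrow> reduced v \<and> reduced w \<and> (v = [] \<or> w = [] \<or> hd w \<noteq> flip (last v))"
proof (induction v rule: reduced.induct)
  case ("2_2" v)
  then show ?case by (cases w) auto
qed auto

lemma mult_reduced: "reduced (v @ w) \<Longrightarrow> foldr cancel_cons v w = v @ w"
proof (induction v)
  case (Cons x v)
  then show ?case using reduced_tl[of x "v @ w"] by (simp add: cancel_cons_reduced)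
qed simp

text \<open>Products of words that begin and end with the same letter involve no cancellation, so their
  lengths add up exactly.\<close>

definition anchored :: "nat \<Rightarrow> nat \<Rightarrow> fword set" where
  "anchored d j = {w. reduced w \<and> fst ` set w \<subseteq> {..<d} \<and> w \<noteq> [] \<and>
     hd w = (0, False) \<and> last w = (0, False) \<and> length w = j}"

lemma anchored_mult:
  assumes "v \<in> anchored d i" "w \<in> anchored d j"
  shows "foldr cancel_cons v w \<in> anchored d (i + j)"
proof -
  have "reduced (v @ w)"
    using assms by (auto simp: anchored_def reduced_append flip_def)
  then show ?thesis
    using assms by (auto simp: anchored_def mult_reduced)
qed

text \<open>A buffer letter on each side keeps the outer letters from cancelling against
  \<open>w\<close>. Each buffer letter must avoid the inverses of its two neighbours; a choice
  between generators 0 and 1 suffices, which is where \<open>2 \<le> d\<close> enters.\<close>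

lemma anchored_extend:
  assumes "2 \<le> d" "reduced w" "fst ` set w \<subseteq> {..<d}"
  obtains b c where "[b] \<in> free_gens d" "[c] \<in> free_gens d"
    "[(0, False), b] @ w @ [c, (0, False)] \<in> anchored d (length w + 4)"
proof -
  obtain b :: letter where b: "fst b < d" "b \<noteq> flip (0, False)" "w \<noteq> [] \<longrightarrow> hd w \<noteq> flip b"
  proof (cases "w \<noteq> [] \<and> hd w = flip (0, False)")
    case True
    then show ?thesis using assms(1) by (intro that[of "(1, False)"]) (auto simp: flip_def)
  next
    case False
    then show ?thesis using assms(1) by (intro that[of "(0, False)"]) (auto simp: flip_def)
  qed
  obtain c :: letter where c: "fst c < d" "(0, False) \<noteq> flip c" "w \<noteq> [] \<longrightarrow> c \<noteq> flip (last w)"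
    "w = [] \<longrightarrow> c \<noteq> flip b"
  proof -
    \<comment> \<open>\<open>x\<close> is the letter to the left of \<open>c\<close>, namely
      \<open>b\<close> if \<open>w\<close> is empty. The choice \<open>(0, False)\<close> for
      \<open>c\<close> fails only if it is the inverse of \<open>x\<close>.\<close>
    define x where "x = (if w = [] then b else last w)"
    show ?thesis
    proof (cases "x = (0, True)")
      case True
      then show ?thesis using assms(1)
        by (intro that[of "(1, False)"]) (auto simp: flip_def x_def split: if_splits)
    next
      case False
      then show ?thesis using assms(1)
        by (intro that[of "(0, False)"]) (auto simp: flip_def x_def prod_eq_iff split: if_splits)
    qed
  qed
  have "reduced ([(0, False), b] @ w @ [c, (0, False)])"
    unfolding reduced_append[of "[(0, False), b]"] reduced_append[of w]
    using assms b c by (cases "w = []") auto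
  then show ?thesis
    using assms b c by (cases b; cases c) (auto intro!: that[of b c] simp: anchored_def free_gens_def)
qed

text \<open>The list \<open>es\<close> may contain cancelling and trivial steps, but its product is
  already reduced; the four single-letter steps around it do not cancel because the padded word is
  reduced.\<close>

lemma lp_anchored_extend:
  assumes "set es \<subseteq> steps d" "[(0, False), b] @ lp d es @ [c, (0, False)] \<in> anchored d j"
  shows "lp d ([[(0, False)], [b]] @ es @ [[c], [(0, False)]]) =
    [(0, False), b] @ lp d es @ [c, (0, False)]"
proof -
  have red: "reduced ([(0, False), b] @ lp d es @ [c, (0, False)])"
    using assms(2) by (simp add: anchored_def)
  have "fst c < d" "0 < d" using assms(2) by (auto simp: anchored_def)
  then have ss: "set [[c], [(0, False)]] \<subseteq> steps d" by (cases c) (auto simp: free_gens_def)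
  have r1: "reduced (lp d es @ [c, (0, False)])" using red reduced_append by blast
  then have r2: "reduced [c, (0, False)]" using reduced_append by blast
  have c: "lp d [[c], [(0, False)]] = [c, (0, False)]"
    using r2 by (simp add: cancel_cons_reduced)
  have "lp d (es @ [[c], [(0, False)]]) = lp d es @ [c, (0, False)]"
    unfolding lp_append[OF ss] c using r1 by (rule mult_reduced)
  then show ?thesis
    using mult_reduced[OF red] by simp
qed

section \<open>The random walk and its large deviations\<close>

lemma replicate_pmf_Suc_pair:
  "replicate_pmf (Suc n) p = map_pmf (\<lambda>(x, xs). x # xs) (pair_pmf p (replicate_pmf n p))"
  by (simp add: pair_pmf_def map_bind_pmf map_pmf_def[symmetric] pmf.map_comp comp_def)

lemma replicate_pmf_add_pair:
  "replicate_pmf (m + n) p =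
    map_pmf (\<lambda>(xs, ys). xs @ ys) (pair_pmf (replicate_pmf m p) (replicate_pmf n p))"
  by (simp add: replicate_pmf_distrib pair_pmf_def map_bind_pmf bind_assoc_pmf bind_return_pmf map_pmf_def)

lemma pmf_replicate: "length xs = n \<Longrightarrow> pmf (replicate_pmf n p) xs = prod_list (map (pmf p) xs)"
proof (induction xs arbitrary: n)
  case (Cons x xs)
  then obtain m where m: "n = Suc m" "length xs = m" by (cases n) auto
  have "pmf (replicate_pmf (Suc m) p) ((\<lambda>(x, xs). x # xs) (x, xs)) = pmf (pair_pmf p (replicate_pmf m p)) (x, xs)"
    unfolding replicate_pmf_Suc_pair by (rule pmf_map_inj') (auto simp: inj_def)
  then show ?case using Cons m by (simp add: pmf_pair)
qed (simp add: pmf_return)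

lemma finite_set_replicate_pmf:
  assumes "finite (set_pmf p)"
  shows "finite (set_pmf (replicate_pmf n p))"
proof -
  have "{xs \<in> lists (set_pmf p). length xs = n} = {xs. set xs \<subseteq> set_pmf p \<and> length xs = n}"
    by auto
  then show ?thesis
    using finite_lists_length_eq[OF assms, of n] by (simp add: set_replicate_pmf)
qed

lemma measure_pmf_mono_AE:
  "(\<And>x. x \<in> set_pmf p \<Longrightarrow> x \<in> A \<Longrightarrow> x \<in> B) \<Longrightarrow> measure_pmf.prob p A \<le> measure_pmf.prob p B"
  by (rule measure_pmf.finite_measure_mono_AE) (auto simp: AE_measure_pmf_iff)

lemma finite_free_gens: "finite (free_gens d)"
proof -
  have "free_gens d = (\<lambda>x. [x]) ` ({..<d} \<times> UNIV)" by (auto simp: free_gens_def image_iff)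
  then show ?thesis by simp
qed

locale free_walk =
  fixes d :: nat and \<mu> :: "fword pmf"
  assumes d: "2 \<le> d"
    and support: "set_pmf \<mu> \<subseteq> steps d"
    and pos: "\<And>a. a \<in> free_gens d \<Longrightarrow> 0 < pmf \<mu> a"
begin

definition anchor_prob :: "nat \<Rightarrow> nat \<Rightarrow> real" where
  "anchor_prob n j = measure_pmf.prob (replicate_pmf n \<mu>) {es. lp d es \<in> anchored d j}"

definition length_prob :: "nat \<Rightarrow> nat \<Rightarrow> real" where
  "length_prob n j = measure_pmf.prob (replicate_pmf n \<mu>) {es. length (lp d es) = j}"

definition rate_prob :: "nat \<Rightarrow> real set \<Rightarrow> real" where
  "rate_prob n B = measure_pmf.prob (replicate_pmf n \<mu>) {es. real (length (lp d es)) / real n \<in> B}"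

lemma set_replicate: "es \<in> set_pmf (replicate_pmf n \<mu>) \<Longrightarrow> set es \<subseteq> steps d \<and> length es = n"
  using support by (auto simp: set_replicate_pmf)

text \<open>Two independent anchored blocks concatenate to an anchored block whose length is exactly
  the sum. For \<open>length_prob\<close> such supermultiplicativity fails in general, because the
  two words may cancel.\<close>

lemma anchor_prob_mult: "anchor_prob m i * anchor_prob n j \<le> anchor_prob (m + n) (i + j)"
proof -
  let ?p = "pair_pmf (replicate_pmf m \<mu>) (replicate_pmf n \<mu>)"
  let ?A = "\<lambda>i. {es. lp d es \<in> anchored d i}"
  have "anchor_prob m i * anchor_prob n j = measure_pmf.prob ?p (?A i \<times> ?A j)"
    unfolding anchor_prob_def by (rule measure_pmf_prob_product[symmetric]) auto
  also have "\<dots> \<le> measure_pmf.prob ?p ((\<lambda>(xs, ys). xs @ ys) -` ?A (i + j))"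
  proof (rule measure_pmf_mono_AE)
    fix x assume "x \<in> set_pmf ?p" "x \<in> ?A i \<times> ?A j"
    then show "x \<in> (\<lambda>(xs, ys). xs @ ys) -` ?A (i + j)"
      using set_replicate[of "snd x" n] by (auto simp: lp_append intro: anchored_mult)
  qed
  also have "\<dots> = anchor_prob (m + n) (i + j)"
    unfolding anchor_prob_def replicate_pmf_add_pair by simp
  finally show ?thesis .
qed

lemma anchor_prob_power:
  assumes "0 < k"
  shows "anchor_prob n j ^ k \<le> anchor_prob (k * n) (k * j)"
  using assms
proof (induction k rule: nat_induct_non_zero)
  case (Suc k)
  have "anchor_prob n j ^ Suc k \<le> anchor_prob n j * anchor_prob (k * n) (k * j)"
    using Suc by (auto intro!: mult_left_mono simp: anchor_prob_def)
  also have "\<dots> \<le> anchor_prob (Suc k * n) (Suc k * j)"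
    using anchor_prob_mult[of n j "k * n" "k * j"] by simp
  finally show ?case .
qed simp

lemma anchor_prob_pos:
  assumes "0 < anchor_prob n j"
  shows "0 < n" "j \<le> n"
proof -
  have "\<not> set_pmf (replicate_pmf n \<mu>) \<inter> {es. lp d es \<in> anchored d j} = {}"
    using assms unfolding anchor_prob_def by (metis less_irrefl measure_pmf_zero_iff)
  then obtain es where es: "es \<in> set_pmf (replicate_pmf n \<mu>)" "lp d es \<in> anchored d j" by auto
  then have "set es \<subseteq> steps d" "length es = n" using set_replicate by auto
  then show "j \<le> n" using es(2) lp_length_le[of es d] by (auto simp: anchored_def)
  show "0 < n" using es \<open>length es = n\<close> by (cases es) (auto simp: anchored_def)
qed

text \<open>Padding a step list by the four letters of \<open>anchored_extend\<close> keeps at least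
  the fraction \<open>k ^ 4\<close> of its probability, where \<open>k\<close> is the least
  probability of a generator. This is uniform in \<open>n\<close> and \<open>j\<close>.\<close>

lemma anchor_prob_lower:
  obtains \<kappa> where "0 < \<kappa>" "\<And>n j. \<kappa> * length_prob n j \<le> anchor_prob (n + 4) (j + 4)"
proof -
  define k where "k = Min (pmf \<mu> ` free_gens d)"
  have a: "[(0, False)] \<in> free_gens d" using d by (auto simp: free_gens_def)
  have fin: "finite (pmf \<mu> ` free_gens d)" by (simp add: finite_free_gens)
  have k: "0 < k" using fin a pos unfolding k_def by (subst Min_gr_iff) auto
  have kle: "k \<le> pmf \<mu> x" if "x \<in> free_gens d" for x
    using fin that by (auto simp: k_def)
  have "finite (set_pmf \<mu>)" using support finite_free_gens by (rule_tac finite_subset) auto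
  note fs = finite_set_replicate_pmf[OF this]
  have "k ^ 4 * length_prob n j \<le> anchor_prob (n + 4) (j + 4)" for n j
  proof -
    define S where "S = set_pmf (replicate_pmf n \<mu>) \<inter> {es. length (lp d es) = j}"
    have "\<exists>b c. [b] \<in> free_gens d \<and> [c] \<in> free_gens d \<and>
        [(0, False), b] @ lp d es @ [c, (0, False)] \<in> anchored d (j + 4)" if "es \<in> S" for es
    proof -
      have "set es \<subseteq> steps d" "length (lp d es) = j"
        using that set_replicate[of es n] by (auto simp: S_def)
      then show ?thesis using anchored_extend[OF d lp_carrier, of es] by metis
    qed
    then obtain b c where bc: "\<And>es. es \<in> S \<Longrightarrow> [b es] \<in> free_gens d" "\<And>es. es \<in> S \<Longrightarrow> [c es] \<in> free_gens d"
      "\<And>es. es \<in> S \<Longrightarrow> [(0, False), b es] @ lp d es @ [c es, (0, False)] \<in> anchored d (j + 4)"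
      by metis
    \<comment> \<open>The letters \<open>b es\<close> and \<open>c es\<close> depend on
      \<open>es\<close>, yet \<open>f\<close> is injective: dropping two steps at each end recovers
      \<open>es\<close>. Hence no probability is counted twice.\<close>
    define f where "f es = [[(0, False)], [b es]] @ es @ [[c es], [(0, False)]]" for es
    have inj: "inj_on f S" by (auto simp: inj_on_def f_def)
    have S: "set es \<subseteq> steps d" "length es = n" if "es \<in> S" for es
      using that set_replicate by (auto simp: S_def)
    have "k ^ 4 * length_prob n j = k ^ 4 * measure_pmf.prob (replicate_pmf n \<mu>) S"
      unfolding length_prob_def S_def by (subst Int_commute) (simp add: measure_Int_set_pmf)
    also have "\<dots> = (\<Sum>es\<in>S. k ^ 4 * pmf (replicate_pmf n \<mu>) es)"
      using fs by (simp add: measure_measure_pmf_finite S_def sum_distrib_left)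
    also have "\<dots> \<le> (\<Sum>es\<in>S. pmf (replicate_pmf (n + 4) \<mu>) (f es))"
    proof (rule sum_mono)
      fix es assume es: "es \<in> S"
      have "k * k * (k * k) \<le> pmf \<mu> [(0, False)] * pmf \<mu> [b es] * (pmf \<mu> [c es] * pmf \<mu> [(0, False)])"
        using k a bc es by (intro mult_mono kle) auto
      then have "k ^ 4 * prod_list (map (pmf \<mu>) es) \<le>
          pmf \<mu> [(0, False)] * pmf \<mu> [b es] * (pmf \<mu> [c es] * pmf \<mu> [(0, False)]) * prod_list (map (pmf \<mu>) es)"
        by (intro mult_right_mono prod_list_nonneg) (auto simp: eval_nat_numeral)
      then show "k ^ 4 * pmf (replicate_pmf n \<mu>) es \<le> pmf (replicate_pmf (n + 4) \<mu>) (f es)"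
        using S[OF es] by (simp add: pmf_replicate f_def mult_ac)
    qed
    also have "\<dots> = (\<Sum>es\<in>f ` S. pmf (replicate_pmf (n + 4) \<mu>) es)"
      using inj by (simp add: sum.reindex)
    also have "\<dots> = measure_pmf.prob (replicate_pmf (n + 4) \<mu>) (f ` S)"
      using fs by (simp add: measure_measure_pmf_finite S_def)
    also have "\<dots> \<le> anchor_prob (n + 4) (j + 4)"
      unfolding anchor_prob_def
    proof (rule measure_pmf.finite_measure_mono)
      show "f ` S \<subseteq> {es. lp d es \<in> anchored d (j + 4)}"
        using bc(3) lp_anchored_extend[OF S(1) bc(3)] unfolding f_def
        by (auto simp del: lp_simps append_Cons)
    qed simp
    finally show ?thesis .
  qed
  with k show ?thesis by (intro that[of "k ^ 4"]) auto
qed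

lemma rate_prob_le_one: "rate_prob n B \<le> 1"
  by (simp add: rate_prob_def)

text \<open>Pigeonhole: the length after \<open>n\<close> steps has at most \<open>n + 1\<close>
  values. The polynomial loss is invisible on the exponential scale.\<close>

lemma rate_prob_attained:
  assumes "0 < rate_prob n B"
  obtains j where "j \<le> n" "real j / real n \<in> B" "rate_prob n B \<le> (real n + 1) * length_prob n j"
proof -
  define J where "J = {j. j \<le> n \<and> real j / real n \<in> B}"
  have J: "finite J" "card J \<le> n + 1"
    using card_mono[of "{..n}" J] by (auto simp: J_def)
  have "rate_prob n B \<le> measure_pmf.prob (replicate_pmf n \<mu>) (\<Union>j\<in>J. {es. length (lp d es) = j})"
    unfolding rate_prob_def
  proof (rule measure_pmf_mono_AE)
    fix es assume "es \<in> set_pmf (replicate_pmf n \<mu>)" "es \<in> {es. real (length (lp d es)) / real n \<in> B}"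
    then show "es \<in> (\<Union>j\<in>J. {es. length (lp d es) = j})"
      using set_replicate[of es n] lp_length_le[of es d] by (auto simp: J_def)
  qed
  also have "\<dots> \<le> (\<Sum>j\<in>J. length_prob n j)"
    unfolding length_prob_def using J by (intro measure_pmf.finite_measure_subadditive_finite) auto
  finally have sum: "rate_prob n B \<le> (\<Sum>j\<in>J. length_prob n j)" .
  note found = that
  show ?thesis
  proof (rule ccontr)
    assume none: "\<not> thesis"
    have less: "length_prob n j < rate_prob n B / (real n + 1)" if "j \<in> J" for j
    proof (rule ccontr)
      assume "\<not> ?thesis"
      then have "rate_prob n B \<le> (real n + 1) * length_prob n j"
        by (simp add: field_simps add_pos_pos split: if_splits)
      then show False using that none found[of j] by (simp add: J_def)
    qed
    have "(\<Sum>j\<in>J. length_prob n j) < rate_prob n B"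
    proof (cases "J = {}")
      case False
      then have "(\<Sum>j\<in>J. length_prob n j) < (\<Sum>j\<in>J. rate_prob n B / (real n + 1))"
        using J less by (intro sum_strict_mono) auto
      also have "\<dots> = real (card J) * (rate_prob n B / (real n + 1))" by simp
      also have "\<dots> \<le> real (n + 1) * (rate_prob n B / (real n + 1))"
        using J assms by (intro mult_right_mono) auto
      also have "\<dots> = rate_prob n B"
        using of_nat_0_le_iff[of n, where 'a = real] by (simp add: divide_simps)
      finally show ?thesis .
    qed (use assms in simp)
    with sum show False by simp
  qed
qed

text \<open>A block type is a block length \<open>l\<close> and a displacement \<open>j\<close>; it is supercritical if a population
  that grows at exponential rate \<open>h\<close> has on average more than one block of that type.\<close>

definition types :: "real \<Rightarrow> (nat \<times> nat) set" where
  "types h = {(l, j). 1 < exp (real l * h) * anchor_prob l j}"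

lemma types_range: "i \<in> types h \<Longrightarrow> 0 < fst i \<and> snd i \<le> fst i"
proof -
  assume "i \<in> types h"
  then have "1 < exp (real (fst i) * h) * anchor_prob (fst i) (snd i)" by (auto simp: types_def)
  then have "anchor_prob (fst i) (snd i) \<noteq> 0" by (intro notI) simp
  moreover have "0 \<le> anchor_prob (fst i) (snd i)" by (simp add: anchor_prob_def)
  ultimately show ?thesis using anchor_prob_pos[of "fst i" "snd i"] by auto
qed

end

section \<open>Large deviation bounds for blocks and for speed intervals\<close>

locale free_walk_ldp = free_walk +
  fixes L :: "real \<Rightarrow> ereal"
  assumes L_nonneg: "\<And>x. 0 \<le> L x"
    and L_lsc: "\<And>c. closed {x. L x \<le> c}"
    and ldp_open: "\<And>B. open B \<Longrightarrow>
      - (INF x\<in>B. L x) \<le> liminf (\<lambda>n. ln_ereal (rate_prob n B) / ereal (real n))"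
    and ldp_closed: "\<And>B. closed B \<Longrightarrow>
      limsup (\<lambda>n. ln_ereal (rate_prob n B) / ereal (real n)) \<le> - (INF x\<in>B. L x)"
begin

text \<open>The lower large deviation bound near \<open>q\<close> is localised to a single length by
  \<open>rate_prob_attained\<close> and then to anchored words by \<open>anchor_prob_lower\<close>.
  Half of \<open>\<epsilon>\<close> in the exponent pays for the limit inferior, the other half for
  the factors \<open>n + 1\<close> and \<open>\<kappa>\<close>.\<close>

lemma anchor_prob_near:
  assumes L: "L q \<le> ereal c" and "0 < \<epsilon>"
  obtains n j where "0 < n" "\<bar>real j / real n - q\<bar> < \<epsilon>" "exp (- (real n * (c + \<epsilon>))) \<le> anchor_prob n j"
proof -
  have "0 \<le> c" using L L_nonneg[of q] by (metis ereal_less_eq(5) order_trans)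
  obtain \<kappa> where \<kappa>: "0 < \<kappa>" "\<And>n j. \<kappa> * length_prob n j \<le> anchor_prob (n + 4) (j + 4)"
    using anchor_prob_lower by blast
  define B where "B = ball q (\<epsilon> / 2)"
  have "(INF x\<in>B. L x) \<le> ereal c"
    using \<open>0 < \<epsilon>\<close> L by (intro INF_lower2[of q]) (auto simp: B_def)
  then have "- ereal c \<le> - (INF x\<in>B. L x)" by (simp only: ereal_minus_le_minus)
  also have "\<dots> \<le> liminf (\<lambda>n. ln_ereal (rate_prob n B) / ereal (real n))"
    by (rule ldp_open) (simp add: B_def)
  finally have "- ereal c \<le> liminf (\<lambda>n. ln_ereal (rate_prob n B) / ereal (real n))" .
  moreover have "ereal (- (c + \<epsilon> / 2)) < - ereal c" using \<open>0 < \<epsilon>\<close> by simp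
  ultimately have ev: "\<forall>\<^sub>F n in sequentially.
      ereal (- (c + \<epsilon> / 2)) < ln_ereal (rate_prob n B) / ereal (real n)"
    unfolding le_Liminf_iff by blast
  have "(\<lambda>n. (real n + 1) * exp (- (real n * (\<epsilon> / 2)))) \<longlonglongrightarrow> 0"
    using \<open>0 < \<epsilon>\<close> by real_asymp
  then have ev1: "\<forall>\<^sub>F n in sequentially. (real n + 1) * exp (- (real n * (\<epsilon> / 2))) < \<kappa>"
    using \<kappa>(1) by (rule order_tendstoD)
  have "(\<lambda>n. 4 / real n) \<longlonglongrightarrow> 0" by real_asymp
  then have ev2: "\<forall>\<^sub>F n in sequentially. 4 / real n < \<epsilon> / 2"
    by (rule order_tendstoD) (use \<open>0 < \<epsilon>\<close> in simp)
  have "\<forall>\<^sub>F n in sequentially. 0 < n \<and> ereal (- (c + \<epsilon> / 2)) < ln_ereal (rate_prob n B) / ereal (real n) \<and>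
      (real n + 1) * exp (- (real n * (\<epsilon> / 2))) < \<kappa> \<and> 4 / real n < \<epsilon> / 2"
    by (intro eventually_conj ev ev1 ev2 eventually_gt_at_top)
  then obtain n where n: "0 < n" "ereal (- (c + \<epsilon> / 2)) < ln_ereal (rate_prob n B) / ereal (real n)"
    "(real n + 1) * exp (- (real n * (\<epsilon> / 2))) < \<kappa>" "4 / real n < \<epsilon> / 2"
    by (auto dest!: eventually_happens)
  have p: "0 < rate_prob n B"
    using n(1,2) by (auto simp: ln_ereal_def split: if_splits)
  have "- (c + \<epsilon> / 2) < ln (rate_prob n B) / real n"
    using n(1,2) p by (simp add: ln_ereal_def)
  then have "- (real n * (c + \<epsilon> / 2)) < ln (rate_prob n B)"
    using n(1) by (simp add: field_simps)
  then have p_lower: "exp (- (real n * (c + \<epsilon> / 2))) < rate_prob n B"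
    using p by (simp flip: exp_less_cancel_iff[of _ "ln (rate_prob n B)"])
  obtain j where j: "j \<le> n" "real j / real n \<in> B" "rate_prob n B \<le> (real n + 1) * length_prob n j"
    using rate_prob_attained[OF p] by blast
  \<comment> \<open>The four anchoring letters shift the slope by at most
    \<open>4 / n\<close>.\<close>
  have "real (j + 4) / real (n + 4) - real j / real n =
      ((real j + 4) * real n - real j * (real n + 4)) / ((real n + 4) * real n)"
    using n(1) by (subst diff_frac_eq) auto
  also have "(real j + 4) * real n - real j * (real n + 4) = 4 * (real n - real j)"
    by (simp add: algebra_simps)
  finally have "\<bar>real (j + 4) / real (n + 4) - real j / real n\<bar> = 4 * (real n - real j) / ((real n + 4) * real n)"
    using j(1) by simp
  also have "\<dots> \<le> 4 * (real n + 4) / ((real n + 4) * real n)"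
    by (intro divide_right_mono) auto
  also have "\<dots> = 4 / real n"
    by (subst mult.commute, rule nonzero_mult_divide_mult_cancel_left) simp
  finally have "\<bar>real (j + 4) / real (n + 4) - real j / real n\<bar> < \<epsilon> / 2"
    using n(4) by (rule le_less_trans)
  moreover have "\<bar>real j / real n - q\<bar> < \<epsilon> / 2" using j(2) unfolding B_def mem_ball dist_real_def
    by (subst abs_minus_commute)
  ultimately have near: "\<bar>real (j + 4) / real (n + 4) - q\<bar> < \<epsilon>"
    by (simp only: abs_less_iff) argo
  have "exp (- (real (n + 4) * (c + \<epsilon>))) \<le> exp (- (real n * (c + \<epsilon> / 2))) * exp (- (real n * (\<epsilon> / 2)))"
    unfolding exp_add[symmetric] using \<open>0 \<le> c\<close> \<open>0 < \<epsilon>\<close> by (simp add: algebra_simps)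
  also have "\<dots> \<le> ((real n + 1) * length_prob n j) * exp (- (real n * (\<epsilon> / 2)))"
    using p_lower j(3) by (intro mult_right_mono) auto
  also have "\<dots> = length_prob n j * ((real n + 1) * exp (- (real n * (\<epsilon> / 2))))"
    by (simp add: mult_ac)
  also have "\<dots> \<le> length_prob n j * \<kappa>"
    using n(3) by (intro mult_left_mono) (auto simp: length_prob_def)
  also have "\<dots> \<le> anchor_prob (n + 4) (j + 4)" using \<kappa>(2) by (simp add: mult.commute)
  finally show ?thesis using near by (intro that[of "n + 4" "j + 4"]) auto
qed

text \<open>Mixing a few blocks of slope about \<open>C\<close> into blocks of slope about \<open>q\<close> makes the latter
  supercritical even when \<open>L q = h\<close>.\<close>

lemma types_dense:
  assumes "0 < h" "L q \<le> ereal h" "0 \<le> q" "q \<le> 1" "0 < \<epsilon>" and L_C: "L C = 0"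
  obtains l j where "(l, j) \<in> types h" "\<bar>real j / real l - q\<bar> < \<epsilon>"
proof -
  \<comment> \<open>\<open>K\<close> is the ratio of the time spent in blocks of slope about
    \<open>q\<close> to the time spent in blocks taken near \<open>C\<close>. With
    \<open>K \<ge> 2 / \<epsilon>\<close> the latter disturb the slope by less than
    \<open>\<epsilon> / 2\<close>.\<close>
  define K where "K = nat \<lceil>2 / \<epsilon>\<rceil> + 1"
  have "2 / \<epsilon> \<le> real K" unfolding K_def by linarith
  then have K: "0 < K" "2 \<le> real K * \<epsilon>" using \<open>0 < \<epsilon>\<close> by (auto simp: K_def field_simps)
  \<comment> \<open>\<open>e \<le> \<epsilon> / 2\<close> controls the slope of the main blocks;
    \<open>K * e \<le> h / 4\<close> keeps their deficit below the surplus \<open>h / 2\<close> that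
    the blocks near \<open>C\<close> contribute.\<close>
  define e where "e = min (\<epsilon> / 2) (h / (4 * real K))"
  have e: "0 < e" "e \<le> \<epsilon> / 2" "real K * e \<le> h / 4"
  proof -
    show "0 < e" "e \<le> \<epsilon> / 2" using assms K by (auto simp: e_def)
    have "real K * e \<le> real K * (h / (4 * real K))" by (intro mult_left_mono) (auto simp: e_def)
    then show "real K * e \<le> h / 4" using K by simp
  qed
  obtain n1 j1 where 1: "0 < n1" "\<bar>real j1 / real n1 - q\<bar> < e" "exp (- (real n1 * (h + e))) \<le> anchor_prob n1 j1"
    using anchor_prob_near[OF assms(2) e(1)] by blast
  obtain n2 j2 where 2: "0 < n2" "exp (- (real n2 * (h / 2))) \<le> anchor_prob n2 j2"
    using anchor_prob_near[of C 0 "h / 2"] L_C assms(1) by (metis add_0 half_gt_zero order_refl zero_ereal_def)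
  have "0 < anchor_prob n2 j2" using 2(2) by (metis exp_gt_zero less_le_trans)
  then have "j2 \<le> n2" by (rule anchor_prob_pos)
  \<comment> \<open>The multiplicities \<open>K * n2\<close> and \<open>n1\<close> make the two
    kinds of blocks fill lengths in the ratio \<open>K\<close> to 1.\<close>
  define l where "l = K * n2 * n1 + n1 * n2"
  define j where "j = K * n2 * j1 + n1 * j2"
  have nonneg: "0 \<le> anchor_prob n j" for n j by (simp add: anchor_prob_def)
  have "exp (- (real n1 * (h + e))) ^ (K * n2) * exp (- (real n2 * (h / 2))) ^ n1 \<le>
      anchor_prob n1 j1 ^ (K * n2) * anchor_prob n2 j2 ^ n1"
    using 1 2 nonneg by (intro mult_mono power_mono) auto
  also have "\<dots> \<le> anchor_prob (K * n2 * n1) (K * n2 * j1) * anchor_prob (n1 * n2) (n1 * j2)"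
    using 1 2 K nonneg by (intro mult_mono anchor_prob_power zero_le_power) auto
  also have "\<dots> \<le> anchor_prob l j"
    unfolding l_def j_def by (rule anchor_prob_mult)
  finally have lower: "exp (- (real n1 * (h + e))) ^ (K * n2) * exp (- (real n2 * (h / 2))) ^ n1 \<le> anchor_prob l j" .
  have "real l * h + - (real n1 * (h + e)) * real (K * n2) + - (real n2 * (h / 2)) * real n1 =
      real n1 * real n2 * (h / 2 - real K * e)"
    by (simp add: l_def algebra_simps)
  moreover have "0 < real n1 * real n2 * (h / 2 - real K * e)"
    using 1 2 e assms(1) by (intro mult_pos_pos) auto
  ultimately have "1 < exp (real l * h + - (real n1 * (h + e)) * real (K * n2) + - (real n2 * (h / 2)) * real n1)"
    by simp
  also have "\<dots> = exp (real l * h) * (exp (- (real n1 * (h + e))) ^ (K * n2) * exp (- (real n2 * (h / 2))) ^ n1)"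
    by (simp only: exp_add exp_of_nat_mult[symmetric] mult_ac)
  also have "\<dots> \<le> exp (real l * h) * anchor_prob l j"
    using lower by simp
  finally have type: "(l, j) \<in> types h" by (simp add: types_def)
  have "real j / real l - q = (real K * (real j1 / real n1 - q) + (real j2 / real n2 - q)) / (real K + 1)"
  proof -
    have "real l = real n1 * real n2 * (real K + 1)" by (simp add: l_def algebra_simps)
    moreover have "real j = real n1 * real n2 * (real K * (real j1 / real n1) + real j2 / real n2)"
      using 1 2 by (simp add: j_def field_simps)
    ultimately have "real j / real l = (real K * (real j1 / real n1) + real j2 / real n2) / (real K + 1)"
      using 1 2 by simp
    moreover have "(real K * x + y) / (real K + 1) - q = (real K * (x - q) + (y - q)) / (real K + 1)" for x y
      by (simp add: field_simps)
    ultimately show ?thesis by (simp only:)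
  qed
  moreover have "\<bar>real K * (real j1 / real n1 - q) + (real j2 / real n2 - q)\<bar> < \<epsilon> * (real K + 1)"
  proof -
    have "\<bar>real K * (real j1 / real n1 - q)\<bar> \<le> real K * (\<epsilon> / 2)"
      using 1 e unfolding abs_mult by (intro mult_mono) auto
    moreover have "\<bar>real j2 / real n2 - q\<bar> \<le> 1"
    proof -
      have "0 \<le> real j2 / real n2" "real j2 / real n2 \<le> 1"
        using \<open>j2 \<le> n2\<close> 2 by auto
      then show ?thesis using assms(3,4) by linarith
    qed
    ultimately have "\<bar>real K * (real j1 / real n1 - q) + (real j2 / real n2 - q)\<bar> \<le> real K * (\<epsilon> / 2) + 1"
      by linarith
    also have "\<dots> < \<epsilon> * (real K + 1)" using K \<open>0 < \<epsilon>\<close> by (simp add: algebra_simps)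
    finally show ?thesis .
  qed
  ultimately have "\<bar>real j / real l - q\<bar> < \<epsilon>"
    by (simp add: abs_divide divide_less_eq)
  with type show ?thesis by (rule that)
qed

text \<open>Lower semicontinuity keeps \<open>L\<close> above a level beyond \<open>c\<close> near
  \<open>q\<close>, so by the upper large deviation bound the speed probabilities there are
  eventually at most \<open>exp (- n c)\<close>, and \<open>h < c\<close>. Rational endpoints keep
  the number of events countable.\<close>

lemma rate_prob_summable:
  assumes "ereal c < L q" "h < c"
  obtains a b where "a \<in> \<rat>" "b \<in> \<rat>" "a < q" "q < b"
    "(\<Sum>n. ennreal (exp (real n * h) * rate_prob n {a..b})) < \<infinity>"
proof -
  obtain c' where c': "ereal c < c'" "c' < L q" using assms(1) dense by blast
  then obtain k where k: "c' = ereal k" by (cases c') auto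
  have "open (- {x. L x \<le> c'})" using L_lsc by (simp add: open_Compl)
  moreover have "q \<in> - {x. L x \<le> c'}" using c' by simp
  ultimately obtain e where e: "0 < e" "ball q e \<subseteq> - {x. L x \<le> c'}"
    using open_contains_ball by blast
  obtain a where a: "a \<in> \<rat>" "q - e < a" "a < q" using Rats_dense_in_real[of "q - e" q] e by auto
  obtain b where b: "b \<in> \<rat>" "q < b" "b < q + e" using Rats_dense_in_real[of q "q + e"] e by auto
  have "c' \<le> (INF x\<in>{a..b}. L x)"
  proof (rule INF_greatest)
    fix x assume "x \<in> {a..b}"
    then have "x \<in> ball q e" using a b by (auto simp: dist_real_def abs_if)
    then show "c' \<le> L x" using e by auto
  qed
  then have "- (INF x\<in>{a..b}. L x) \<le> - c'" by (simp only: ereal_minus_le_minus)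
  then have "limsup (\<lambda>n. ln_ereal (rate_prob n {a..b}) / ereal (real n)) \<le> - c'"
    by (rule order_trans[OF ldp_closed[OF closed_atLeastAtMost]])
  moreover have "- c' < ereal (- c)" using c' by (simp add: k)
  ultimately have "\<forall>\<^sub>F n in sequentially. ln_ereal (rate_prob n {a..b}) / ereal (real n) < ereal (- c)"
    unfolding Limsup_le_iff by blast
  then have ev: "\<forall>\<^sub>F n in sequentially. rate_prob n {a..b} \<le> exp (- (real n * c))"
    using eventually_gt_at_top[of 0]
  proof eventually_elim
    case (elim n)
    show ?case
    proof (cases "rate_prob n {a..b} \<le> 0")
      case False
      then have "ln (rate_prob n {a..b}) / real n < - c"
        using elim by (simp add: ln_ereal_def)
      then have "ln (rate_prob n {a..b}) \<le> - (real n * c)"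
        using elim(2) by (simp add: field_simps)
      then show ?thesis using False by (simp flip: exp_le_cancel_iff[of "ln (rate_prob n {a..b})"])
    qed (meson exp_ge_zero order_trans)
  qed
  have "summable (\<lambda>n. exp (h - c) ^ n)"
    using assms by (intro summable_geometric) simp
  then have "summable (\<lambda>n. exp (real n * h) * rate_prob n {a..b})"
  proof (rule summable_comparison_test_ev[rotated])
    show "\<forall>\<^sub>F n in sequentially. norm (exp (real n * h) * rate_prob n {a..b}) \<le> exp (h - c) ^ n"
      using ev
    proof eventually_elim
      case (elim n)
      have "exp (real n * h) * rate_prob n {a..b} \<le> exp (real n * h) * exp (- (real n * c))"
        using elim by simp
      also have "\<dots> = exp (h - c) ^ n"
        by (simp add: exp_of_nat_mult[symmetric] exp_add[symmetric] algebra_simps)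
      finally show ?case by (simp add: rate_prob_def)
    qed
  qed
  then have "(\<Sum>n. ennreal (exp (real n * h) * rate_prob n {a..b})) < \<infinity>"
    by (subst suminf_ennreal2) (auto simp: rate_prob_def)
  with a b show ?thesis by (intro that) auto
qed

end

section \<open>Iterating concave functions\<close>

text \<open>Both iterations converge to the largest fixed point of \<open>g\<close>: a concave \<open>g\<close> lying above the
  diagonal near 0 has only one positive fixed point.\<close>

lemma concave_iterates:
  fixes g :: "real \<Rightarrow> real"
  assumes mono: "\<And>x y. 0 \<le> x \<Longrightarrow> x \<le> y \<Longrightarrow> y \<le> 1 \<Longrightarrow> g x \<le> g y"
    and bound: "\<And>x. 0 \<le> x \<Longrightarrow> x \<le> 1 \<Longrightarrow> 0 \<le> g x \<and> g x \<le> 1"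
    and cont: "continuous_on {0..1} g"
    and conc: "\<And>x y t. x \<in> {0..1} \<Longrightarrow> y \<in> {0..1} \<Longrightarrow> t \<in> {0..1} \<Longrightarrow>
      (1 - t) * g x + t * g y \<le> g ((1 - t) * x + t * y)"
    and "0 < \<delta>" and above: "\<And>x. 0 < x \<Longrightarrow> x < \<delta> \<Longrightarrow> x \<le> 1 \<Longrightarrow> x < g x"
    and \<eta>: "0 < \<eta>" "\<eta> \<le> 1"
  shows "(\<lambda>k. (g ^^ k) 1 - (g ^^ k) \<eta>) \<longlonglongrightarrow> 0"
    and "\<exists>c>0. \<forall>k. c \<le> (g ^^ k) \<eta>"
proof -
  \<comment> \<open>Started below \<open>\<eta>\<close>, and in the region where \<open>g\<close>
    exceeds the identity, the iterates of \<open>z\<close> increase and bound those of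
    \<open>\<eta>\<close> from below.\<close>
  define z where "z = min \<eta> (\<delta> / 2)"
  have z: "0 < z" "z \<le> \<eta>" "z < g z" "z \<le> 1"
    using \<eta> \<open>0 < \<delta>\<close> by (auto simp: z_def intro!: above)
  have range: "0 \<le> (g ^^ k) x \<and> (g ^^ k) x \<le> 1" if "0 \<le> x" "x \<le> 1" for k x
    using that by (induction k) (auto simp: bound)
  have le: "(g ^^ k) x \<le> (g ^^ k) y" if "0 \<le> x" "x \<le> y" "y \<le> 1" for k x y
  proof (induction k)
    case (Suc k)
    then show ?case using range[of x k] range[of y k] that by (auto intro!: mono)
  qed (use that in simp)
  have dec: "decseq (\<lambda>k. (g ^^ k) 1)"
  proof (rule decseq_SucI)
    show "(g ^^ Suc k) 1 \<le> (g ^^ k) 1" for k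
      using le[of "g 1" 1 k] bound[of 1] by (simp add: funpow_swap1)
  qed
  have inc: "incseq (\<lambda>k. (g ^^ k) z)"
  proof (rule incseq_SucI)
    show "(g ^^ k) z \<le> (g ^^ Suc k) z" for k
      using le[of z "g z" k] bound[of z] z by (simp add: funpow_swap1)
  qed
  obtain x where x: "(\<lambda>k. (g ^^ k) 1) \<longlonglongrightarrow> x"
    by (rule decseq_convergent[OF dec, of 0]) (use range[of 1] in auto)
  obtain y where y: "(\<lambda>k. (g ^^ k) z) \<longlonglongrightarrow> y"
    by (rule incseq_convergent[OF inc, of 1]) (use range[of z] z in auto)
  have zk: "z \<le> (g ^^ k) z" for k
    using incseqD[OF inc, of 0 k] by simp
  have zy: "z \<le> y"
    by (rule LIMSEQ_le_const[OF y]) (use zk in auto)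
  have yx: "y \<le> x"
    by (rule LIMSEQ_le[OF y x]) (use le[of z 1] z in auto)
  have x1: "x \<le> 1"
    by (rule LIMSEQ_le_const2[OF x]) (use range[of 1] in auto)
  have fixpoint: "g l = l" if l: "(\<lambda>k. (g ^^ k) w) \<longlonglongrightarrow> l" "l \<in> {0..1}" "w \<in> {0..1}" for l w
  proof -
    have "(\<lambda>k. g ((g ^^ k) w)) \<longlonglongrightarrow> g l"
      using range[of w] l
      by (intro continuous_on_tendsto_compose[OF cont l(1)]) auto
    then show ?thesis
      using LIMSEQ_unique[OF LIMSEQ_Suc[OF l(1)], of "g l"] by simp
  qed
  have range_xyz: "x \<in> {0..1}" "y \<in> {0..1}" "z \<in> {0..1}" "(1::real) \<in> {0..1}"
    using z zy yx x1 by auto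
  have gx: "g x = x" and gy: "g y = y"
    by (rule fixpoint[OF x range_xyz(1,4)], rule fixpoint[OF y range_xyz(2,3)])
  have "y = x"
  proof (rule ccontr)
    assume "y \<noteq> x"
    then have "y < x" using yx by simp
    \<comment> \<open>If the limits differed, the smaller fixed point \<open>y\<close> would be a
      proper convex combination of the fixed point \<open>x\<close> and a point \<open>v\<close>
      with \<open>v < g v\<close>, and concavity would force \<open>y < g y\<close>.\<close>
    define v where "v = min (y / 2) (\<delta> / 2)"
    have v: "0 < v" "v < y" "v < \<delta>"
      using zy z \<open>0 < \<delta>\<close> by (auto simp: v_def min_def)
    then have "v < g v" using x1 yx by (intro above) auto
    note v = v(1,2) this
    define t where "t = (y - v) / (x - v)"
    have t: "0 < t" "t < 1" using v \<open>y < x\<close> by (auto simp: t_def)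
    have "t * (x - v) = y - v" using v \<open>y < x\<close> by (simp add: t_def)
    then have ty: "(1 - t) * v + t * x = y" by (simp add: algebra_simps)
    have "(1 - t) * v + t * x < (1 - t) * g v + t * g x"
      using t v gx by simp
    also have "\<dots> \<le> g ((1 - t) * v + t * x)"
      using v t x1 \<open>y < x\<close> by (intro conc) auto
    finally show False using ty gy by simp
  qed
  then have lim: "(\<lambda>k. (g ^^ k) 1 - (g ^^ k) z) \<longlonglongrightarrow> 0"
    using tendsto_diff[OF x y] by simp
  show "(\<lambda>k. (g ^^ k) 1 - (g ^^ k) \<eta>) \<longlonglongrightarrow> 0"
    by (rule tendsto_sandwich[OF _ _ tendsto_const lim])
      (use le[of \<eta> 1] le[of z \<eta>] \<eta> z in \<open>auto intro!: always_eventually\<close>)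
  show "\<exists>c>0. \<forall>k. c \<le> (g ^^ k) \<eta>"
  proof (intro exI[of _ z] conjI allI)
    show "z \<le> (g ^^ k) \<eta>" for k
      using zk[of k] le[of z \<eta> k] \<eta> z by linarith
  qed (use z in simp)
qed

section \<open>The Galton-Watson iteration\<close>

lemma power_convex:
  fixes a b t :: real
  assumes "0 \<le> a" "0 \<le> b" "0 \<le> t" "t \<le> 1"
  shows "((1 - t) * a + t * b) ^ n \<le> (1 - t) * a ^ n + t * b ^ n"
proof (induction n)
  case (Suc n)
  \<comment> \<open>Both factors have the same sign, since powers are monotone; this product is
    exactly the defect that appears in the induction step.\<close>
  have "0 \<le> (a - b) * (a ^ n - b ^ n)"
    using assms power_mono[of a b n] power_mono[of b a n]
    by (cases "a \<le> b") (auto simp: mult_nonpos_nonpos)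
  then have *: "0 \<le> t * (1 - t) * ((a - b) * (a ^ n - b ^ n))"
    using assms by simp
  have "((1 - t) * a + t * b) ^ Suc n \<le> ((1 - t) * a + t * b) * ((1 - t) * a ^ n + t * b ^ n)"
    using assms Suc by (auto intro!: mult_left_mono)
  also have "\<dots> = (1 - t) * a ^ Suc n + t * b ^ Suc n - t * (1 - t) * ((a - b) * (a ^ n - b ^ n))"
    by (simp add: algebra_simps)
  finally show ?case using * by linarith
qed simp

text \<open>A Bonferroni inequality for \<open>n\<close> independent events of probability
  \<open>x\<close>, with the number of pairs rounded up to \<open>n ^ 2\<close>.\<close>

lemma one_minus_power_lower:
  fixes x :: real
  assumes "0 \<le> x" "x \<le> 1"
  shows "real n * x - (real n)\<^sup>2 * x\<^sup>2 \<le> 1 - (1 - x) ^ n"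
proof (induction n)
  case (Suc n)
  have "0 \<le> (1 + real n) * x\<^sup>2 + (real n)\<^sup>2 * x\<^sup>2 * x"
    using assms by simp
  moreover have "(1 - x) * (1 - x) ^ n \<le> (1 - x) * (1 - real n * x + (real n)\<^sup>2 * x\<^sup>2)"
    using assms Suc by (intro mult_left_mono) auto
  ultimately show ?case
    by (simp add: algebra_simps power2_eq_square)
qed simp

context prob_space
begin

text \<open>If every child of an individual is kept with probability \<open>x\<close>, then \<open>some_kept K x\<close> is the
  probability that at least one of its \<open>K\<close> children is kept.\<close>

definition some_kept :: "('a \<Rightarrow> nat) \<Rightarrow> real \<Rightarrow> real" where
  "some_kept K x = expectation (\<lambda>\<omega>. 1 - (1 - x) ^ K \<omega>)"

lemma some_kept_iterates:
  assumes K [measurable]: "K \<in> measurable M (count_space UNIV)"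
    and mean: "1 < (\<integral>\<^sup>+\<omega>. of_nat (K \<omega>) \<partial>M)"
    and \<eta>: "0 < \<eta>" "\<eta> \<le> 1"
  shows "(\<lambda>k. (some_kept K ^^ k) 1 - (some_kept K ^^ k) \<eta>) \<longlonglongrightarrow> 0"
    and "\<exists>c>0. \<forall>k. c \<le> (some_kept K ^^ k) \<eta>"
proof -
  have pow: "0 \<le> (1 - x) ^ n" "(1 - x) ^ n \<le> 1" if "0 \<le> x" "x \<le> 1" for x :: real and n
    using that by (auto simp: power_le_one)
  have int: "integrable M (\<lambda>\<omega>. 1 - (1 - x) ^ K \<omega>)" if "0 \<le> x" "x \<le> 1" for x :: real
    by (rule integrable_const_bound[of _ 1]) (use pow[OF that] in auto)
  have mono: "some_kept K x \<le> some_kept K y" if "0 \<le> x" "x \<le> y" "y \<le> 1" for x y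
    unfolding some_kept_def using that
    by (intro integral_mono int) (auto intro!: power_mono)
  have bound: "0 \<le> some_kept K x \<and> some_kept K x \<le> 1" if "0 \<le> x" "x \<le> 1" for x
  proof
    show "0 \<le> some_kept K x"
      unfolding some_kept_def using pow[OF that] by (intro Bochner_Integration.integral_nonneg) auto
    have "some_kept K x \<le> expectation (\<lambda>_. 1)"
      unfolding some_kept_def using pow[OF that] by (intro integral_mono int that) auto
    then show "some_kept K x \<le> 1" by (simp add: prob_space)
  qed
  have cont: "continuous_on {0..1} (some_kept K)"
  proof (rule continuous_on_sequentiallyI)
    fix u :: "nat \<Rightarrow> real" and a
    assume u: "\<forall>n. u n \<in> {0..1}" "a \<in> {0..1}" "u \<longlonglongrightarrow> a"
    show "(\<lambda>n. some_kept K (u n)) \<longlonglongrightarrow> some_kept K a"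
      unfolding some_kept_def
    proof (rule integral_dominated_convergence[where w = "\<lambda>_. 1"])
      show "AE \<omega> in M. (\<lambda>n. 1 - (1 - u n) ^ K \<omega>) \<longlonglongrightarrow> 1 - (1 - a) ^ K \<omega>"
        using u by (auto intro!: tendsto_intros)
      show "AE \<omega> in M. norm (1 - (1 - u n) ^ K \<omega>) \<le> 1" for n
        using u pow[of "u n"] by auto
    qed auto
  qed
  have conc: "(1 - t) * some_kept K x + t * some_kept K y \<le> some_kept K ((1 - t) * x + t * y)"
    if "x \<in> {0..1}" "y \<in> {0..1}" "t \<in> {0..1}" for x y t
  proof -
    have "(1 - t) * x + t * y \<le> (1 - t) * 1 + t * 1"
      using that by (intro add_mono mult_left_mono) auto
    then have xy: "(1 - t) * x + t * y \<in> {0..1}" using that by auto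
    have "(1 - t) * some_kept K x + t * some_kept K y =
        expectation (\<lambda>\<omega>. (1 - t) * (1 - (1 - x) ^ K \<omega>) + t * (1 - (1 - y) ^ K \<omega>))"
      using that by (simp add: some_kept_def int)
    also have "\<dots> \<le> some_kept K ((1 - t) * x + t * y)"
      unfolding some_kept_def
    proof (intro integral_mono)
      fix \<omega>
      have "1 - ((1 - t) * x + t * y) = (1 - t) * (1 - x) + t * (1 - y)"
        by (simp add: algebra_simps)
      then show "(1 - t) * (1 - (1 - x) ^ K \<omega>) + t * (1 - (1 - y) ^ K \<omega>) \<le>
          1 - (1 - ((1 - t) * x + t * y)) ^ K \<omega>"
        using power_convex[of "1 - x" "1 - y" t "K \<omega>"] that by (simp add: algebra_simps)
    qed (use that xy int in auto)
    finally show ?thesis .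
  qed
  \<comment> \<open>Truncation at \<open>m\<close> keeps the mean above 1 and bounds the quadratic
    error of \<open>one_minus_power_lower\<close>, whose untruncated expectation may be
    infinite.\<close>
  obtain m a where m: "0 < m" and a: "1 < a" "a = expectation (\<lambda>\<omega>. real (min (K \<omega>) m))"
  proof -
    have "(SUP m. \<integral>\<^sup>+\<omega>. of_nat (min (K \<omega>) m) \<partial>M) = (\<integral>\<^sup>+\<omega>. (SUP m. of_nat (min (K \<omega>) m)) \<partial>M)"
      by (intro nn_integral_monotone_convergence_SUP[symmetric])
        (auto simp: incseq_def le_fun_def intro!: of_nat_mono)
    also have "\<dots> = (\<integral>\<^sup>+\<omega>. of_nat (K \<omega>) \<partial>M)"
    proof (intro nn_integral_cong antisym SUP_least)
      fix \<omega>
      show "of_nat (K \<omega>) \<le> (SUP m. of_nat (min (K \<omega>) m) :: ennreal)"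
        by (rule SUP_upper2[of "K \<omega>"]) auto
    qed (auto intro!: of_nat_mono)
    finally have "1 < (SUP m. \<integral>\<^sup>+\<omega>. of_nat (min (K \<omega>) m) \<partial>M)"
      using mean by simp
    then obtain m where m: "1 < (\<integral>\<^sup>+\<omega>. of_nat (min (K \<omega>) m) \<partial>M)"
      by (auto simp only: less_SUP_iff)
    have i: "integrable M (\<lambda>\<omega>. real (min (K \<omega>) m))"
      by (rule integrable_const_bound[of _ "real m"]) auto
    have "(\<integral>\<^sup>+\<omega>. of_nat (min (K \<omega>) m) \<partial>M) = (\<integral>\<^sup>+\<omega>. ennreal (real (min (K \<omega>) m)) \<partial>M)"
      by (simp add: ennreal_of_nat_eq_real_of_nat)
    also have "\<dots> = ennreal (expectation (\<lambda>\<omega>. real (min (K \<omega>) m)))"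
      using i by (intro nn_integral_eq_integral) auto
    finally have "1 < expectation (\<lambda>\<omega>. real (min (K \<omega>) m))"
      using m ennreal_less_iff[of 1] by simp
    moreover from m have "0 < m" by (cases m) auto
    ultimately show ?thesis using that by blast
  qed
  \<comment> \<open>Below \<open>(a - 1) / m ^ 2\<close> the linear gain \<open>(a - 1) * x\<close>
    beats the quadratic error.\<close>
  have above: "x < some_kept K x" if x: "0 < x" "x < (a - 1) / (real m)\<^sup>2" "x \<le> 1" for x
  proof -
    have i: "integrable M (\<lambda>\<omega>. real (min (K \<omega>) m))"
      by (rule integrable_const_bound[of _ "real m"]) auto
    have "x * ((real m)\<^sup>2 * x) < x * (a - 1)"
      using x m by (intro mult_strict_left_mono) (auto simp: field_simps)
    then have "x < a * x - (real m)\<^sup>2 * x\<^sup>2"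
      by (simp add: algebra_simps power2_eq_square)
    also have "\<dots> = expectation (\<lambda>\<omega>. real (min (K \<omega>) m) * x - (real m)\<^sup>2 * x\<^sup>2)"
      using i a by (simp add: prob_space)
    also have "\<dots> \<le> some_kept K x"
      unfolding some_kept_def
    proof (intro integral_mono)
      fix \<omega>
      let ?n = "min (K \<omega>) m"
      have "(real ?n)\<^sup>2 * x\<^sup>2 \<le> (real m)\<^sup>2 * x\<^sup>2"
        by (intro mult_right_mono power_mono) auto
      moreover have "(1 - x) ^ K \<omega> \<le> (1 - x) ^ ?n"
        using x by (intro power_decreasing) auto
      ultimately show "real ?n * x - (real m)\<^sup>2 * x\<^sup>2 \<le> 1 - (1 - x) ^ K \<omega>"
        using one_minus_power_lower[of x ?n] x by linarith
    qed (use i int x in auto)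
    finally show ?thesis .
  qed
  have \<delta>: "0 < (a - 1) / (real m)\<^sup>2" using a m by simp
  show "(\<lambda>k. (some_kept K ^^ k) 1 - (some_kept K ^^ k) \<eta>) \<longlonglongrightarrow> 0"
    by (rule concave_iterates(1)[OF mono bound cont conc \<delta> above \<eta>])
  show "\<exists>c>0. \<forall>k. c \<le> (some_kept K ^^ k) \<eta>"
    by (rule concave_iterates(2)[OF mono bound cont conc \<delta> above \<eta>])
qed

end

section \<open>Labelled trees\<close>

text \<open>A labelled tree is coded by the function that maps each vertex to the list of labels of the
  edges to its children; the length of this list is the number of children.\<close>

definition tree :: "(nat list \<Rightarrow> 'e list) \<Rightarrow> nat list set" where
  "tree \<omega> = {u. \<forall>k<length u. u ! k < length (\<omega> (take k u))}"

definition edges :: "(nat list \<Rightarrow> 'e list) \<Rightarrow> nat list \<Rightarrow> 'e list" where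
  "edges \<omega> u = map (\<lambda>k. \<omega> (take k u) ! (u ! k)) [0..<length u]"

definition shift :: "nat list \<Rightarrow> (nat list \<Rightarrow> 'b) \<Rightarrow> nat list \<Rightarrow> 'b" where
  "shift v \<omega> u = \<omega> (v @ u)"

definition blocks :: "nat \<Rightarrow> 'e list set \<Rightarrow> (nat list \<Rightarrow> 'e list) \<Rightarrow> nat list set" where
  "blocks l A \<omega> = {w \<in> tree \<omega>. length w = l \<and> edges \<omega> w \<in> A}"

text \<open>The \<open>k\<close>-fold iterate asks for \<open>k\<close> consecutive blocks ending at
  a vertex whose subtree lies in \<open>G\<close>. It describes generation \<open>k\<close> of an
  embedded Galton-Watson process in which one generation takes \<open>l\<close> levels.\<close>

definition reach :: "nat \<Rightarrow> 'e list set \<Rightarrow> (nat list \<Rightarrow> 'e list) set \<Rightarrow> (nat list \<Rightarrow> 'e list) set" where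
  "reach l A G = {\<omega>. \<exists>w\<in>blocks l A \<omega>. shift w \<omega> \<in> G}"

text \<open>Survival to every finite generation, a decreasing countable intersection. Infinite rays
  come later from switching types, not from a compactness argument on this set.\<close>

definition survival :: "nat \<Rightarrow> 'e list set \<Rightarrow> (nat list \<Rightarrow> 'e list) set" where
  "survival l A = (\<Inter>k. (reach l A ^^ k) UNIV)"

lemma shift_Nil [simp]: "shift [] \<omega> = \<omega>"
  by (simp add: shift_def fun_eq_iff)

lemma shift_shift [simp]: "shift w (shift v \<omega>) = shift (v @ w) \<omega>"
  by (simp add: shift_def fun_eq_iff)

lemma Nil_tree [simp]: "[] \<in> tree \<omega>"
  by (simp add: tree_def)

lemma edges_Nil [simp]: "edges \<omega> [] = []"
  by (simp add: edges_def)

lemma length_edges [simp]: "length (edges \<omega> u) = length u"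
  by (simp add: edges_def)

lemma all_less_add: "(\<forall>k<m + n. P k) \<longleftrightarrow> (\<forall>k<m. P k) \<and> (\<forall>k<n. P (m + k))" for m n :: nat
  by (metis add_less_cancel_left le_add_diff_inverse not_less trans_less_add1)

lemma tree_append: "v @ w \<in> tree \<omega> \<longleftrightarrow> v \<in> tree \<omega> \<and> w \<in> tree (shift v \<omega>)"
  by (simp add: tree_def shift_def all_less_add nth_append)

lemma edges_append: "edges \<omega> (v @ w) = edges \<omega> v @ edges (shift v \<omega>) w"
  by (rule nth_equalityI) (auto simp: edges_def shift_def nth_append)

lemma tree_take: "u \<in> tree \<omega> \<Longrightarrow> take k u \<in> tree \<omega>"
  using tree_append[of "take k u" "drop k u" \<omega>] by simp

lemma edges_take: "edges \<omega> (take k u) = take k (edges \<omega> u)"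
  using edges_append[of \<omega> "take k u" "drop k u"] by (cases "k \<le> length u") auto

lemma finite_level: "finite {w \<in> tree \<omega>. length w = l}"
proof (induction l)
  case (Suc l)
  have "{w \<in> tree \<omega>. length w = Suc l} \<subseteq> (\<Union>v\<in>{w \<in> tree \<omega>. length w = l}. (\<lambda>k. v @ [k]) ` {..<length (\<omega> v)})"
  proof
    fix w assume w: "w \<in> {w \<in> tree \<omega>. length w = Suc l}"
    then obtain v k where "w = v @ [k]" by (cases w rule: rev_cases) auto
    then show "w \<in> (\<Union>v\<in>{w \<in> tree \<omega>. length w = l}. (\<lambda>k. v @ [k]) ` {..<length (\<omega> v)})"
      using w by (auto simp: tree_append) (auto simp: tree_def shift_def)
  qed
  then show ?case using Suc by (auto intro: finite_subset)
qed auto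

lemma finite_blocks: "finite (blocks l A \<omega>)"
  by (rule finite_subset[OF _ finite_level[of \<omega> l]]) (auto simp: blocks_def)

lemma blocks_cong:
  assumes "\<And>u. length u < l \<Longrightarrow> \<omega> u = \<omega>' u"
  shows "blocks l A \<omega> = blocks l A \<omega>'"
proof -
  have "w \<in> tree \<omega> \<longleftrightarrow> w \<in> tree \<omega>'" "edges \<omega> w = edges \<omega>' w" if "length w = l" for w
    using that assms by (auto simp: tree_def edges_def)
  then show ?thesis by (auto simp: blocks_def)
qed

lemma reach_mono: "G \<subseteq> H \<Longrightarrow> reach l A G \<subseteq> reach l A H"
  by (auto simp: reach_def)

lemma reach_funpow_mono: "G \<subseteq> H \<Longrightarrow> (reach l A ^^ k) G \<subseteq> (reach l A ^^ k) H"
  by (induction k) (auto dest: reach_mono)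

lemma reach_funpow_antimono:
  assumes "i \<le> k"
  shows "(reach l A ^^ k) UNIV \<subseteq> (reach l A ^^ i) UNIV"
  using assms
proof (induction k rule: dec_induct)
  case (step k)
  have "(reach l A ^^ Suc k) UNIV = (reach l A ^^ k) (reach l A UNIV)" by (simp add: funpow_swap1)
  then show ?case using step.IH reach_funpow_mono[of "reach l A UNIV" UNIV k l A] by auto
qed simp


section \<open>Families of independent labels\<close>

lemma measurable_map_coordinates:
  fixes D :: "'i \<Rightarrow> ('a::countable) pmf"
  assumes "set us \<subseteq> I"
  shows "(\<lambda>\<omega>. map \<omega> us) \<in> measurable (\<Pi>\<^sub>M i\<in>I. measure_pmf (D i)) (count_space UNIV)"
  unfolding measurable_count_space_eq2_countable
proof (intro conjI ballI)
  fix xs :: "'a list"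
  let ?Q = "\<Pi>\<^sub>M i\<in>I. measure_pmf (D i)"
  show "(\<lambda>\<omega>. map \<omega> us) -` {xs} \<inter> space ?Q \<in> sets ?Q"
  proof (cases "length xs = length us")
    case True
    then have "(\<lambda>\<omega>. map \<omega> us) -` {xs} \<inter> space ?Q = {\<omega>\<in>space ?Q. \<forall>k<length us. \<omega> (us ! k) \<in> {xs ! k}}"
      by (auto simp: list_eq_iff_nth_eq)
    also have "\<dots> \<in> sets ?Q"
    proof -
      have "{\<omega>\<in>space ?Q. \<forall>k\<in>{..<length us}. \<omega> (us ! k) \<in> {xs ! k}} \<in> sets ?Q"
      proof (rule sets.sets_Collect_finite_All)
        fix k assume "k \<in> {..<length us}"
        then have "us ! k \<in> I" using assms by auto
        then show "{\<omega>\<in>space ?Q. \<omega> (us ! k) \<in> {xs ! k}} \<in> sets ?Q"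
          by (rule sets_Collect_single) simp
      qed simp
      then show ?thesis by (simp only: Ball_def lessThan_iff)
    qed
    finally show ?thesis .
  next
    case False
    then have "(\<lambda>\<omega>. map \<omega> us) -` {xs} \<inter> space ?Q = {}" by auto
    then show ?thesis by simp
  qed
qed simp

lemma pred_map_coordinates:
  fixes D :: "'i \<Rightarrow> ('a::countable) pmf"
  assumes "set us \<subseteq> I"
  shows "Measurable.pred (\<Pi>\<^sub>M i\<in>I. measure_pmf (D i)) (\<lambda>\<omega>. P (map \<omega> us))"
  by (rule measurable_compose[OF measurable_map_coordinates[OF assms]]) simp

text \<open>The index set \<open>I\<close> is general because \<open>prob_blocks_miss\<close> needs
  these events on the product over the first \<open>l\<close> levels alone.\<close>

lemma pred_blocks:
  fixes D :: "nat list \<Rightarrow> ('e::countable) list pmf"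
  assumes "\<And>u. length u < l \<Longrightarrow> u \<in> I"
  shows "Measurable.pred (\<Pi>\<^sub>M i\<in>I. measure_pmf (D i)) (\<lambda>\<omega>. w \<in> blocks l A \<omega>)"
proof (cases "length w = l")
  case True
  let ?us = "map (\<lambda>k. take k w) [0..<length w]"
  let ?P = "\<lambda>ls. (\<forall>k<length w. w ! k < length (ls ! k)) \<and> map (\<lambda>k. ls ! k ! (w ! k)) [0..<length w] \<in> A"
  have "edges \<omega> w = map (\<lambda>k. map \<omega> ?us ! k ! (w ! k)) [0..<length w]" for \<omega> :: "nat list \<Rightarrow> 'e list"
    by (simp add: edges_def)
  moreover have "w \<in> tree \<omega> \<longleftrightarrow> (\<forall>k<length w. w ! k < length (map \<omega> ?us ! k))" for \<omega> :: "nat list \<Rightarrow> 'e list"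
    by (simp add: tree_def)
  ultimately have "(\<lambda>\<omega>. w \<in> blocks l A \<omega>) = (\<lambda>\<omega>. ?P (map \<omega> ?us))"
    using True by (auto simp: blocks_def fun_eq_iff)
  then show ?thesis
    using True assms by (simp only:) (intro pred_map_coordinates, auto)
qed (simp add: blocks_def)

lemma pred_blocks_eq:
  fixes D :: "nat list \<Rightarrow> ('e::countable) list pmf"
  assumes "\<And>u. length u < l \<Longrightarrow> u \<in> I"
  shows "Measurable.pred (\<Pi>\<^sub>M i\<in>I. measure_pmf (D i)) (\<lambda>\<omega>. blocks l A \<omega> = B)"
proof -
  note [measurable] = pred_blocks[OF assms, where A = A and D = D]
  have "(\<lambda>\<omega>. blocks l A \<omega> = B) = (\<lambda>\<omega>. \<forall>w. w \<in> blocks l A \<omega> \<longleftrightarrow> w \<in> B)"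
    by (auto simp: fun_eq_iff)
  then show ?thesis by simp
qed

lemma measurable_shift_PiM:
  assumes "\<And>u. v @ u \<in> I"
  shows "shift v \<in> measurable (\<Pi>\<^sub>M u\<in>I. measure_pmf D) (\<Pi>\<^sub>M u\<in>UNIV. measure_pmf D)"
  unfolding shift_def
  by (rule measurable_PiM_single') (use assms in \<open>auto intro: measurable_component_singleton\<close>)

lemma distr_shift:
  fixes D :: "'a pmf"
  shows "distr (\<Pi>\<^sub>M u\<in>UNIV. measure_pmf D) (\<Pi>\<^sub>M u\<in>UNIV. measure_pmf D) (shift v) = (\<Pi>\<^sub>M u\<in>UNIV. measure_pmf D)"
  using distr_PiM_reindex[of UNIV "\<lambda>_. measure_pmf D" "\<lambda>u. v @ u" UNIV]
  by (simp add: shift_def[abs_def] inj_on_def prob_space_measure_pmf restrict_UNIV)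

locale label_family =
  fixes D :: "('a::countable) pmf"
begin

abbreviation Q :: "(nat list \<Rightarrow> 'a) measure" where
  "Q \<equiv> \<Pi>\<^sub>M u\<in>UNIV. measure_pmf D"

sublocale product_prob_space "\<lambda>_::nat list. measure_pmf D" UNIV
  by unfold_locales

lemma space_Q [simp]: "space Q = UNIV"
  by (simp add: space_PiM)

lemma indep_coordinates: "indep_vars (\<lambda>_. measure_pmf D) (\<lambda>u \<omega>. \<omega> u) UNIV"
  by (subst indep_vars_iff_distr_eq_PiM') (simp_all add: PiM_component distr_id2 restrict_UNIV)

end

locale edge_labels = label_family D for D :: "('e::countable) list pmf"
begin

lemma measurable_shift [measurable]: "shift v \<in> measurable Q Q"
  by (rule measurable_shift_PiM) simp

lemma prob_shift:
  assumes "G \<in> sets Q"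
  shows "prob (shift v -` G) = prob G"
  apply (rule trans)
  apply (rule sym)
  apply (rule trans[OF measure_distr[OF measurable_shift assms]])
   apply (subst space_Q)
   apply (subst Int_UNIV_right)
   apply (rule refl)
  apply (subst distr_shift)
  apply (rule refl)
  done

lemma sets_blocks: "{\<omega>. w \<in> blocks l A \<omega>} \<in> sets Q" "{\<omega>. blocks l A \<omega> = B} \<in> sets Q"
proof -
  have "{\<omega> \<in> space Q. w \<in> blocks l A \<omega>} \<in> sets Q"
    by (rule predE[OF pred_blocks]) (rule UNIV_I)
  then show "{\<omega>. w \<in> blocks l A \<omega>} \<in> sets Q" by simp
  have "{\<omega> \<in> space Q. blocks l A \<omega> = B} \<in> sets Q"
    by (rule predE[OF pred_blocks_eq]) (rule UNIV_I)
  then show "{\<omega>. blocks l A \<omega> = B} \<in> sets Q" by simp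
qed

lemma sets_shift: "G \<in> sets Q \<Longrightarrow> shift v -` G \<in> sets Q"
  using measurable_sets[OF measurable_shift] by simp

lemma sets_reach:
  assumes "G \<in> sets Q"
  shows "reach l A G \<in> sets Q"
proof -
  have "reach l A G = (\<Union>w. {\<omega>. w \<in> blocks l A \<omega>} \<inter> shift w -` G)"
    by (auto simp: reach_def)
  also have "\<dots> \<in> sets Q"
    using assms by (intro sets.countable_UN'' sets.Int sets_blocks sets_shift) auto
  finally show ?thesis .
qed

lemma sets_reach_funpow: "G \<in> sets Q \<Longrightarrow> (reach l A ^^ k) G \<in> sets Q"
  by (induction k) (auto intro: sets_reach)

text \<open>The branching property: the subtrees rooted at the distinct vertices of \<open>B\<close>
  are copies of the whole tree, independent of each other and of the first \<open>l\<close>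
  levels.\<close>

lemma prob_blocks_miss:
  assumes G: "G \<in> sets Q" and B: "finite B" "\<And>w. w \<in> B \<Longrightarrow> length w = l"
  shows "prob {\<omega>. blocks l A \<omega> = B \<and> (\<forall>w\<in>B. shift w \<omega> \<notin> G)} =
    prob {\<omega>. blocks l A \<omega> = B} * (1 - prob G) ^ card B"
proof -
  \<comment> \<open>\<open>None\<close> indexes the first \<open>l\<close> levels and
    \<open>Some w\<close> the subtree at \<open>w\<close>; these coordinate sets are disjoint
    because all vertices of \<open>B\<close> have depth exactly \<open>l\<close>.\<close>
  define K where "K j = (case j of None \<Rightarrow> {u. length u < l} | Some w \<Rightarrow> range ((@) w))" for j :: "nat list option"
  define L where "L = insert None (Some ` B)"
  define E where "E j = (case j of
      None \<Rightarrow> {f \<in> space (\<Pi>\<^sub>M u\<in>K None. measure_pmf D). blocks l A f = B}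
    | Some w \<Rightarrow> {f \<in> space (\<Pi>\<^sub>M u\<in>K (Some w). measure_pmf D). shift w f \<notin> G})" for j
  let ?X = "\<lambda>j \<omega>. restrict (\<lambda>u. \<omega> u) (K j)"
  have disj: "disjoint_family_on K L"
    unfolding disjoint_family_on_def L_def
  proof (intro ballI impI)
    fix i j assume ij: "i \<in> insert None (Some ` B)" "j \<in> insert None (Some ` B)" "i \<noteq> j"
    show "K i \<inter> K j = {}"
    proof (cases i; cases j)
      fix v w assume "i = Some v" "j = Some w"
      then show ?thesis using ij B by (auto simp: K_def)
    qed (use ij B in \<open>auto simp: K_def\<close>)
  qed
  have ind: "indep_vars (\<lambda>j. \<Pi>\<^sub>M u\<in>K j. measure_pmf D) ?X L"
    by (rule indep_vars_restrict[OF indep_coordinates _ disj]) simp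
  have E: "E j \<in> sets (\<Pi>\<^sub>M u\<in>K j. measure_pmf D)" if "j \<in> L" for j
  proof (cases j)
    case None
    show ?thesis
    proof -
      have "{f \<in> space (\<Pi>\<^sub>M u\<in>K None. measure_pmf D). blocks l A f = B} \<in> sets (\<Pi>\<^sub>M u\<in>K None. measure_pmf D)"
        by (rule predE[OF pred_blocks_eq]) (simp add: K_def)
      then show ?thesis unfolding E_def None by (simp only: option.case)
    qed
  next
    case (Some w)
    have "shift w \<in> measurable (\<Pi>\<^sub>M u\<in>K j. measure_pmf D) Q"
      by (rule measurable_shift_PiM) (simp add: K_def Some)
    from measurable_sets[OF this, of "- G"] G
    have "shift w -` (- G) \<inter> space (\<Pi>\<^sub>M u\<in>K j. measure_pmf D) \<in> sets (\<Pi>\<^sub>M u\<in>K j. measure_pmf D)"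
      by (simp add: sets.compl_sets[of G Q, simplified] Compl_eq_Diff_UNIV)
    moreover have "E j = shift w -` (- G) \<inter> space (\<Pi>\<^sub>M u\<in>K j. measure_pmf D)"
      by (auto simp: E_def Some)
    ultimately show ?thesis by simp
  qed
  have XN: "?X None -` E None \<inter> space Q = {\<omega>. blocks l A \<omega> = B}"
  proof -
    have "blocks l A (?X None \<omega>) = blocks l A \<omega>" for \<omega>
      by (rule blocks_cong) (simp add: K_def)
    then show ?thesis by (auto simp: E_def space_PiM)
  qed
  have XS: "?X (Some w) -` E (Some w) \<inter> space Q = shift w -` (- G)" for w
  proof -
    have "shift w (?X (Some w) \<omega>) = shift w \<omega>" for \<omega> :: "nat list \<Rightarrow> 'e list"
      by (auto simp: shift_def K_def)
    then show ?thesis by (auto simp: E_def space_PiM)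
  qed
  define g where "g j = prob (?X j -` E j \<inter> space Q)" for j
  have gN: "g None = prob {\<omega>. blocks l A \<omega> = B}"
    unfolding g_def XN ..
  have gS: "g (Some w) = 1 - prob G" for w
  proof -
    have "- G \<in> sets Q" using sets.compl_sets[OF G] by (simp only: Compl_eq_Diff_UNIV space_Q)
    then have "g (Some w) = prob (- G)" unfolding g_def XS by (rule prob_shift)
    also have "\<dots> = 1 - prob G"
      using prob_compl[OF G] by (simp only: Compl_eq_Diff_UNIV space_Q)
    finally show ?thesis .
  qed
  have prod: "(\<Prod>j\<in>L. g j) = g None * (\<Prod>w\<in>B. g (Some w))"
    unfolding L_def using B(1) by (simp add: prod.reindex)
  define h where "h j = ?X j -` E j \<inter> space Q" for j
  have "h None = {\<omega>. blocks l A \<omega> = B}" "h (Some w) = shift w -` (- G)" for w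
    unfolding h_def XN XS by (rule refl)+
  then have "(\<Inter>j\<in>L. h j) = {\<omega>. blocks l A \<omega> = B \<and> (\<forall>w\<in>B. shift w \<omega> \<notin> G)}"
    by (auto simp: L_def)
  then have inter: "(\<Inter>j\<in>L. ?X j -` E j \<inter> space Q) = {\<omega>. blocks l A \<omega> = B \<and> (\<forall>w\<in>B. shift w \<omega> \<notin> G)}"
    unfolding h_def .
  have "prob (\<Inter>j\<in>L. ?X j -` E j \<inter> space Q) = (\<Prod>j\<in>L. g j)"
    unfolding g_def
  proof (rule indep_varsD_finite[OF ind])
    show "L \<noteq> {}" "finite L" using B(1) by (simp_all add: L_def)
  qed (rule E)
  then show ?thesis
    unfolding inter prod gN gS by (simp only: prod_constant)
qed

lemma card_blocks_measurable [measurable]: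
  "(\<lambda>\<omega>. card (blocks l A \<omega>)) \<in> measurable Q (count_space UNIV)"
  unfolding measurable_count_space_eq2_countable
proof (intro conjI ballI)
  fix n :: nat
  have "(\<lambda>\<omega>. card (blocks l A \<omega>)) -` {n} \<inter> space Q = (\<Union>B\<in>{B. finite B \<and> card B = n}. {\<omega>. blocks l A \<omega> = B})"
    using finite_blocks by auto
  also have "\<dots> \<in> sets Q"
  proof (intro sets.countable_UN'' sets_blocks)
    show "countable {B :: nat list set. finite B \<and> card B = n}"
      by (rule countable_subset[OF _ countable_Collect_finite]) auto
  qed
  finally show "(\<lambda>\<omega>. card (blocks l A \<omega>)) -` {n} \<inter> space Q \<in> sets Q" .
qed simp

text \<open>On the complement every block end misses \<open>G\<close>. Splitting by the finite set
  \<open>B\<close> of block ends and averaging \<open>(1 - prob G) ^ card B\<close> gives the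
  one-generation recursion of the embedded process.\<close>

lemma prob_reach:
  assumes G: "G \<in> sets Q"
  shows "prob (reach l A G) = some_kept (\<lambda>\<omega>. card (blocks l A \<omega>)) (prob G)"
proof -
  define c where "c = 1 - prob G"
  have c: "0 \<le> c" "c \<le> 1" by (auto simp: c_def)
  let ?F = "{B :: nat list set. finite B \<and> (\<forall>w\<in>B. length w = l)}"
  let ?S = "\<lambda>B. {\<omega>. blocks l A \<omega> = B \<and> (\<forall>w\<in>B. shift w \<omega> \<notin> G)}"
  let ?T = "\<lambda>B. {\<omega>. blocks l A \<omega> = B}"
  have F: "countable ?F"
    by (rule countable_subset[OF _ countable_Collect_finite]) auto
  have inF: "blocks l A \<omega> \<in> ?F" for \<omega>
    using finite_blocks by (auto simp: blocks_def)
  have pc: "0 \<le> c ^ n" "c ^ n \<le> 1" for n using c by (auto simp: power_le_one)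
  have int: "integrable Q (\<lambda>\<omega>. c ^ card (blocks l A \<omega>))"
    by (rule integrable_const_bound[of _ 1]) (use pc in auto)
  have SetS: "?S B \<in> sets Q" if "B \<in> ?F" for B
  proof -
    have "?S B = ?T B \<inter> (\<Inter>w\<in>B. - (shift w -` G))" by auto
    also have "\<dots> \<in> sets Q"
      using that sets_shift[OF G] by (cases "B = {}")
        (auto intro!: sets.Int sets_blocks sets.finite_INT simp: Compl_eq_Diff_UNIV sets.compl_sets[of _ Q, simplified])
    finally show ?thesis .
  qed
  have "emeasure Q (- reach l A G) = emeasure Q (\<Union>B\<in>?F. ?S B)"
    using inF by (intro arg_cong[where f = "emeasure Q"]) (auto simp: reach_def)
  also have "\<dots> = (\<integral>\<^sup>+B. emeasure Q (?S B) \<partial>count_space ?F)"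
    using SetS F by (intro emeasure_UN_countable) (auto simp: disjoint_family_on_def)
  also have "\<dots> = (\<integral>\<^sup>+B. ennreal (c ^ card B) * emeasure Q (?T B) \<partial>count_space ?F)"
  proof (rule nn_integral_cong)
    fix B assume "B \<in> space (count_space ?F)"
    then have "finite B" "\<And>w. w \<in> B \<Longrightarrow> length w = l" by auto
    from prob_blocks_miss[OF G this, of A]
    show "emeasure Q (?S B) = ennreal (c ^ card B) * emeasure Q (?T B)"
      using c pc by (simp add: emeasure_eq_measure ennreal_mult[symmetric] mult.commute c_def)
  qed
  also have "\<dots> = (\<integral>\<^sup>+B. \<integral>\<^sup>+\<omega>. ennreal (c ^ card B) * indicator (?T B) \<omega> \<partial>Q \<partial>count_space ?F)"
    using sets_blocks by (simp add: nn_integral_cmult_indicator)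
  also have "\<dots> = (\<integral>\<^sup>+\<omega>. \<integral>\<^sup>+B. ennreal (c ^ card B) * indicator (?T B) \<omega> \<partial>count_space ?F \<partial>Q)"
    using sets_blocks by (intro nn_integral_count_space_nn_integral[symmetric] F) auto
  also have "\<dots> = (\<integral>\<^sup>+\<omega>. ennreal (c ^ card (blocks l A \<omega>)) \<partial>Q)"
  proof (rule nn_integral_cong)
    fix \<omega>
    have "(\<integral>\<^sup>+B. ennreal (c ^ card B) * indicator (?T B) \<omega> \<partial>count_space ?F) =
        (\<integral>\<^sup>+B. ennreal (c ^ card B) * indicator {blocks l A \<omega>} B \<partial>count_space ?F)"
      by (intro nn_integral_cong) (auto split: split_indicator)
    also have "\<dots> = ennreal (c ^ card (blocks l A \<omega>))"
      using inF[of \<omega>] by (subst nn_integral_indicator_singleton) auto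
    finally show "(\<integral>\<^sup>+B. ennreal (c ^ card B) * indicator (?T B) \<omega> \<partial>count_space ?F) = ennreal (c ^ card (blocks l A \<omega>))" .
  qed
  also have "\<dots> = ennreal (expectation (\<lambda>\<omega>. c ^ card (blocks l A \<omega>)))"
    using pc by (intro nn_integral_eq_integral int) auto
  finally have "prob (- reach l A G) = expectation (\<lambda>\<omega>. c ^ card (blocks l A \<omega>))"
    using pc by (simp add: emeasure_eq_measure)
  moreover have "prob (- reach l A G) = 1 - prob (reach l A G)"
    using prob_compl[OF sets_reach[OF G]] by (simp add: Compl_eq_Diff_UNIV)
  ultimately show ?thesis
    using int P.prob_space by (simp add: some_kept_def c_def[symmetric])
qed

lemma prob_reach_funpow:
  assumes G: "G \<in> sets Q"
  shows "prob ((reach l A ^^ k) G) = (some_kept (\<lambda>\<omega>. card (blocks l A \<omega>)) ^^ k) (prob G)"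
  by (induction k) (simp_all add: prob_reach sets_reach_funpow G)

lemma prob_UNIV: "prob UNIV = 1"
  using P.prob_space unfolding space_Q .

lemma UNIV_sets [simp]: "UNIV \<in> sets Q"
  using sets.top[of Q] by simp

lemma sets_survival [simp]: "survival l A \<in> sets Q"
  unfolding survival_def by (intro sets.countable_INT'' sets_reach_funpow) auto

context
  fixes l :: nat and A :: "'e list set"
  assumes supercritical: "1 < (\<integral>\<^sup>+\<omega>. of_nat (card (blocks l A \<omega>)) \<partial>Q)"
begin

text \<open>The probabilities of surviving \<open>k\<close> generations are the iterates of
  \<open>some_kept\<close> started at 1, which stay above a positive constant.\<close>

lemma prob_survival_pos: "0 < prob (survival l A)"
proof -
  obtain c where c: "0 < c" "\<And>k. c \<le> (some_kept (\<lambda>\<omega>. card (blocks l A \<omega>)) ^^ k) 1"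
    using some_kept_iterates(2)[OF card_blocks_measurable supercritical, of 1] by auto
  have c_le: "c \<le> prob ((reach l A ^^ k) UNIV)" for k
    using c(2)[of k] prob_reach_funpow[OF UNIV_sets, of k l A] prob_UNIV by simp
  have "(\<lambda>k. prob ((reach l A ^^ k) UNIV)) \<longlonglongrightarrow> prob (survival l A)"
    unfolding survival_def
    by (intro finite_Lim_measure_decseq)
      (auto simp: decseq_def intro: sets_reach_funpow dest: reach_funpow_antimono)
  then have "c \<le> prob (survival l A)"
    by (rule LIMSEQ_le_const) (use c_le in auto)
  with c show ?thesis by linarith
qed

text \<open>On survival, every event of positive probability is seen from infinitely many generations,
  because survival to generation \<open>k\<close> and seeing the event from generation \<open>k\<close> have
  asymptotically the same probability.\<close>

lemma survival_reaches:
  assumes G: "G \<in> sets Q" "0 < prob G"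
  shows "AE \<omega> in Q. \<omega> \<in> survival l A \<longrightarrow> (\<exists>k\<ge>k0. \<omega> \<in> (reach l A ^^ k) G)"
proof -
  define N where "N = survival l A - (\<Union>k\<in>{k0..}. (reach l A ^^ k) G)"
  have N: "N \<in> sets Q"
    unfolding N_def using G by (intro sets.Diff sets.countable_UN'' sets_reach_funpow) auto
  have "prob N \<le> prob ((reach l A ^^ k) UNIV) - prob ((reach l A ^^ k) G)" if "k0 \<le> k" for k
  proof -
    have "prob N \<le> prob ((reach l A ^^ k) UNIV - (reach l A ^^ k) G)"
      using G that by (intro finite_measure_mono sets.Diff sets_reach_funpow) (auto simp: N_def survival_def)
    also have "\<dots> = prob ((reach l A ^^ k) UNIV) - prob ((reach l A ^^ k) G)"
      using G by (intro finite_measure_Diff sets_reach_funpow reach_funpow_mono) auto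
    finally show ?thesis .
  qed
  \<comment> \<open>Both terms are iterates of the same map, started at 1 and at
    \<open>prob G\<close>.\<close>
  moreover have "(\<lambda>k. prob ((reach l A ^^ k) UNIV) - prob ((reach l A ^^ k) G)) \<longlonglongrightarrow> 0"
    using some_kept_iterates(1)[OF card_blocks_measurable supercritical G(2)]
    by (simp only: prob_reach_funpow[OF G(1)] prob_reach_funpow[OF UNIV_sets] prob_UNIV prob_le_1)
  ultimately have "prob N \<le> 0"
    by (intro LIMSEQ_le_const) auto
  then have "prob N = 0" by (simp add: measure_le_0_iff)
  then have "N \<in> null_sets Q" using N by (simp add: null_sets_def emeasure_eq_measure)
  then show ?thesis
    by (rule AE_I') (auto simp: N_def)
qed

end

lemma AE_shift:
  assumes "AE \<omega> in Q. P \<omega>"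
  shows "AE \<omega> in Q. P (shift v \<omega>)"
  by (rule AE_distrD[OF measurable_shift[of v]], subst distr_shift, rule assms)

end

section \<open>Laws of labels built from independent coordinates\<close>

lemma pmf_replicate_prod:
  "length xs = n \<Longrightarrow> pmf (replicate_pmf n p) xs = (\<Prod>k<n. pmf p (xs ! k))"
  by (simp add: pmf_replicate prod.list_conv_set_nth atLeast0LessThan)

lemma measurable_map_family:
  fixes \<nu> :: "('a::countable) pmf"
  assumes "\<And>k. k < m \<Longrightarrow> f k \<in> I"
  shows "(\<lambda>e. map (\<lambda>k. e (f k)) [0..<m]) \<in> measurable (\<Pi>\<^sub>M i\<in>I. measure_pmf \<nu>) (count_space UNIV)"
proof -
  have "set (map f [0..<m]) \<subseteq> I" using assms by auto
  from measurable_map_coordinates[OF this, of "\<lambda>_. \<nu>"] show ?thesis by (simp add: comp_def)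
qed

text \<open>Distinct coordinates of a product are independent. The injection \<open>f\<close> is
  arbitrary so that the formula serves paths in the tree, groups of siblings and the time axis
  alike.\<close>

lemma distr_map_coordinates:
  fixes \<nu> :: "('a::countable) pmf"
  assumes f: "inj_on f {..<m}" "\<And>k. k < m \<Longrightarrow> f k \<in> I"
  shows "distr (\<Pi>\<^sub>M i\<in>I. measure_pmf \<nu>) (count_space UNIV) (\<lambda>e. map (\<lambda>k. e (f k)) [0..<m]) =
    measure_pmf (replicate_pmf m \<nu>)"
proof (rule measure_eqI_countable[of _ UNIV])
  let ?P = "\<Pi>\<^sub>M i\<in>I. measure_pmf \<nu>"
  interpret product_prob_space "\<lambda>_. measure_pmf \<nu>" I by unfold_locales
  have meas: "(\<lambda>e. map (\<lambda>k. e (f k)) [0..<m]) \<in> measurable ?P (count_space UNIV)"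
    using f(2) by (rule measurable_map_family)
  fix xs :: "'a list"
  have eq: "emeasure (distr ?P (count_space UNIV) (\<lambda>e. map (\<lambda>k. e (f k)) [0..<m])) {xs} =
      emeasure ?P ((\<lambda>e. map (\<lambda>k. e (f k)) [0..<m]) -` {xs} \<inter> space ?P)"
    by (rule emeasure_distr[OF meas]) simp
  show "emeasure (distr ?P (count_space UNIV) (\<lambda>e. map (\<lambda>k. e (f k)) [0..<m])) {xs} =
      emeasure (measure_pmf (replicate_pmf m \<nu>)) {xs}"
  proof (cases "length xs = m")
    case True
    define J where "J = f ` {..<m}"
    define X where "X j = {xs ! the_inv_into {..<m} f j}" for j
    have X: "X (f k) = {xs ! k}" if "k < m" for k
      using that f(1) by (simp add: X_def the_inv_into_f_f)
    have "(\<lambda>e. map (\<lambda>k. e (f k)) [0..<m]) -` {xs} \<inter> space ?P = {e \<in> space ?P. \<forall>j\<in>J. e j \<in> X j}"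
    proof -
      have "map (\<lambda>k. e (f k)) [0..<m] = xs \<longleftrightarrow> (\<forall>j\<in>J. e j \<in> X j)" for e
      proof -
        have "map (\<lambda>k. e (f k)) [0..<m] = xs \<longleftrightarrow> (\<forall>k<m. e (f k) = xs ! k)"
          unfolding list_eq_iff_nth_eq[of _ xs] using True by simp
        also have "\<dots> \<longleftrightarrow> (\<forall>k<m. e (f k) \<in> X (f k))" using X by simp
        finally show ?thesis unfolding J_def by blast
      qed
      then show ?thesis by auto
    qed
    also have "emeasure ?P \<dots> = (\<Prod>j\<in>J. emeasure (measure_pmf \<nu>) (X j))"
      by (rule emeasure_PiM_Collect) (use f in \<open>auto simp: J_def\<close>)
    also have "\<dots> = (\<Prod>k<m. emeasure (measure_pmf \<nu>) {xs ! k})"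
      using X by (simp add: J_def prod.reindex[OF f(1)])
    also have "\<dots> = ennreal (pmf (replicate_pmf m \<nu>) xs)"
      using True by (simp add: emeasure_pmf_single prod_ennreal pmf_replicate_prod)
    finally show ?thesis unfolding eq by (simp add: emeasure_pmf_single)
  next
    case False
    then have "(\<lambda>e. map (\<lambda>k. e (f k)) [0..<m]) -` {xs} \<inter> space ?P = {}" by auto
    moreover have "pmf (replicate_pmf m \<nu>) xs = 0"
      using False by (simp add: set_replicate_pmf pmf_eq_0_set_pmf)
    ultimately show ?thesis unfolding eq by (simp add: emeasure_pmf_single)
  qed
qed auto

lemma emeasure_map_coordinates:
  fixes \<nu> :: "('a::countable) pmf"
  assumes f: "inj_on f {..<m}" "\<And>k. k < m \<Longrightarrow> f k \<in> I"
  shows "emeasure (\<Pi>\<^sub>M i\<in>I. measure_pmf \<nu>) {e \<in> space (\<Pi>\<^sub>M i\<in>I. measure_pmf \<nu>). map (\<lambda>k. e (f k)) [0..<m] \<in> A} =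
    emeasure (measure_pmf (replicate_pmf m \<nu>)) A"
    and "{e \<in> space (\<Pi>\<^sub>M i\<in>I. measure_pmf \<nu>). map (\<lambda>k. e (f k)) [0..<m] \<in> A} \<in> sets (\<Pi>\<^sub>M i\<in>I. measure_pmf \<nu>)"
proof -
  let ?P = "\<Pi>\<^sub>M i\<in>I. measure_pmf \<nu>"
  have meas: "(\<lambda>e. map (\<lambda>k. e (f k)) [0..<m]) \<in> measurable ?P (count_space UNIV)"
    using f(2) by (rule measurable_map_family)
  have eq: "(\<lambda>e. map (\<lambda>k. e (f k)) [0..<m]) -` A \<inter> space ?P = {e \<in> space ?P. map (\<lambda>k. e (f k)) [0..<m] \<in> A}"
    by auto
  show "{e \<in> space ?P. map (\<lambda>k. e (f k)) [0..<m] \<in> A} \<in> sets ?P"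
    using measurable_sets[OF meas, of A] unfolding eq by simp
  have "emeasure (distr ?P (count_space UNIV) (\<lambda>e. map (\<lambda>k. e (f k)) [0..<m])) A =
      emeasure ?P {e \<in> space ?P. map (\<lambda>k. e (f k)) [0..<m] \<in> A}"
    unfolding eq[symmetric] by (rule emeasure_distr[OF meas]) simp
  moreover have "emeasure (distr ?P (count_space UNIV) (\<lambda>e. map (\<lambda>k. e (f k)) [0..<m])) A =
      emeasure (measure_pmf (replicate_pmf m \<nu>)) A"
    by (rule arg_cong[where f = "\<lambda>M. emeasure M A"], rule distr_map_coordinates[OF f])
  ultimately show "emeasure ?P {e \<in> space ?P. map (\<lambda>k. e (f k)) [0..<m] \<in> A} =
      emeasure (measure_pmf (replicate_pmf m \<nu>)) A"
    by (rule trans[OF sym])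
qed

text \<open>The vertex datum at \<open>u\<close> and the first few edge values below
  \<open>u\<close> are combined by \<open>c\<close> into one label, \<open>len\<close> telling how
  many values to read. This joins offspring numbers with steps, and later labels with percolation
  bits.\<close>

definition attach :: "('x \<Rightarrow> nat) \<Rightarrow> ('x \<Rightarrow> 'e list \<Rightarrow> 'y) \<Rightarrow>
    (nat list \<Rightarrow> 'x) \<times> (nat list \<Rightarrow> 'e) \<Rightarrow> nat list \<Rightarrow> 'y" where
  "attach len c z u = c (fst z u) (map (\<lambda>k. snd z (u @ [k])) [0..<len (fst z u)])"

definition attach_pmf :: "('x \<Rightarrow> nat) \<Rightarrow> ('x \<Rightarrow> 'e list \<Rightarrow> 'y) \<Rightarrow> 'x pmf \<Rightarrow> 'e pmf \<Rightarrow> 'y pmf" where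
  "attach_pmf len c D \<nu> = bind_pmf D (\<lambda>x. map_pmf (c x) (replicate_pmf (len x) \<nu>))"

abbreviation vertices :: "'x pmf \<Rightarrow> (nat list \<Rightarrow> 'x) measure" where
  "vertices D \<equiv> \<Pi>\<^sub>M u\<in>UNIV. measure_pmf D"

abbreviation nonroot :: "'e pmf \<Rightarrow> (nat list \<Rightarrow> 'e) measure" where
  "nonroot \<nu> \<equiv> \<Pi>\<^sub>M u\<in>{u. u \<noteq> []}. measure_pmf \<nu>"

lemma prob_space_nonroot: "prob_space (nonroot \<nu>)"
  by (rule prob_space_PiM, rule prob_space_measure_pmf)

text \<open>Edges below different parents occupy disjoint sets of coordinates, so the groups of
  siblings are independent.\<close>

lemma emeasure_sibling_blocks:
  fixes \<nu> :: "('e::countable) pmf"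
  assumes J: "finite J"
  shows "emeasure (nonroot \<nu>) {e \<in> space (nonroot \<nu>). \<forall>u\<in>J. map (\<lambda>k. e (u @ [k])) [0..<m u] \<in> A u} =
    (\<Prod>u\<in>J. emeasure (measure_pmf (replicate_pmf (m u) \<nu>)) (A u))"
proof (cases "J = {}")
  case True
  then show ?thesis using prob_space.emeasure_space_1[OF prob_space_nonroot] by simp
next
  case False
  interpret product_prob_space "\<lambda>_. measure_pmf \<nu>" "{u. u \<noteq> []} :: nat list set" by unfold_locales
  have "indep_vars (\<lambda>_. measure_pmf \<nu>) (\<lambda>u e. e u) {u :: nat list. u \<noteq> []}"
  proof (subst indep_vars_iff_distr_eq_PiM')
    have "distr (nonroot \<nu>) (nonroot \<nu>) (\<lambda>x. restrict x {u. u \<noteq> []}) = distr (nonroot \<nu>) (nonroot \<nu>) (\<lambda>x. x)"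
      by (intro distr_cong) (auto simp: space_PiM)
    also have "\<dots> = nonroot \<nu>" by (rule distr_id)
    also have "\<dots> = (\<Pi>\<^sub>M u\<in>{u. u \<noteq> []}. distr (nonroot \<nu>) (measure_pmf \<nu>) (\<lambda>e. e u))"
      by (rule PiM_cong) (simp_all add: PiM_component)
    finally show "distr (nonroot \<nu>) (nonroot \<nu>) (\<lambda>x. restrict x {u. u \<noteq> []}) =
        (\<Pi>\<^sub>M u\<in>{u. u \<noteq> []}. distr (nonroot \<nu>) (measure_pmf \<nu>) (\<lambda>e. e u))" .
  qed (auto intro!: exI[of _ "[0]"])
  then have ind: "indep_vars (\<lambda>u. \<Pi>\<^sub>M v\<in>range (\<lambda>k. u @ [k]). measure_pmf \<nu>)
      (\<lambda>u e. restrict (\<lambda>v. e v) (range (\<lambda>k. u @ [k]))) J"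
    by (rule indep_vars_restrict) (auto simp: disjoint_family_on_def)
  define E where "E u = {f \<in> space (\<Pi>\<^sub>M v\<in>range (\<lambda>k. u @ [k]). measure_pmf \<nu>).
      map (\<lambda>k. f (u @ [k])) [0..<m u] \<in> A u}" for u
  have inj: "inj_on (\<lambda>k. u @ [k]) {..<m u}" for u :: "nat list" by (auto simp: inj_on_def)
  have E: "E u \<in> sets (\<Pi>\<^sub>M v\<in>range (\<lambda>k. u @ [k]). measure_pmf \<nu>)" for u
    unfolding E_def by (rule emeasure_map_coordinates(2)[OF inj]) simp
  define h where "h u = {e \<in> space (nonroot \<nu>). map (\<lambda>k. e (u @ [k])) [0..<m u] \<in> A u}" for u
  have h: "(\<lambda>e. restrict (\<lambda>v. e v) (range (\<lambda>k. u @ [k]))) -` E u \<inter> space (nonroot \<nu>) = h u" for u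
    by (auto simp: E_def h_def space_PiM)
  have "prob (\<Inter>u\<in>J. h u) = (\<Prod>u\<in>J. prob (h u))"
    using indep_varsD_finite[OF ind False J E] unfolding h .
  moreover have "(\<Inter>u\<in>J. h u) = {e \<in> space (nonroot \<nu>). \<forall>u\<in>J. map (\<lambda>k. e (u @ [k])) [0..<m u] \<in> A u}"
    using False by (auto simp: h_def)
  moreover have "emeasure (nonroot \<nu>) (h u) = emeasure (measure_pmf (replicate_pmf (m u) \<nu>)) (A u)" for u
    unfolding h_def by (rule emeasure_map_coordinates(1)[OF inj]) simp
  ultimately have prob: "prob {e \<in> space (nonroot \<nu>). \<forall>u\<in>J. map (\<lambda>k. e (u @ [k])) [0..<m u] \<in> A u} = (\<Prod>u\<in>J. prob (h u))"
    and single: "\<And>u. emeasure (nonroot \<nu>) (h u) = emeasure (measure_pmf (replicate_pmf (m u) \<nu>)) (A u)"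
    by simp_all
  show ?thesis
    unfolding single[symmetric] emeasure_eq_measure prob by (rule prod_ennreal[symmetric]) simp
qed

lemma attach_component_sets:
  fixes D :: "('x::countable) pmf" and \<nu> :: "('e::countable) pmf"
  shows "{z \<in> space (vertices D \<Otimes>\<^sub>M nonroot \<nu>). attach len c z u \<in> A} \<in> sets (vertices D \<Otimes>\<^sub>M nonroot \<nu>)"
proof -
  let ?V = "\<lambda>x. {f \<in> space (vertices D). f u \<in> {x}}"
  let ?E = "\<lambda>x. {e \<in> space (nonroot \<nu>). map (\<lambda>k. e (u @ [k])) [0..<len x] \<in> c x -` A}"
  have "{z \<in> space (vertices D \<Otimes>\<^sub>M nonroot \<nu>). attach len c z u \<in> A} = (\<Union>x. ?V x \<times> ?E x)"
    by (auto simp: attach_def space_pair_measure)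
  also have "\<dots> \<in> sets (vertices D \<Otimes>\<^sub>M nonroot \<nu>)"
  proof (intro sets.countable_UN'' pair_measureI)
    show "?V x \<in> sets (vertices D)" for x
      by (rule sets_Collect_single) simp_all
    show "?E x \<in> sets (nonroot \<nu>)" for x
      by (rule emeasure_map_coordinates(2)) (simp_all add: inj_on_def)
  qed simp
  finally show ?thesis .
qed

lemma measurable_attach:
  fixes D :: "('x::countable) pmf" and \<nu> :: "('e::countable) pmf"
  shows "attach len c \<in> measurable (vertices D \<Otimes>\<^sub>M nonroot \<nu>) (vertices D')"
proof -
  have "(\<lambda>z u. attach len c z u) \<in> measurable (vertices D \<Otimes>\<^sub>M nonroot \<nu>) (vertices D')"
  proof (rule measurable_PiM_single')
    fix u :: "nat list"
    show "(\<lambda>z. attach len c z u) \<in> measurable (vertices D \<Otimes>\<^sub>M nonroot \<nu>) (measure_pmf D')"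
    proof (rule measurableI)
      fix A
      have "(\<lambda>z. attach len c z u) -` A \<inter> space (vertices D \<Otimes>\<^sub>M nonroot \<nu>) =
          {z \<in> space (vertices D \<Otimes>\<^sub>M nonroot \<nu>). attach len c z u \<in> A}" by blast
      then show "(\<lambda>z. attach len c z u) -` A \<inter> space (vertices D \<Otimes>\<^sub>M nonroot \<nu>) \<in> sets (vertices D \<Otimes>\<^sub>M nonroot \<nu>)"
        using attach_component_sets[where u = u and len = len and c = c and A = A] by (simp only:)
    qed simp
  qed auto
  then show ?thesis by simp
qed

text \<open>For fixed vertex data the labels factorise by \<open>emeasure_sibling_blocks\<close>,
  and each factor depends on a single vertex datum. So the combined labels are again i.i.d.,
  although each reads a random number of edge values.\<close>

lemma distr_attach:
  fixes D :: "('x::countable) pmf" and \<nu> :: "('e::countable) pmf"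
  shows "distr (vertices D \<Otimes>\<^sub>M nonroot \<nu>) (vertices (attach_pmf len c D \<nu>)) (attach len c) =
    vertices (attach_pmf len c D \<nu>)"
proof -
  let ?D' = "attach_pmf len c D \<nu>"
  let ?S = "vertices D \<Otimes>\<^sub>M nonroot \<nu>"
  interpret T: product_prob_space "\<lambda>_. measure_pmf ?D'" "UNIV :: nat list set" by unfold_locales
  interpret L: label_family D .
  interpret E: prob_space "nonroot \<nu>" by (rule prob_space_nonroot)
  show ?thesis
  proof (rule T.PiM_eq)
    fix J :: "nat list set" and F
    assume J: "finite J"
    let ?W = "{z \<in> space ?S. \<forall>u\<in>J. attach len c z u \<in> F u}"
    let ?X = "prod_emb UNIV (\<lambda>_. measure_pmf ?D') J (\<Pi>\<^sub>E j\<in>J. F j)"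
    define h where "h u a = emeasure (measure_pmf (replicate_pmf (len a) \<nu>)) (c a -` F u)" for u a
    have pre: "attach len c -` ?X \<inter> space ?S = ?W"
      by (auto simp: prod_emb_def space_PiM)
    have X: "?X \<in> sets (vertices ?D')"
      using J by (intro sets_PiM_I) auto
    have W: "?W \<in> sets ?S"
      unfolding pre[symmetric] by (rule measurable_sets[OF measurable_attach X])
    have "emeasure (distr ?S (vertices ?D') (attach len c)) ?X = emeasure ?S ?W"
      unfolding pre[symmetric] by (rule emeasure_distr[OF measurable_attach X])
    also have "\<dots> = (\<integral>\<^sup>+x. emeasure (nonroot \<nu>) (Pair x -` ?W) \<partial>vertices D)"
      by (rule E.emeasure_pair_measure_alt[OF W])
    also have "\<dots> = (\<integral>\<^sup>+x. (\<Prod>u\<in>J. h u (x u)) \<partial>vertices D)"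
    proof (rule nn_integral_cong)
      fix x :: "nat list \<Rightarrow> 'x"
      have "Pair x -` ?W = {e \<in> space (nonroot \<nu>). \<forall>u\<in>J. map (\<lambda>k. e (u @ [k])) [0..<len (x u)] \<in> c (x u) -` F u}"
        by (auto simp: space_pair_measure attach_def)
      then show "emeasure (nonroot \<nu>) (Pair x -` ?W) = (\<Prod>u\<in>J. h u (x u))"
        unfolding h_def by (simp only:) (rule emeasure_sibling_blocks[OF J])
    qed
    also have "\<dots> = (\<Prod>u\<in>J. \<integral>\<^sup>+x. h u (x u) \<partial>vertices D)"
    proof (rule L.indep_vars_nn_integral[OF J])
      have "L.indep_vars (\<lambda>_. measure_pmf D) (\<lambda>u \<omega>. \<omega> u) J"
        using L.indep_coordinates by (rule L.indep_vars_subset) simp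
      then show "L.indep_vars (\<lambda>_. borel) (\<lambda>u x. h u (x u)) J"
        by (rule L.indep_vars_compose2) simp
    qed simp
    also have "\<dots> = (\<Prod>u\<in>J. emeasure (measure_pmf ?D') (F u))"
    proof (rule prod.cong[OF refl])
      fix u
      have "(\<integral>\<^sup>+x. h u (x u) \<partial>vertices D) = (\<integral>\<^sup>+a. h u a \<partial>distr (vertices D) (measure_pmf D) (\<lambda>x. x u))"
        by (rule nn_integral_distr[symmetric]) simp_all
      also have "distr (vertices D) (measure_pmf D) (\<lambda>x. x u) = measure_pmf D"
        by (rule L.PiM_component) simp
      also have "(\<integral>\<^sup>+a. h u a \<partial>measure_pmf D) = emeasure (measure_pmf ?D') (F u)"
        by (simp add: attach_pmf_def h_def)
      finally show "(\<integral>\<^sup>+x. h u (x u) \<partial>vertices D) = emeasure (measure_pmf ?D') (F u)" .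
    qed
    finally show "emeasure (distr ?S (vertices ?D') (attach len c)) ?X =
        (\<Prod>u\<in>J. emeasure (measure_pmf ?D') (F u))" .
  qed simp
qed

abbreviation labels :: "(nat list \<Rightarrow> nat) \<times> (nat list \<Rightarrow> 'e) \<Rightarrow> nat list \<Rightarrow> 'e list" where
  "labels \<equiv> attach id (\<lambda>_ es. es)"

abbreviation label_law :: "nat pmf \<Rightarrow> 'e pmf \<Rightarrow> 'e list pmf" where
  "label_law \<equiv> attach_pmf id (\<lambda>_ es. es)"

lemma tree_labels: "tree (labels z) = gw_tree (fst z)"
  by (simp add: tree_def gw_tree_def attach_def)

lemma edges_labels:
  assumes "w \<in> tree (labels z)"
  shows "edges (labels z) w = map (\<lambda>k. snd z (take (Suc k) w)) [0..<length w]"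
  unfolding edges_def
proof (rule map_cong[OF refl])
  fix k assume "k \<in> set [0..<length w]"
  then have "k < length w" by simp
  then have "w ! k < length (labels z (take k w))" using assms by (auto simp: tree_def)
  then show "labels z (take k w) ! (w ! k) = snd z (take (Suc k) w)"
    using \<open>k < length w\<close> by (simp add: attach_def take_Suc_conv_app_nth)
qed

text \<open>Membership separates into a condition on the offspring numbers along \<open>w\<close>
  and one on the steps along \<open>w\<close>; independence of the two families then makes the first
  moment factorise.\<close>

lemma mem_blocks_labels:
  "w \<in> blocks l A (labels z) \<longleftrightarrow> length w = l \<and>
    list_all2 (<) w (map (\<lambda>k. fst z (take k w)) [0..<l]) \<and>
    map (\<lambda>k. snd z (take (Suc k) w)) [0..<l] \<in> A"
proof (cases "length w = l")
  case True
  then have "w \<in> tree (labels z) \<longleftrightarrow> list_all2 (<) w (map (\<lambda>k. fst z (take k w)) [0..<l])"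
    by (auto simp: tree_labels gw_tree_def list_all2_conv_all_nth)
  then show ?thesis using True edges_labels[of w z] by (auto simp: blocks_def)
qed (simp add: blocks_def)

section \<open>First moment of the number of blocks\<close>

lemma card_list_all2_less: "finite {w. list_all2 (<) w ns} \<and> card {w :: nat list. list_all2 (<) w ns} = prod_list ns"
proof (induction ns)
  case (Cons n ns)
  have eq: "{w. list_all2 (<) w (n # ns)} = (\<lambda>(k, w). k # w) ` ({..<n} \<times> {w. list_all2 (<) w ns})"
    by (auto simp: list_all2_Cons2 image_iff)
  have inj: "inj_on (\<lambda>(k, w). k # w) ({..<n} \<times> {w. list_all2 (<) w ns})"
    by (auto simp: inj_on_def)
  show ?case
    unfolding eq card_image[OF inj] using Cons by (simp add: card_cartesian_product)
qed simp

lemma nn_integral_prod_list_replicate: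
  "(\<integral>\<^sup>+ns. of_nat (prod_list ns) \<partial>measure_pmf (replicate_pmf l p)) = (\<integral>\<^sup>+n. of_nat n \<partial>measure_pmf p) ^ l"
proof (induction l)
  case (Suc l)
  have "(\<integral>\<^sup>+ns. of_nat (prod_list ns) \<partial>measure_pmf (replicate_pmf (Suc l) p)) =
      (\<integral>\<^sup>+x. of_nat (fst x) * of_nat (prod_list (snd x)) \<partial>measure_pmf (pair_pmf p (replicate_pmf l p)))"
    unfolding replicate_pmf_Suc_pair nn_integral_map_pmf by (simp add: case_prod_unfold)
  also have "\<dots> = (\<integral>\<^sup>+n. of_nat n * (\<integral>\<^sup>+ns. of_nat (prod_list ns) \<partial>measure_pmf (replicate_pmf l p)) \<partial>measure_pmf p)"
    by (simp add: nn_integral_pair_pmf' nn_integral_cmult)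
  also have "\<dots> = (\<integral>\<^sup>+n. of_nat n \<partial>measure_pmf p) ^ Suc l"
    unfolding Suc.IH by (simp add: nn_integral_multc)
  finally show ?case .
qed simp

text \<open>The offspring numbers along every potential vertex \<open>w\<close> have the same law,
  so the sum may be computed with one common list \<open>ns\<close>, for which exactly
  \<open>prod_list ns\<close> words \<open>w\<close> are admissible.\<close>

lemma sum_list_all2_less:
  "(\<integral>\<^sup>+w. emeasure (measure_pmf (replicate_pmf l p)) {ns. list_all2 (<) w ns} \<partial>count_space {w :: nat list. length w = l}) =
    (\<integral>\<^sup>+n. of_nat n \<partial>measure_pmf p) ^ l"
proof -
  have "(\<integral>\<^sup>+w. emeasure (measure_pmf (replicate_pmf l p)) {ns. list_all2 (<) w ns} \<partial>count_space {w :: nat list. length w = l}) =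
      (\<integral>\<^sup>+w. \<integral>\<^sup>+ns. indicator {ns. list_all2 (<) w ns} ns \<partial>measure_pmf (replicate_pmf l p) \<partial>count_space {w :: nat list. length w = l})"
    by simp
  also have "\<dots> = (\<integral>\<^sup>+ns. \<integral>\<^sup>+w. indicator {ns. list_all2 (<) w ns} ns \<partial>count_space {w :: nat list. length w = l} \<partial>measure_pmf (replicate_pmf l p))"
    by (rule nn_integral_count_space_nn_integral[symmetric]) auto
  also have "\<dots> = (\<integral>\<^sup>+ns. of_nat (prod_list ns) \<partial>measure_pmf (replicate_pmf l p))"
  proof (rule nn_integral_cong_AE, unfold AE_measure_pmf_iff, rule ballI)
    fix ns assume "ns \<in> set_pmf (replicate_pmf l p)"
    then have len: "length ns = l" by (simp add: set_replicate_pmf)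
    have "(\<integral>\<^sup>+w. indicator {ns. list_all2 (<) w ns} ns \<partial>count_space {w :: nat list. length w = l}) =
        (\<integral>\<^sup>+w. indicator {w. list_all2 (<) w ns} w \<partial>count_space {w :: nat list. length w = l})"
      by (intro nn_integral_cong) (simp add: indicator_def)
    also have "\<dots> = emeasure (count_space {w. length w = l}) {w. list_all2 (<) w ns}"
      using len by (intro nn_integral_indicator) (auto dest: list_all2_lengthD)
    also have "\<dots> = of_nat (card {w. list_all2 (<) w ns})"
      using len card_list_all2_less[of ns] by (intro emeasure_count_space_finite) (auto dest: list_all2_lengthD)
    finally show "(\<integral>\<^sup>+w. indicator {ns. list_all2 (<) w ns} ns \<partial>count_space {w :: nat list. length w = l}) =
        of_nat (prod_list ns)"
      using card_list_all2_less[of ns] by simp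
  qed
  finally show ?thesis by (simp add: nn_integral_prod_list_replicate)
qed

lemma sets_mem_blocks_labels:
  fixes \<nu> :: "('e::countable) pmf"
  shows "{z \<in> space (vertices p \<Otimes>\<^sub>M nonroot \<nu>). w \<in> blocks l A (labels z)} \<in> sets (vertices p \<Otimes>\<^sub>M nonroot \<nu>)"
    and "emeasure (vertices p \<Otimes>\<^sub>M nonroot \<nu>) {z \<in> space (vertices p \<Otimes>\<^sub>M nonroot \<nu>). w \<in> blocks l A (labels z)} =
      (if length w = l then emeasure (measure_pmf (replicate_pmf l p)) {ns. list_all2 (<) w ns} *
        emeasure (measure_pmf (replicate_pmf l \<nu>)) A else 0)"
proof -
  interpret E: prob_space "nonroot \<nu>" by (rule prob_space_nonroot)
  let ?S = "vertices p \<Otimes>\<^sub>M nonroot \<nu>"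
  have "{z \<in> space ?S. w \<in> blocks l A (labels z)} \<in> sets ?S \<and>
    emeasure ?S {z \<in> space ?S. w \<in> blocks l A (labels z)} =
      (if length w = l then emeasure (measure_pmf (replicate_pmf l p)) {ns. list_all2 (<) w ns} *
        emeasure (measure_pmf (replicate_pmf l \<nu>)) A else 0)"
  proof (cases "length w = l")
    case True
    let ?V = "{f \<in> space (vertices p). map (\<lambda>k. f (take k w)) [0..<l] \<in> {ns. list_all2 (<) w ns}}"
    let ?E = "{e \<in> space (nonroot \<nu>). map (\<lambda>k. e (take (Suc k) w)) [0..<l] \<in> A}"
    have len: "length (take k w) = k" if "k \<le> l" for k using that True by simp
    have inj1: "inj_on (\<lambda>k. take k w) {..<l}"
      by (rule inj_onI) (metis len lessThan_iff less_imp_le)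
    have inj2: "inj_on (\<lambda>k. take (Suc k) w) {..<l}"
      by (rule inj_onI) (metis len Suc_inject Suc_leI lessThan_iff)
    have ne: "take (Suc k) w \<in> {u. u \<noteq> []}" if "k < l" for k using that True by auto
    have eq: "{z \<in> space ?S. w \<in> blocks l A (labels z)} = ?V \<times> ?E"
      using True by (auto simp: mem_blocks_labels space_pair_measure)
    have "?V \<in> sets (vertices p)"
      by (rule emeasure_map_coordinates(2)[OF inj1]) simp
    moreover have "?E \<in> sets (nonroot \<nu>)"
      by (rule emeasure_map_coordinates(2)[OF inj2]) (rule ne)
    ultimately have sets: "?V \<in> sets (vertices p)" "?E \<in> sets (nonroot \<nu>)" .
    have "emeasure ?S (?V \<times> ?E) = emeasure (vertices p) ?V * emeasure (nonroot \<nu>) ?E"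
      using sets by (rule E.emeasure_pair_measure_Times)
    also have "emeasure (vertices p) ?V = emeasure (measure_pmf (replicate_pmf l p)) {ns. list_all2 (<) w ns}"
      by (rule emeasure_map_coordinates(1)[OF inj1]) simp
    also have "emeasure (nonroot \<nu>) ?E = emeasure (measure_pmf (replicate_pmf l \<nu>)) A"
      by (rule emeasure_map_coordinates(1)[OF inj2]) (rule ne)
    finally show ?thesis
      unfolding eq using True pair_measureI[OF sets] by simp
  next
    case False
    then have "{z \<in> space ?S. w \<in> blocks l A (labels z)} = {}" by (simp add: mem_blocks_labels)
    then show ?thesis using False by (simp only: sets.empty_sets emeasure_empty if_False simp_thms)
  qed
  then show "{z \<in> space ?S. w \<in> blocks l A (labels z)} \<in> sets ?S"
    "emeasure ?S {z \<in> space ?S. w \<in> blocks l A (labels z)} =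
      (if length w = l then emeasure (measure_pmf (replicate_pmf l p)) {ns. list_all2 (<) w ns} *
        emeasure (measure_pmf (replicate_pmf l \<nu>)) A else 0)"
    by blast+
qed

text \<open>This is the many-to-one formula. In the sum over potential vertices of level
  \<open>l\<close>, each contributes its probability of lying in the tree times the same probability
  for its steps.\<close>

theorem mean_card_blocks:
  fixes \<nu> :: "('e::countable) pmf"
  shows "(\<integral>\<^sup>+\<omega>. of_nat (card (blocks l A \<omega>)) \<partial>vertices (label_law p \<nu>)) =
    (\<integral>\<^sup>+n. of_nat n \<partial>measure_pmf p) ^ l * emeasure (measure_pmf (replicate_pmf l \<nu>)) A"
proof -
  let ?S = "vertices p \<Otimes>\<^sub>M nonroot \<nu>"
  let ?W = "{w :: nat list. length w = l}"
  interpret edge_labels "label_law p \<nu>" by unfold_locales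
  have "(\<integral>\<^sup>+\<omega>. of_nat (card (blocks l A \<omega>)) \<partial>vertices (label_law p \<nu>)) =
      (\<integral>\<^sup>+\<omega>. of_nat (card (blocks l A \<omega>)) \<partial>distr ?S (vertices (label_law p \<nu>)) labels)"
    unfolding distr_attach ..
  also have "\<dots> = (\<integral>\<^sup>+z. of_nat (card (blocks l A (labels z))) \<partial>?S)"
  proof (rule nn_integral_distr)
    show "labels \<in> measurable ?S (vertices (label_law p \<nu>))" by (rule measurable_attach)
    have "(\<lambda>\<omega>. of_nat (card (blocks l A \<omega>)) :: ennreal) \<in> borel_measurable (vertices (label_law p \<nu>))"
      by (rule measurable_compose[OF card_blocks_measurable]) simp
    then show "(\<lambda>\<omega>. of_nat (card (blocks l A \<omega>)) :: ennreal) \<in>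
        borel_measurable (distr ?S (vertices (label_law p \<nu>)) labels)"
      by (simp only: measurable_distr_eq1)
  qed
  also have "\<dots> = (\<integral>\<^sup>+z. \<integral>\<^sup>+w. indicator {z \<in> space ?S. w \<in> blocks l A (labels z)} z \<partial>count_space ?W \<partial>?S)"
  proof (rule nn_integral_cong)
    fix z assume z: "z \<in> space ?S"
    have "(\<integral>\<^sup>+w. indicator {z \<in> space ?S. w \<in> blocks l A (labels z)} z \<partial>count_space ?W) =
        (\<integral>\<^sup>+w. indicator (blocks l A (labels z)) w \<partial>count_space ?W)"
      using z by (intro nn_integral_cong) (simp add: indicator_def)
    also have "\<dots> = emeasure (count_space ?W) (blocks l A (labels z))"
      by (rule nn_integral_indicator) (auto simp: blocks_def)
    also have "\<dots> = of_nat (card (blocks l A (labels z)))"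
      using finite_blocks by (intro emeasure_count_space_finite) (auto simp: blocks_def)
    finally show "of_nat (card (blocks l A (labels z))) =
        (\<integral>\<^sup>+w. indicator {z \<in> space ?S. w \<in> blocks l A (labels z)} z \<partial>count_space ?W)" ..
  qed
  also have "\<dots> = (\<integral>\<^sup>+w. \<integral>\<^sup>+z. indicator {z \<in> space ?S. w \<in> blocks l A (labels z)} z \<partial>?S \<partial>count_space ?W)"
    by (rule nn_integral_count_space_nn_integral)
      (simp, rule borel_measurable_indicator, rule sets_mem_blocks_labels(1))
  also have "\<dots> = (\<integral>\<^sup>+w. emeasure (measure_pmf (replicate_pmf l p)) {ns. list_all2 (<) w ns} *
      emeasure (measure_pmf (replicate_pmf l \<nu>)) A \<partial>count_space ?W)"
    by (rule nn_integral_cong) (simp add: nn_integral_indicator sets_mem_blocks_labels)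
  also have "\<dots> = (\<integral>\<^sup>+w. emeasure (measure_pmf (replicate_pmf l p)) {ns. list_all2 (<) w ns} \<partial>count_space ?W) *
      emeasure (measure_pmf (replicate_pmf l \<nu>)) A"
    by (rule nn_integral_multc) simp
  finally show ?thesis unfolding sum_list_all2_less .
qed

section \<open>Percolation\<close>

lemma zip_replicate_pmf:
  "map_pmf (\<lambda>(xs, ys). zip xs ys) (pair_pmf (replicate_pmf n p) (replicate_pmf n q)) = replicate_pmf n (pair_pmf p q)"
proof (induction n)
  case (Suc n)
  have "map_pmf (\<lambda>(xs, ys). zip xs ys) (pair_pmf (replicate_pmf (Suc n) p) (replicate_pmf (Suc n) q)) =
      bind_pmf p (\<lambda>x. bind_pmf (replicate_pmf n p) (\<lambda>xs. bind_pmf q (\<lambda>y. bind_pmf (replicate_pmf n q)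
        (\<lambda>ys. return_pmf ((x, y) # zip xs ys)))))"
    by (simp add: pair_pmf_def map_bind_pmf bind_assoc_pmf bind_return_pmf)
  also have "\<dots> = bind_pmf p (\<lambda>x. bind_pmf q (\<lambda>y. bind_pmf (replicate_pmf n p) (\<lambda>xs. bind_pmf (replicate_pmf n q)
        (\<lambda>ys. return_pmf ((x, y) # zip xs ys)))))"
    by (subst bind_commute_pmf) (rule refl)
  also have "\<dots> = bind_pmf (pair_pmf p q) (\<lambda>z. bind_pmf
      (map_pmf (\<lambda>(xs, ys). zip xs ys) (pair_pmf (replicate_pmf n p) (replicate_pmf n q))) (\<lambda>zs. return_pmf (z # zs)))"
    by (simp add: pair_pmf_def map_bind_pmf bind_assoc_pmf bind_return_pmf)
  finally show ?case unfolding Suc.IH by simp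
qed (simp add: pair_return_pmf1)

text \<open>Independent bits on the edges give a tree whose steps carry a bit and whose labels are
  again i.i.d., so all results on \<open>edge_labels\<close> apply to the percolated tree.\<close>

lemma attach_zip_label_law:
  "attach_pmf length zip (label_law p \<mu>) \<nu> = label_law p (pair_pmf \<mu> \<nu>)"
proof -
  have "bind_pmf (replicate_pmf n \<mu>) (\<lambda>xs. map_pmf (zip xs) (replicate_pmf (length xs) \<nu>)) = replicate_pmf n (pair_pmf \<mu> \<nu>)" for n
  proof -
    have "bind_pmf (replicate_pmf n \<mu>) (\<lambda>xs. map_pmf (zip xs) (replicate_pmf (length xs) \<nu>)) =
        bind_pmf (replicate_pmf n \<mu>) (\<lambda>xs. map_pmf (zip xs) (replicate_pmf n \<nu>))"
      by (rule bind_pmf_cong) (auto simp: set_replicate_pmf)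
    also have "\<dots> = map_pmf (\<lambda>(xs, ys). zip xs ys) (pair_pmf (replicate_pmf n \<mu>) (replicate_pmf n \<nu>))"
      by (simp add: pair_pmf_def map_bind_pmf map_pmf_def[of "zip _"])
    finally show ?thesis unfolding zip_replicate_pmf .
  qed
  then show ?thesis
    by (simp add: attach_pmf_def bind_assoc_pmf map_pmf_ident)
qed

lemma prob_all_open:
  fixes \<mu> :: "('a::countable) pmf"
  assumes "0 \<le> \<beta>" "\<beta> \<le> 1"
  shows "measure_pmf.prob (replicate_pmf n (pair_pmf \<mu> (bernoulli_pmf \<beta>))) {es. list_all snd es \<and> map fst es \<in> A} =
    \<beta> ^ n * measure_pmf.prob (replicate_pmf n \<mu>) A"
proof -
  let ?b = "replicate_pmf n (bernoulli_pmf \<beta>)"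
  let ?p = "pair_pmf (replicate_pmf n \<mu>) ?b"
  have "measure_pmf.prob (replicate_pmf n (pair_pmf \<mu> (bernoulli_pmf \<beta>))) {es. list_all snd es \<and> map fst es \<in> A} =
      measure_pmf.prob ?p ((\<lambda>(xs, ys). zip xs ys) -` {es. list_all snd es \<and> map fst es \<in> A})"
    unfolding zip_replicate_pmf[symmetric] by (rule measure_map_pmf)
  also have "\<dots> = measure_pmf.prob ?p (A \<times> {replicate n True})"
  proof (rule measure_pmf.finite_measure_eq_AE)
    show "AE x in ?p. x \<in> (\<lambda>(xs, ys). zip xs ys) -` {es. list_all snd es \<and> map fst es \<in> A} \<longleftrightarrow>
        x \<in> A \<times> {replicate n True}"
      unfolding AE_measure_pmf_iff
    proof
      fix x assume "x \<in> set_pmf ?p"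
      then have len: "length (fst x) = n" "length (snd x) = n" by (auto simp: set_replicate_pmf)
      have "list_all snd (zip (fst x) (snd x)) \<longleftrightarrow> snd x = replicate n True"
        using len by (auto simp: list_all_length list_eq_iff_nth_eq)
      moreover have "map fst (zip (fst x) (snd x)) = fst x" using len by simp
      ultimately show "x \<in> (\<lambda>(xs, ys). zip xs ys) -` {es. list_all snd es \<and> map fst es \<in> A} \<longleftrightarrow>
          x \<in> A \<times> {replicate n True}"
        by (cases x) auto
    qed
  qed auto
  also have "\<dots> = measure_pmf.prob (replicate_pmf n \<mu>) A * measure_pmf.prob ?b {replicate n True}"
    by (rule measure_pmf_prob_product) simp_all
  also have "measure_pmf.prob ?b {replicate n True} = \<beta> ^ n"
    using assms by (simp add: measure_pmf_single pmf_replicate_prod)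
  finally show ?thesis by (simp add: mult.commute)
qed

section \<open>Rays with prescribed lower and upper speed\<close>

lemma strict_mono_interval:
  fixes m :: "nat \<Rightarrow> nat"
  assumes m: "strict_mono m" and "m a \<le> N"
  obtains n where "a \<le> n" "m n \<le> N" "N < m (Suc n)"
proof -
  define k where "k = (LEAST k. N < m k)"
  have "Suc N \<le> m (Suc N)" by (rule strict_mono_imp_increasing[OF m])
  then have "N < m (Suc N)" by simp
  then have k: "N < m k" unfolding k_def by (rule LeastI)
  have "a < k"
  proof (rule ccontr)
    assume "\<not> a < k"
    then have "m k \<le> m a" using m by (simp add: strict_mono_less_eq)
    with k assms(2) show False by simp
  qed
  then obtain n where n: "k = Suc n" "a \<le> n" by (cases k) auto
  have "\<not> N < m n" using not_less_Least[of n "\<lambda>k. N < m k"] n by (simp add: k_def)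
  with k n show ?thesis by (intro that[of n]) auto
qed

text \<open>On the \<open>n\<close>-th stretch of the ray the speed moves from \<open>q n\<close> to \<open>q (Suc n)\<close>, so up to an error
  that vanishes in the limit it stays between these values.\<close>

lemma interpolated_liminf:
  fixes H :: "nat \<Rightarrow> real" and q :: "nat \<Rightarrow> real" and m f :: "nat \<Rightarrow> nat"
  assumes m: "strict_mono m"
    and core: "\<And>n N. m (Suc n) \<le> N \<Longrightarrow> N \<le> m (Suc (Suc n)) \<Longrightarrow>
      \<bar>H N - (q n * real (m (Suc n)) + q (Suc n) * (real N - real (m (Suc n))))\<bar> \<le> K * real N / real (Suc n)"
    and q: "\<And>n. \<alpha> - 1 / real (Suc n) \<le> q (Suc n)"
    and f: "strict_mono f" "\<And>k. \<bar>q (Suc (f k)) - \<alpha>\<bar> \<le> 1 / real (Suc (f k))"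
  shows "liminf (\<lambda>N. ereal (H N / real N)) = ereal \<alpha>"
proof -
  \<comment> \<open>Error budget: the first term bounds the distance of the slopes from the target,
    the second the interpolation error.\<close>
  let ?e = "\<lambda>n. 1 / real (Suc n) + K / real (Suc (Suc n))"
  have mpos: "0 < m (Suc n)" for n
    using strict_monoD[OF m, of 0 "Suc n"] by simp
  have low: "c - K / real (Suc n) \<le> H N / real N"
    if "m (Suc n) \<le> N" "N \<le> m (Suc (Suc n))" "c \<le> q n" "c \<le> q (Suc n)" for n N c
  proof -
    have N: "0 < real N" using mpos[of n] that by linarith
    have "c * real (m (Suc n)) + c * (real N - real (m (Suc n))) \<le>
        q n * real (m (Suc n)) + q (Suc n) * (real N - real (m (Suc n)))"
      using that by (intro add_mono mult_right_mono) auto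
    then have "c * real N \<le> q n * real (m (Suc n)) + q (Suc n) * (real N - real (m (Suc n)))"
      by (simp add: algebra_simps)
    then have "c * real N - K * real N / real (Suc n) \<le> H N"
      using core[OF that(1,2)] by (simp only: abs_le_iff) linarith
    moreover have "c * real N - K * real N / real (Suc n) = (c - K / real (Suc n)) * real N"
      by (simp add: left_diff_distrib)
    ultimately show ?thesis using N by (simp only: pos_le_divide_eq)
  qed
  have e: "?e \<longlonglongrightarrow> 0"
    using tendsto_add[OF lim_const_over_n[THEN LIMSEQ_Suc, of 1] lim_const_over_n[THEN LIMSEQ_Suc, THEN LIMSEQ_Suc, of K]]
    by simp
  have ev_low: "\<forall>\<^sub>F N in sequentially. \<alpha> - \<epsilon> < H N / real N" if \<epsilon>: "0 < \<epsilon>" for \<epsilon> :: real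
  proof -
    obtain a where a: "\<And>n. a \<le> n \<Longrightarrow> ?e n < \<epsilon>"
      using order_tendstoD(2)[OF e \<epsilon>] unfolding eventually_sequentially by blast
    show ?thesis
      unfolding eventually_sequentially
    proof (intro exI[of _ "m (Suc (Suc a))"] allI impI)
      fix N assume "m (Suc (Suc a)) \<le> N"
      from strict_mono_interval[OF m this]
      obtain n' where n': "Suc (Suc a) \<le> n'" "m n' \<le> N" "N < m (Suc n')" .
      then obtain n where n: "n' = Suc (Suc n)" "a \<le> n" by (metis Suc_le_D Suc_le_mono)
      have le: "1 / real (Suc (Suc n)) \<le> 1 / real (Suc n)" by (simp add: frac_le)
      have "(\<alpha> - 1 / real (Suc n)) - K / real (Suc (Suc n)) \<le> H N / real N"
      proof (rule low)
        show "m (Suc (Suc n)) \<le> N" "N \<le> m (Suc (Suc (Suc n)))" using n n' by simp_all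
        show "\<alpha> - 1 / real (Suc n) \<le> q (Suc n)" using q[of n] le by linarith
        show "\<alpha> - 1 / real (Suc n) \<le> q (Suc (Suc n))" using q[of "Suc n"] le by linarith
      qed
      with a[OF n(2)] show "\<alpha> - \<epsilon> < H N / real N" by linarith
    qed
  qed
  \<comment> \<open>At the start of the next stretch the interpolation formula reduces to the slope
    of the stretch just completed, which makes the target an accumulation point.\<close>
  have at: "\<bar>H (m (Suc (Suc n))) / real (m (Suc (Suc n))) - q (Suc n)\<bar> \<le> K / real (Suc (Suc n))" for n
  proof -
    let ?N = "m (Suc (Suc n))"
    have N: "0 < real ?N" using mpos by simp
    have "?N \<le> m (Suc (Suc (Suc n)))" using m by (simp add: strict_mono_less_eq)
    from core[OF order_refl this]
    have *: "\<bar>H ?N - q (Suc n) * real ?N\<bar> \<le> K * real ?N / real (Suc (Suc n))" by simp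
    have "H ?N / real ?N - q (Suc n) = (H ?N - q (Suc n) * real ?N) / real ?N"
      using N by (simp add: diff_divide_distrib)
    then have "\<bar>H ?N / real ?N - q (Suc n)\<bar> = \<bar>H ?N - q (Suc n) * real ?N\<bar> / real ?N"
      by (simp only: abs_divide abs_of_nat)
    also have "\<dots> \<le> (K * real ?N / real (Suc (Suc n))) / real ?N"
      using * by (rule divide_right_mono) simp
    finally show ?thesis using N by simp
  qed
  let ?r = "\<lambda>k. m (Suc (Suc (f k)))"
  have "(\<lambda>k. H (?r k) / real (?r k)) \<longlonglongrightarrow> \<alpha>"
  proof (rule LIM_zero_cancel, rule Lim_null_comparison)
    show "(\<lambda>k. ?e (f k)) \<longlonglongrightarrow> 0"
      using LIMSEQ_subseq_LIMSEQ[OF e f(1)] by (simp add: comp_def)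
    have "\<bar>H (?r k) / real (?r k) - \<alpha>\<bar> \<le> ?e (f k)" for k
      using at[of "f k"] f(2)[of k] by linarith
    then show "\<forall>\<^sub>F k in sequentially. norm (H (?r k) / real (?r k) - \<alpha>) \<le> ?e (f k)"
      by (intro always_eventually allI) (simp only: real_norm_def)
  qed
  then have sub: "liminf ((\<lambda>N. ereal (H N / real N)) \<circ> ?r) = ereal \<alpha>"
    by (intro lim_imp_Liminf) (simp_all add: comp_def)
  show ?thesis
  proof (rule antisym)
    have "strict_mono ?r" by (rule strict_monoI) (simp add: strict_mono_less[OF m] strict_mono_less[OF f(1)])
    from liminf_subseq_mono[OF this, of "\<lambda>N. ereal (H N / real N)"]
    show "liminf (\<lambda>N. ereal (H N / real N)) \<le> ereal \<alpha>" unfolding sub .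
    show "ereal \<alpha> \<le> liminf (\<lambda>N. ereal (H N / real N))"
      unfolding le_Liminf_iff
    proof (intro allI impI)
      fix y assume "y < ereal \<alpha>"
      then obtain z where z: "y < ereal z" "z < \<alpha>" using ereal_dense2 by (metis less_ereal.simps(1))
      show "\<forall>\<^sub>F N in sequentially. y < ereal (H N / real N)"
        using ev_low[of "\<alpha> - z"] z by (auto elim!: eventually_mono intro: less_trans)
    qed
  qed
qed

lemma alternating_limits:
  fixes H :: "nat \<Rightarrow> real" and q :: "nat \<Rightarrow> real" and m :: "nat \<Rightarrow> nat"
  assumes m: "strict_mono m"
    and core: "\<And>n N. m (Suc n) \<le> N \<Longrightarrow> N \<le> m (Suc (Suc n)) \<Longrightarrow>
      \<bar>H N - (q n * real (m (Suc n)) + q (Suc n) * (real N - real (m (Suc n))))\<bar> \<le> K * real N / real (Suc n)"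
    and q: "\<And>n. \<bar>q (Suc n) - (if even n then \<alpha> else \<beta>)\<bar> \<le> 1 / real (Suc n)"
    and "\<alpha> \<le> \<beta>"
  shows "liminf (\<lambda>N. ereal (H N / real N)) = ereal \<alpha>" "limsup (\<lambda>N. ereal (H N / real N)) = ereal \<beta>"
proof -
  have bounds: "\<alpha> - 1 / real (Suc n) \<le> q (Suc n)" "- \<beta> - 1 / real (Suc n) \<le> - q (Suc n)" for n
    using q[of n] \<open>\<alpha> \<le> \<beta>\<close> by (auto simp: abs_le_iff split: if_splits)
  show "liminf (\<lambda>N. ereal (H N / real N)) = ereal \<alpha>"
  proof (rule interpolated_liminf[OF m core bounds(1)])
    show "strict_mono (\<lambda>k::nat. 2 * k)" by (rule strict_monoI) simp
    show "\<bar>q (Suc (2 * k)) - \<alpha>\<bar> \<le> 1 / real (Suc (2 * k))" for k using q[of "2 * k"] by simp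
  qed
  \<comment> \<open>Negating \<open>H\<close> and \<open>q\<close> exchanges lower and upper limits;
    the slopes \<open>q (Suc n)\<close> near \<open>\<beta>\<close> are those with odd
    \<open>n\<close>.\<close>
  have "liminf (\<lambda>N. ereal (- H N / real N)) = ereal (- \<beta>)"
  proof (rule interpolated_liminf[OF m _ bounds(2)])
    show "\<bar>- H N - (- q n * real (m (Suc n)) + - q (Suc n) * (real N - real (m (Suc n))))\<bar> \<le> K * real N / real (Suc n)"
      if "m (Suc n) \<le> N" "N \<le> m (Suc (Suc n))" for n N
      using core[OF that] by (simp only: abs_le_iff mult_minus_left) linarith
    show "strict_mono (\<lambda>k::nat. Suc (2 * k))" by (rule strict_monoI) simp
    show "\<bar>- q (Suc (Suc (2 * k))) - - \<beta>\<bar> \<le> 1 / real (Suc (Suc (2 * k)))" for k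
      using q[of "Suc (2 * k)"] by simp
  qed
  then have "- liminf (\<lambda>N. - ereal (H N / real N)) = ereal \<beta>" by simp
  then show "limsup (\<lambda>N. ereal (H N / real N)) = ereal \<beta>"
    by (simp only: ereal_Liminf_uminus ereal_uminus_uminus)
qed

section \<open>Concatenation of blocks without cancellation\<close>

text \<open>The empty word is the position of the root but is not anchored; adding it gives a set
  that contains the empty product and is closed under multiplication.\<close>

definition plain :: "nat \<Rightarrow> fword set" where
  "plain d = {w. w = [] \<or> w \<in> anchored d (length w)}"

lemma Nil_plain [simp]: "[] \<in> plain d"
  by (simp add: plain_def)

lemma anchored_plain: "w \<in> anchored d j \<Longrightarrow> w \<in> plain d \<and> length w = j"
  by (auto simp: plain_def anchored_def)

lemma plain_reduced: "w \<in> plain d \<Longrightarrow> reduced w"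
  by (auto simp: plain_def anchored_def)

lemma plain_mult:
  assumes "v \<in> plain d" "w \<in> plain d"
  shows "foldr cancel_cons v w \<in> plain d" "length (foldr cancel_cons v w) = length v + length w"
proof -
  have "foldr cancel_cons v w \<in> plain d \<and> length (foldr cancel_cons v w) = length v + length w"
  proof (cases "v = [] \<or> w = []")
    case True
    then show ?thesis using assms foldr_Nil[OF plain_reduced[OF assms(1)]] by auto
  next
    case False
    then have "foldr cancel_cons v w \<in> anchored d (length v + length w)"
      using assms by (intro anchored_mult) (auto simp: plain_def)
    then show ?thesis by (rule anchored_plain)
  qed
  then show "foldr cancel_cons v w \<in> plain d" "length (foldr cancel_cons v w) = length v + length w"
    by auto
qed

text \<open>Membership of the steps in \<open>steps d\<close> is built in because the ray
  construction is deterministic, whereas only almost every tree has legal steps.\<close>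

definition open_words :: "nat \<Rightarrow> nat \<Rightarrow> (fword \<times> bool) list set" where
  "open_words d j = {es. list_all snd es \<and> map fst es \<in> {xs. set xs \<subseteq> steps d \<and> lp d xs \<in> anchored d j}}"

abbreviation open_survival :: "nat \<Rightarrow> nat \<times> nat \<Rightarrow> (nat list \<Rightarrow> (fword \<times> bool) list) set" where
  "open_survival d i \<equiv> survival (fst i) (open_words d (snd i))"

abbreviation open_reach where
  "open_reach d i \<equiv> reach (fst i) (open_words d (snd i))"

abbreviation pos :: "nat \<Rightarrow> (fword \<times> bool) list \<Rightarrow> fword" where
  "pos d es \<equiv> lp d (map fst es)"

lemma concat_open_words:
  assumes "set ess \<subseteq> open_words d j"
  shows "pos d (concat ess) \<in> plain d \<and> length (pos d (concat ess)) = length ess * j \<and>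
    list_all snd (concat ess) \<and> set (map fst (concat ess)) \<subseteq> steps d"
  using assms
proof (induction ess)
  case (Cons es ess)
  then have es: "list_all snd es" "set (map fst es) \<subseteq> steps d" "pos d es \<in> plain d" "length (pos d es) = j"
    using anchored_plain[of "pos d es" d j] by (auto simp: open_words_def)
  have IH: "pos d (concat ess) \<in> plain d" "length (pos d (concat ess)) = length ess * j"
    "list_all snd (concat ess)" "set (map fst (concat ess)) \<subseteq> steps d"
    using Cons by auto
  have "pos d (concat (es # ess)) = foldr cancel_cons (pos d es) (pos d (concat ess))"
    using lp_append[OF IH(4)] by simp
  then show ?case
    using es IH plain_mult[OF es(3) IH(1)] by simp
qed simp

lemma reach_path:
  assumes "\<omega> \<in> (reach l A ^^ k) G"
  shows "\<exists>w ess. w \<in> tree \<omega> \<and> length ess = k \<and> set ess \<subseteq> A \<and> (\<forall>es\<in>set ess. length es = l) \<and>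
    edges \<omega> w = concat ess \<and> shift w \<omega> \<in> G"
  using assms
proof (induction k arbitrary: \<omega>)
  case 0
  then show ?case by (intro exI[of _ "[]"]) auto
next
  case (Suc k)
  then have "\<omega> \<in> reach l A ((reach l A ^^ k) G)" by simp
  then obtain v where v: "v \<in> blocks l A \<omega>" "shift v \<omega> \<in> (reach l A ^^ k) G"
    unfolding reach_def[of l A "(reach l A ^^ k) G"] by blast
  from Suc.IH[OF v(2)] obtain w ess where w: "w \<in> tree (shift v \<omega>)" "length ess = k" "set ess \<subseteq> A"
    "\<forall>es\<in>set ess. length es = l" "edges (shift v \<omega>) w = concat ess" "shift w (shift v \<omega>) \<in> G"
    by blast
  show ?case
    using v w by (intro exI[of _ "v @ w"] exI[of _ "edges \<omega> v # ess"])
      (auto simp: blocks_def tree_append edges_append)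
qed

lemma take_concat:
  assumes "\<forall>es\<in>set ess. length es = l"
  shows "take (s * l) (concat ess) = concat (take s ess)"
  using assms
proof (induction ess arbitrary: s)
  case (Cons es ess)
  then show ?case by (cases s) auto
qed simp

lemma length_concat_uniform:
  assumes "\<forall>es\<in>set ess. length es = l"
  shows "length (concat ess) = length ess * l"
  using assms by (induction ess) auto

lemma pos_length_append:
  assumes "set (map fst es) \<subseteq> steps d" "set (map fst fs) \<subseteq> steps d"
  shows "\<bar>real (length (pos d (es @ fs))) - real (length (pos d es))\<bar> \<le> real (length fs)"
  using lp_length_append[of "map fst es" d "map fst fs"] assms by simp

text \<open>Completed blocks contribute exactly \<open>j\<close> each. An unfinished block has fewer
  than \<open>l\<close> steps, which costs at most \<open>l\<close> in the position and at most
  \<open>l\<close> in the linear interpolation.\<close>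

lemma block_interpolation:
  assumes es: "pos d es \<in> plain d" "set (map fst es) \<subseteq> steps d"
    and ess: "set ess \<subseteq> open_words d j" "\<forall>es\<in>set ess. length es = l"
    and l: "0 < l" "j \<le> l" and N: "N \<le> length (concat ess)"
  shows "\<bar>real (length (pos d (es @ take N (concat ess)))) -
    (real (length (pos d es)) + real j / real l * real N)\<bar> \<le> 2 * real l"
proof -
  define s where "s = N div l"
  define rest where "rest = drop (s * l) (take N (concat ess))"
  have sl: "s * l \<le> N" "N - s * l < l" "N - s * l = N mod l"
    using l by (auto simp: s_def minus_div_mult_eq_mod)
  have split: "take N (concat ess) = concat (take s ess) @ rest"
  proof -
    have "take (s * l) (take N (concat ess)) = concat (take s ess)"
      using sl take_concat[OF ess(2), of s] by (simp add: min_def)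
    then show ?thesis unfolding rest_def by (metis append_take_drop_id)
  qed
  have all: "set (map fst (concat ess)) \<subseteq> steps d"
    using concat_open_words[OF ess(1)] by blast
  then have fsts: "set (map fst (take N (concat ess))) \<subseteq> steps d"
    unfolding take_map[symmetric] by (rule order_trans[OF set_take_subset])
  have sub: "set (take s ess) \<subseteq> open_words d j" using ess(1) set_take_subset[of s ess] by blast
  have s_le: "s \<le> length ess"
  proof -
    have "N \<le> length ess * l" using N length_concat_uniform[OF ess(2)] by simp
    then have "N div l \<le> length ess * l div l" by (rule div_le_mono)
    then show ?thesis using l by (simp add: s_def)
  qed
  note c = concat_open_words[OF sub]
  have len_s: "length (pos d (es @ concat (take s ess))) = length (pos d es) + s * j"
  proof -
    have "pos d (es @ concat (take s ess)) = foldr cancel_cons (pos d es) (pos d (concat (take s ess)))"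
      using lp_append[of "map fst (concat (take s ess))" d "map fst es"] c by simp
    then show ?thesis using plain_mult(2)[OF es(1)] c s_le by simp
  qed
  have len_rest: "length rest = N - s * l" using N by (simp add: rest_def)
  have r: "length rest < l" "real (length rest) = real N - real s * real l"
    unfolding len_rest of_nat_diff[OF sl(1)] of_nat_mult by (rule sl(2), rule refl)
  have "\<bar>real (length (pos d (es @ take N (concat ess)))) - real (length (pos d (es @ concat (take s ess))))\<bar> \<le> real (length rest)"
    using pos_length_append[of "es @ concat (take s ess)" d rest] es(2) c fsts unfolding split by auto
  moreover have "real (length (pos d (es @ concat (take s ess)))) =
      real (length (pos d es)) + real j / real l * real N - real j / real l * real (length rest)"
    using l unfolding len_s r(2) by (simp add: field_simps)
  moreover have "real j / real l * real (length rest) \<le> 1 * real (length rest)"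
    using l by (intro mult_right_mono) auto
  moreover have "0 \<le> real j / real l * real (length rest)" by simp
  ultimately show ?thesis using r(1) by linarith
qed

lemma ray_construction:
  fixes \<omega> :: "nat list \<Rightarrow> (fword \<times> bool) list" and i :: "nat \<Rightarrow> nat \<times> nat" and c :: nat
  defines "q \<equiv> \<lambda>n. real (snd (i n)) / real (fst (i n))"
  assumes start: "\<omega> \<in> open_survival d (i 0)"
    and trans: "\<And>u n k0. shift u \<omega> \<in> open_survival d (i n) \<Longrightarrow>
      \<exists>k\<ge>k0. shift u \<omega> \<in> (open_reach d (i n) ^^ k) (open_survival d (i (Suc n)))"
    and type: "\<And>n. 0 < fst (i n) \<and> snd (i n) \<le> fst (i n)"
  obtains t m where "t \<in> boundary (tree \<omega>)" "\<And>N. list_all snd (edges \<omega> (t N))"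
    "\<And>N. set (map fst (edges \<omega> (t N))) \<subseteq> steps d"
    "strict_mono m" "\<And>n. Suc n * c \<le> m (Suc n)"
    "\<And>n N. m (Suc n) \<le> N \<Longrightarrow> N \<le> m (Suc (Suc n)) \<Longrightarrow>
      \<bar>real (length (pos d (edges \<omega> (t N)))) - (q n * real (m (Suc n)) + q (Suc n) * (real N - real (m (Suc n))))\<bar>
      \<le> 2 * real N / real (Suc n)"
proof -
  define P where "P n u \<longleftrightarrow> u \<in> tree \<omega> \<and> shift u \<omega> \<in> open_survival d (i n) \<and> pos d (edges \<omega> u) \<in> plain d \<and>
    list_all snd (edges \<omega> u) \<and> set (map fst (edges \<omega> u)) \<subseteq> steps d" for n u
  \<comment> \<open>Each block has at least one step, so this run length makes the next endpoint at
    least \<open>Suc n\<close> times as deep as the current depth and both block lengths together.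
    These bound the interpolation error, hence the factor \<open>1 / Suc n\<close>. The summand
    \<open>c\<close> reserves room for a prefix attached later.\<close>
  define K where "K n u = Suc n * (length u + fst (i n) + fst (i (Suc n)) + 1 + c)" for n and u :: "nat list"
  define Q where "Q n u u' \<longleftrightarrow> (\<exists>w ess. u' = u @ w \<and> edges (shift u \<omega>) w = concat ess \<and>
    set ess \<subseteq> open_words d (snd (i n)) \<and> (\<forall>es\<in>set ess. length es = fst (i n)) \<and> K n u \<le> length ess)" for n u u'
  have "\<exists>U. \<forall>n. P n (U n) \<and> Q n (U n) (U (Suc n))"
  proof (rule dependent_nat_choice)
    show "\<exists>u. P 0 u" using start by (intro exI[of _ "[]"]) (simp add: P_def)
  next
    fix u n assume Pu: "P n u"
    then obtain k where k: "K n u \<le> k" "shift u \<omega> \<in> (open_reach d (i n) ^^ k) (open_survival d (i (Suc n)))"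
      using trans[of u n "K n u"] by (auto simp: P_def)
    from reach_path[OF k(2)] obtain w ess where w: "w \<in> tree (shift u \<omega>)" "length ess = k"
      "set ess \<subseteq> open_words d (snd (i n))" "\<forall>es\<in>set ess. length es = fst (i n)"
      "edges (shift u \<omega>) w = concat ess" "shift w (shift u \<omega>) \<in> open_survival d (i (Suc n))"
      by blast
    note c = concat_open_words[OF w(3)]
    have "pos d (edges \<omega> (u @ w)) = foldr cancel_cons (pos d (edges \<omega> u)) (pos d (concat ess))"
      using lp_append[of "map fst (concat ess)" d "map fst (edges \<omega> u)"] c w(5) by (simp add: edges_append)
    then have "P (Suc n) (u @ w)"
      using Pu w c plain_mult(1)[of "pos d (edges \<omega> u)" d "pos d (concat ess)"]
      by (auto simp: P_def tree_append edges_append)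
    moreover have "Q n u (u @ w)"
      unfolding Q_def using w k by blast
    ultimately show "\<exists>u'. P (Suc n) u' \<and> Q n u u'" by blast
  qed
  then obtain U where P: "\<And>n. P n (U n)" and Q: "\<And>n. Q n (U n) (U (Suc n))" by blast
  define m where "m n = length (U n)" for n
  \<comment> \<open>\<open>U N\<close> has depth at least \<open>N\<close>, so its prefix of length
    \<open>N\<close> exists and agrees with that of every later \<open>U n\<close>.\<close>
  define t where "t N = take N (U N)" for N
  have growth: "K n (U n) \<le> m (Suc n) - m n \<and> m n < m (Suc n)" for n
  proof -
    obtain w ess where w: "U (Suc n) = U n @ w" "edges (shift (U n) \<omega>) w = concat ess"
      "\<forall>es\<in>set ess. length es = fst (i n)" "K n (U n) \<le> length ess"
      using Q[of n] unfolding Q_def by blast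
    have "length w = length ess * fst (i n)"
      using length_concat_uniform[OF w(3)] w(2) by (metis length_edges)
    moreover have "length ess * 1 \<le> length ess * fst (i n)" using type[of n] by (intro mult_le_mono) auto
    moreover have "0 < K n (U n)" by (simp add: K_def)
    moreover have "m (Suc n) = m n + length w" using w(1) by (simp add: m_def)
    ultimately show ?thesis using w(4) by linarith
  qed
  then have m: "strict_mono m" by (simp add: strict_mono_Suc_iff)
  have K_le: "K n (U n) \<le> m (Suc n)" for n using growth[of n] by linarith
  have le_m: "N \<le> m N" for N by (rule strict_mono_imp_increasing[OF m])
  have prefix: "\<exists>w. U b = U a @ w" if "a \<le> b" for a b
    using that
  proof (induction b rule: dec_induct)
    case (step b)
    obtain w where "U (Suc b) = U b @ w" using Q[of b] unfolding Q_def by blast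
    then show ?case using step.IH by auto
  qed simp
  have t_eq: "t N = take N (U n)" if "N \<le> m n" for N n
  proof (cases "n \<le> N")
    case True
    then show ?thesis using prefix[OF True] that by (auto simp: t_def m_def)
  next
    case False
    then show ?thesis using prefix[of N n] le_m[of N] by (auto simp: t_def m_def)
  qed
  have t_edges: "edges \<omega> (t N) = take N (edges \<omega> (U N))" for N
    by (simp add: t_def edges_take)
  show ?thesis
  proof (rule that[of t m])
    show "t \<in> boundary (tree \<omega>)"
      unfolding boundary_def
    proof (intro CollectI conjI allI)
      show "t 0 = []" by (simp add: t_def)
      fix N
      show "t N \<in> tree \<omega>" using P[of N] by (simp add: P_def t_def tree_take)
      have "t (Suc N) = t N @ [U (Suc N) ! N]"
        using le_m[of "Suc N"] t_eq[of N "Suc N"] t_eq[of "Suc N" "Suc N"]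
        by (simp add: m_def take_Suc_conv_app_nth)
      then show "\<exists>k. t (Suc N) = t N @ [k]" by blast
    qed
    show "list_all snd (edges \<omega> (t N))" for N
      using P[of N] unfolding t_edges by (auto simp: P_def list_all_iff dest: in_set_takeD)
    show "set (map fst (edges \<omega> (t N))) \<subseteq> steps d" for N
      using P[of N] unfolding t_edges take_map[symmetric] P_def
      by (intro order_trans[OF set_take_subset]) blast
    show "strict_mono m" by (rule m)
    show "Suc n * c \<le> m (Suc n)" for n
      using K_le[of n] by (simp add: K_def algebra_simps)
    fix n N assume N: "m (Suc n) \<le> N" "N \<le> m (Suc (Suc n))"
    obtain w ess where w: "U (Suc (Suc n)) = U (Suc n) @ w" "edges (shift (U (Suc n)) \<omega>) w = concat ess"
      "set ess \<subseteq> open_words d (snd (i (Suc n)))" "\<forall>es\<in>set ess. length es = fst (i (Suc n))"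
      using Q[of "Suc n"] unfolding Q_def by blast
    obtain w0 ess0 where w0: "U (Suc n) = U n @ w0" "edges (shift (U n) \<omega>) w0 = concat ess0"
      "set ess0 \<subseteq> open_words d (snd (i n))" "\<forall>es\<in>set ess0. length es = fst (i n)"
      using Q[of n] unfolding Q_def by blast
    define N' where "N' = N - m (Suc n)"
    have N': "N = m (Suc n) + N'" "N' \<le> length (concat ess)"
    proof -
      show "N = m (Suc n) + N'" using N by (simp add: N'_def)
      have "length (concat ess) = length w" using w(2) by (metis length_edges)
      then show "N' \<le> length (concat ess)" using N w(1) by (simp add: N'_def m_def)
    qed
    have "t N = U (Suc n) @ take N' w"
      using t_eq[OF N(2)] N' w(1) by (simp add: m_def)
    then have "edges \<omega> (t N) = edges \<omega> (U (Suc n)) @ take N' (concat ess)"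
      using w(2) by (simp add: edges_append edges_take)
    then have e1: "\<bar>real (length (pos d (edges \<omega> (t N)))) -
        (real (length (pos d (edges \<omega> (U (Suc n))))) + q (Suc n) * real N')\<bar> \<le> 2 * real (fst (i (Suc n)))"
      using block_interpolation[OF _ _ w(3,4) _ _ N'(2), of "edges \<omega> (U (Suc n))"] P[of "Suc n"] type[of "Suc n"]
      unfolding q_def by (simp only: P_def)
    have len0: "length (concat ess0) = m (Suc n) - m n"
      using w0(1,2) by (metis add_diff_cancel_left' length_append length_edges m_def)
    have "edges \<omega> (U (Suc n)) = edges \<omega> (U n) @ take (m (Suc n) - m n) (concat ess0)"
      using w0 len0 by (simp add: edges_append)
    then have e2: "\<bar>real (length (pos d (edges \<omega> (U (Suc n))))) -
        (real (length (pos d (edges \<omega> (U n)))) + q n * real (m (Suc n) - m n))\<bar> \<le> 2 * real (fst (i n))"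
      using block_interpolation[OF _ _ w0(3,4) _ _ eq_refl[OF len0[symmetric]], of "edges \<omega> (U n)"] P[of n] type[of n]
      unfolding q_def by (simp only: P_def)
    have q01: "0 \<le> q n" "q n \<le> 1" using type[of n] by (auto simp: q_def)
    have "length (pos d (edges \<omega> (U n))) \<le> m n"
      using lp_length_le[of "map fst (edges \<omega> (U n))" d] P[of n] by (simp add: P_def m_def)
    then have J: "0 \<le> real (length (pos d (edges \<omega> (U n))))" "real (length (pos d (edges \<omega> (U n)))) \<le> real (m n)"
      by simp_all
    have qm: "0 \<le> q n * real (m n)" "q n * real (m n) \<le> real (m n)"
      using q01 mult_right_mono[of "q n" 1 "real (m n)"] by simp_all
    have split: "q n * real (m (Suc n) - m n) = q n * real (m (Suc n)) - q n * real (m n)"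
      using growth[of n] by (simp add: of_nat_diff right_diff_distrib)
    have N'r: "real N' = real N - real (m (Suc n))" using N by (simp add: N'_def of_nat_diff)
    \<comment> \<open>The height at \<open>U n\<close> and \<open>q n * m n\<close> both lie between
      0 and \<open>m n\<close>, so extending the slope \<open>q n\<close> back to time 0 costs at
      most \<open>m n\<close>.\<close>
    have "\<bar>real (length (pos d (edges \<omega> (t N)))) - (q n * real (m (Suc n)) + q (Suc n) * (real N - real (m (Suc n))))\<bar>
        \<le> real (m n) + 2 * real (fst (i n)) + 2 * real (fst (i (Suc n)))"
      using e1 e2 J qm unfolding split N'r by linarith
    also have "\<dots> \<le> 2 * real N / real (Suc n)"
    proof -
      have "Suc n * (m n + fst (i n) + fst (i (Suc n))) \<le> K n (U n)"
        unfolding K_def m_def by (intro mult_le_mono) auto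
      also have "\<dots> \<le> N" using K_le[of n] N(1) by (rule order_trans)
      finally have "real (Suc n * (m n + fst (i n) + fst (i (Suc n)))) \<le> real N" by (simp only: of_nat_le_iff)
      then have "(real (m n) + real (fst (i n)) + real (fst (i (Suc n)))) * real (Suc n) \<le> real N"
        by (simp only: of_nat_mult of_nat_add mult.commute)
      then have "real (m n) + real (fst (i n)) + real (fst (i (Suc n))) \<le> real N / real (Suc n)"
        by (subst pos_le_divide_eq) simp_all
      moreover have "2 * real N / real (Suc n) = 2 * (real N / real (Suc n))" by simp
      ultimately show ?thesis by linarith
    qed
    finally show "\<bar>real (length (pos d (edges \<omega> (t N)))) - (q n * real (m (Suc n)) + q (Suc n) * (real N - real (m (Suc n))))\<bar>
      \<le> 2 * real N / real (Suc n)" .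
  qed
qed

section \<open>Rays through a prescribed vertex\<close>

lemma lp_length_append_left:
  assumes "set es \<subseteq> steps d" "set fs \<subseteq> steps d"
  shows "\<bar>real (length (lp d (es @ fs))) - real (length (lp d fs))\<bar> \<le> real (length es)"
proof -
  have "length (lp d es) \<le> length es" using assms by (simp add: lp_length_le)
  moreover have "length (lp d (es @ fs)) \<le> length (lp d es) + length (lp d fs)"
    using assms by (simp add: lp_append length_mult)
  moreover have "length (lp d fs) \<le> length (lp d es) + length (lp d (es @ fs))"
  proof -
    have "foldr cancel_cons (rev (map flip (lp d es))) (lp d (es @ fs)) = lp d fs"
      unfolding lp_append[OF assms(2)] by (rule foldr_inverse, rule lp_carrier[OF assms(2)])
    then show ?thesis using length_mult[of "rev (map flip (lp d es))" "lp d (es @ fs)"] by simp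
  qed
  ultimately show ?thesis by linarith
qed

lemma boundary_prepend:
  assumes v: "v \<in> tree x" and t: "t \<in> boundary (tree (shift v x))"
  shows "(\<lambda>N. take N (v @ t N)) \<in> boundary (tree x)"
    and "length v \<le> N \<Longrightarrow> take N (v @ t N) = v @ t (N - length v)"
proof -
  note bp = boundary_prefix[OF t]
  have T: "take N (v @ t N) = v @ t (N - length v)" if "length v \<le> N" for N
    using that bp(1)[of "N - length v" N] by simp
  then show "length v \<le> N \<Longrightarrow> take N (v @ t N) = v @ t (N - length v)" .
  show "(\<lambda>N. take N (v @ t N)) \<in> boundary (tree x)"
    unfolding boundary_def
  proof (intro CollectI conjI allI)
    fix N
    have "v @ t N \<in> tree x" using v t by (simp add: tree_append boundary_def)
    then show "take N (v @ t N) \<in> tree x" by (rule tree_take)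
    show "\<exists>k. take (Suc N) (v @ t (Suc N)) = take N (v @ t N) @ [k]"
    proof (cases "length v \<le> N")
      case True
      obtain k where "t (Suc (N - length v)) = t (N - length v) @ [k]"
        using t by (auto simp: boundary_def)
      then show ?thesis using T[of N] T[of "Suc N"] True by (simp add: Suc_diff_le)
    next
      case False
      then show ?thesis by (simp add: take_Suc_conv_app_nth)
    qed
  qed simp
qed

text \<open>The path to \<open>v\<close> need not be anchored, so its letters may cancel against the
  ray below. This changes each height by at most \<open>length v\<close>, which the parameter
  \<open>c\<close> of \<open>ray_construction\<close> makes negligible.\<close>

lemma survival_ray:
  fixes x :: "nat list \<Rightarrow> (fword \<times> bool) list" and \<T> :: "(nat \<times> nat) set"
  assumes v: "v \<in> tree x" "set (map fst (edges x v)) \<subseteq> steps d"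
    and surv: "i0 \<in> \<T>" "shift v x \<in> open_survival d i0"
    and trans: "\<And>u i i' k0. i \<in> \<T> \<Longrightarrow> i' \<in> \<T> \<Longrightarrow> shift u x \<in> open_survival d i \<Longrightarrow>
      \<exists>k\<ge>k0. shift u x \<in> (open_reach d i ^^ k) (open_survival d i')"
    and type: "\<And>i. i \<in> \<T> \<Longrightarrow> 0 < fst i \<and> snd i \<le> fst i"
    and "\<alpha> \<le> \<beta>"
    and dense: "\<And>\<gamma> \<epsilon>. \<gamma> \<in> {\<alpha>, \<beta>} \<Longrightarrow> 0 < \<epsilon> \<Longrightarrow> \<exists>i\<in>\<T>. \<bar>real (snd i) / real (fst i) - \<gamma>\<bar> < \<epsilon>"
  obtains T where "T \<in> boundary (tree x)" "T (length v) = v"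
    "\<And>N. list_all snd (drop (length v) (edges x (T N)))"
    "liminf (\<lambda>N. ereal (real (length (pos d (edges x (T N)))) / real N)) = ereal \<alpha>"
    "limsup (\<lambda>N. ereal (real (length (pos d (edges x (T N)))) / real N)) = ereal \<beta>"
proof -
  define \<gamma> where "\<gamma> n = (if even n then \<alpha> else \<beta>)" for n :: nat
  have "\<exists>i. i \<in> \<T> \<and> \<bar>real (snd i) / real (fst i) - \<gamma> n\<bar> < 1 / real (Suc n)" for n
  proof -
    have "\<gamma> n \<in> {\<alpha>, \<beta>}" "0 < 1 / real (Suc n)" by (simp_all add: \<gamma>_def)
    from dense[OF this] show ?thesis by blast
  qed
  then obtain s where s: "\<And>n. s n \<in> \<T>" "\<And>n. \<bar>real (snd (s n)) / real (fst (s n)) - \<gamma> n\<bar> < 1 / real (Suc n)"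
    by metis
  \<comment> \<open>Only the type \<open>i0\<close> is known to survive at \<open>v\<close>, so it
    has to serve as the first run.\<close>
  define i where "i = case_nat i0 s"
  have i: "i n \<in> \<T>" for n using s surv by (cases n) (auto simp: i_def)
  define q where "q n = real (snd (i n)) / real (fst (i n))" for n
  define \<omega> where "\<omega> = shift v x"
  have "\<omega> \<in> open_survival d (i 0)" using surv by (simp add: i_def \<omega>_def)
  moreover have "\<exists>k\<ge>k0. shift u \<omega> \<in> (open_reach d (i n) ^^ k) (open_survival d (i (Suc n)))"
    if "shift u \<omega> \<in> open_survival d (i n)" for u n k0
    using trans[OF i[of n] i[of "Suc n"], of "v @ u" k0] that by (simp only: \<omega>_def shift_shift)
  ultimately obtain t m where t: "t \<in> boundary (tree \<omega>)" "\<And>N. list_all snd (edges \<omega> (t N))"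
    "\<And>N. set (map fst (edges \<omega> (t N))) \<subseteq> steps d"
    and m: "strict_mono m" "\<And>n. Suc n * length v \<le> m (Suc n)"
    and core: "\<And>n N. m (Suc n) \<le> N \<Longrightarrow> N \<le> m (Suc (Suc n)) \<Longrightarrow>
      \<bar>real (length (pos d (edges \<omega> (t N)))) - (q n * real (m (Suc n)) + q (Suc n) * (real N - real (m (Suc n))))\<bar>
      \<le> 2 * real N / real (Suc n)"
    using ray_construction[where \<omega> = \<omega> and d = d and i = i and c = "length v"] type[OF i] unfolding q_def by blast
  define T where "T N = take N (v @ t N)" for N
  note bp = boundary_prepend[OF v(1), of t, folded \<omega>_def, OF t(1)]
  have T: "T N = v @ t (N - length v)" if "length v \<le> N" for N
    unfolding T_def by (rule bp(2)[OF that])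
  have t0: "t 0 = []" using t(1) by (simp add: boundary_def)
  define H where "H N = real (length (pos d (edges x (T N))))" for N
  \<comment> \<open>The stretch endpoints move by \<open>length v\<close>. The constant 4 is 2 from
    the ray below \<open>v\<close> and 2 from two shifts by at most \<open>length v\<close>, each at
    most \<open>N0 / Suc n\<close>.\<close>
  have lims: "\<bar>H N - (q n * real (m (Suc n) + length v) + q (Suc n) * (real N - real (m (Suc n) + length v)))\<bar> \<le> 4 * real N / real (Suc n)"
    if N: "m (Suc n) + length v \<le> N" "N \<le> m (Suc (Suc n)) + length v" for n N
  proof -
    define N0 where "N0 = N - length v"
    have N0: "m (Suc n) \<le> N0" "N0 \<le> m (Suc (Suc n))" "real N0 = real N - real (length v)"
      using N by (simp_all add: N0_def of_nat_diff)
    have "edges x (T N) = edges x v @ edges \<omega> (t N0)"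
      using T[of N] N by (simp add: N0_def edges_append \<omega>_def)
    then have 1: "\<bar>H N - real (length (pos d (edges \<omega> (t N0))))\<bar> \<le> real (length v)"
      using lp_length_append_left[OF v(2) t(3)[of N0]] by (simp add: H_def)
    have q01: "0 \<le> q n" "q n \<le> 1" using type[OF i[of n]] by (auto simp: q_def)
    then have 2: "0 \<le> q n * real (length v)" "q n * real (length v) \<le> real (length v)"
      using mult_right_mono[of "q n" 1 "real (length v)"] by simp_all
    have "Suc n * length v \<le> N0" using m(2)[of n] N0(1) by (rule order_trans)
    then have "real (Suc n * length v) \<le> real N0" by (simp only: of_nat_le_iff)
    then have "real (length v) * real (Suc n) \<le> real N0" by (simp only: of_nat_mult mult.commute)
    then have 3: "real (length v) \<le> real N0 / real (Suc n)"
      by (subst pos_le_divide_eq) simp_all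
    have eq: "q n * real (m (Suc n) + length v) + q (Suc n) * (real N - real (m (Suc n) + length v)) =
        q n * real (m (Suc n)) + q (Suc n) * (real N0 - real (m (Suc n))) + q n * real (length v)"
      by (simp add: N0(3) algebra_simps)
    have "\<bar>H N - (q n * real (m (Suc n) + length v) + q (Suc n) * (real N - real (m (Suc n) + length v)))\<bar>
        \<le> 2 * real N0 / real (Suc n) + 2 * real (length v)"
      using 1 2 core[OF N0(1,2)] unfolding eq by linarith
    also have "\<dots> \<le> 4 * (real N0 / real (Suc n))"
      using 3 by simp
    also have "\<dots> \<le> 4 * real N / real (Suc n)"
      using N0(3) by (simp add: divide_right_mono)
    finally show ?thesis .
  qed
  have m': "strict_mono (\<lambda>n. m n + length v)"
    by (rule strict_monoI) (simp add: strict_mono_less[OF m(1)])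
  have q: "\<bar>q (Suc n) - (if even n then \<alpha> else \<beta>)\<bar> \<le> 1 / real (Suc n)" for n
    using s(2)[of n] unfolding q_def i_def \<gamma>_def by simp
  note al = alternating_limits[OF m' lims q \<open>\<alpha> \<le> \<beta>\<close>, unfolded H_def]
  show ?thesis
  proof (rule that[of T])
    show "T \<in> boundary (tree x)" using bp(1) by (simp add: T_def[abs_def])
    show "T (length v) = v" using T[of "length v"] t0 by simp
    show "list_all snd (drop (length v) (edges x (T N)))" for N
    proof (cases "length v \<le> N")
      case True
      then show ?thesis using T[of N] t(2) by (simp add: edges_append \<omega>_def)
    qed (simp add: T_def)
  qed (insert al, simp_all)
qed

section \<open>Hausdorff dimension of sets of rays\<close>

lemma ray_dist_le:
  assumes "t \<in> boundary T" "t' \<in> boundary T" "t n = t' n"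
  shows "ray_dist t t' \<le> exp (- real n)"
  using assms boundary_meet[of t T t' n] by (simp add: ray_dist_def)

lemma ray_dist_ge:
  assumes "t \<in> boundary T" "t' \<in> boundary T" "t (Suc n) \<noteq> t' (Suc n)"
  shows "exp (- real n) \<le> ray_dist t t'"
proof -
  have "t \<noteq> t'" using assms(3) by auto
  then show ?thesis
    using boundary_meet[OF assms(1,2), of "Suc n"] assms(3) by (simp add: ray_dist_def)
qed

lemma ediam_boundary_le:
  assumes "U \<subseteq> boundary T" "\<And>t t'. t \<in> U \<Longrightarrow> t' \<in> U \<Longrightarrow> t n = t' n"
  shows "ediam (boundary_metric T) U \<le> ennreal (exp (- real n))"
  unfolding ediam_def boundary_metric_simps
  using assms by (intro SUP_least ennreal_leI ray_dist_le) auto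

lemma ediam_boundary_le_one:
  assumes "U \<subseteq> boundary T"
  shows "ediam (boundary_metric T) U \<le> 1"
proof -
  have root: "t 0 = []" if "t \<in> U" for t
    using subsetD[OF assms that] by (simp add: boundary_def)
  have "ediam (boundary_metric T) U \<le> ennreal (exp (- real 0))"
    by (rule ediam_boundary_le[OF assms]) (simp only: root)
  then show ?thesis by simp
qed

lemma diam_pow_boundary_le:
  assumes "U \<subseteq> boundary T" "\<And>t t'. t \<in> U \<Longrightarrow> t' \<in> U \<Longrightarrow> t n = t' n" "0 < s"
  shows "diam_pow (boundary_metric T) s U \<le> ennreal (exp (- (s * real n)))"
proof (cases "U = {}")
  case False
  have le: "ediam (boundary_metric T) U \<le> ennreal (exp (- real n))"
    by (rule ediam_boundary_le[OF assms(1)]) (rule assms(2))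
  have "enn2real (ediam (boundary_metric T) U) \<le> exp (- real n)"
    using enn2real_mono[OF le] by simp
  then have "enn2real (ediam (boundary_metric T) U) powr s \<le> exp (- real n) powr s"
    using assms(3) by (intro powr_mono2) auto
  then show ?thesis
    using False assms(3) by (simp add: diam_pow_def powr_def mult.commute ennreal_leI)
qed (simp add: diam_pow_def)

lemma diam_pow_boundary_ge:
  assumes "U \<subseteq> boundary T" "t \<in> U" "t' \<in> U" "t (Suc n) \<noteq> t' (Suc n)" "0 \<le> s"
  shows "ennreal (exp (- (s * real n))) \<le> diam_pow (boundary_metric T) s U"
proof (cases "s = 0")
  case True
  then show ?thesis using assms(2) by (auto simp: diam_pow_def)
next
  case False
  have "ennreal (exp (- real n)) \<le> ennreal (ray_dist t t')"
    using assms by (intro ennreal_leI ray_dist_ge) auto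
  also have "\<dots> \<le> ediam (boundary_metric T) U"
    unfolding ediam_def boundary_metric_simps by (rule SUP_upper2[OF assms(2)], rule SUP_upper2[OF assms(3)], rule order_refl)
  finally have le: "ennreal (exp (- real n)) \<le> ediam (boundary_metric T) U" .
  have "ediam (boundary_metric T) U < Orderings.top"
    by (rule le_less_trans[OF ediam_boundary_le_one[OF assms(1)]]) simp
  from enn2real_mono[OF le this] have "exp (- real n) \<le> enn2real (ediam (boundary_metric T) U)"
    by simp
  then have "exp (- real n) powr s \<le> enn2real (ediam (boundary_metric T) U) powr s"
    using assms(5) by (intro powr_mono2) auto
  then show ?thesis
    using False assms(2) by (auto simp: diam_pow_def powr_def mult.commute intro!: ennreal_leI)
qed

lemma hausdorff_dim_nonneg: "0 \<le> hausdorff_dim m E"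
  unfolding hausdorff_dim_def by (rule INF_greatest) auto

lemma hausdorff_dim_le: "0 \<le> s \<Longrightarrow> hausdorff_measure m s E = 0 \<Longrightarrow> hausdorff_dim m E \<le> ereal s"
  unfolding hausdorff_dim_def by (rule INF_lower) auto

lemma hausdorff_dim_ge:
  assumes "\<And>s. 0 \<le> s \<Longrightarrow> s \<le> k \<Longrightarrow> hausdorff_measure m s E \<noteq> 0"
  shows "ereal k \<le> hausdorff_dim m E"
  unfolding hausdorff_dim_def
proof (rule INF_greatest)
  fix s assume "s \<in> {s. 0 \<le> s \<and> hausdorff_measure m s E = 0}"
  then show "ereal k \<le> ereal s" using assms[of s] by (cases "s \<le> k") auto
qed

lemma hausdorff_content_mono: "E \<subseteq> F \<Longrightarrow> hausdorff_content m s \<delta> E \<le> hausdorff_content m s \<delta> F"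
  unfolding hausdorff_content_def by (rule Inf_superset_mono) blast

lemma hausdorff_measure_mono: "E \<subseteq> F \<Longrightarrow> hausdorff_measure m s E \<le> hausdorff_measure m s F"
  unfolding hausdorff_measure_def by (rule SUP_mono) (auto intro: hausdorff_content_mono)

lemma hausdorff_dim_mono:
  assumes "E \<subseteq> F"
  shows "hausdorff_dim m E \<le> hausdorff_dim m F"
  unfolding hausdorff_dim_def
proof (rule INF_superset_mono)
  show "{s. 0 \<le> s \<and> hausdorff_measure m s F = 0} \<subseteq> {s. 0 \<le> s \<and> hausdorff_measure m s E = 0}"
  proof (intro subsetI CollectI conjI)
    fix s assume s: "s \<in> {s. 0 \<le> s \<and> hausdorff_measure m s F = 0}"
    then show "0 \<le> s" by simp
    have "hausdorff_measure m s E \<le> 0"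
      using hausdorff_measure_mono[OF assms, of m s] s by simp
    then show "hausdorff_measure m s E = 0" by simp
  qed
qed simp

text \<open>The cylinders of the vertices of \<open>S\<close> beyond level \<open>n0\<close> cover
  \<open>E\<close>, have diameter at most \<open>exp (- n0)\<close>, and their \<open>s\<close>-sums
  are tails of a convergent series.\<close>

lemma hausdorff_measure_zero:
  fixes S :: "nat list set"
  assumes s: "0 < s" and E: "E \<subseteq> boundary T" "\<And>t. t \<in> E \<Longrightarrow> \<exists>\<^sub>\<infinity>n. t n \<in> S"
    and fin: "\<And>n. finite {u \<in> S. length u = n}"
    and sum: "(\<Sum>n. ennreal (exp (- (s * real n))) * of_nat (card {u \<in> S. length u = n})) < \<infinity>"
  shows "hausdorff_measure (boundary_metric T) s E = 0"
proof -
  define a where "a n = exp (- (s * real n)) * real (card {u \<in> S. length u = n})" for n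
  have a_eq: "ennreal (exp (- (s * real n))) * of_nat (card {u \<in> S. length u = n}) = ennreal (a n)" for n
    by (simp add: a_def ennreal_mult ennreal_of_nat_eq_real_of_nat)
  have "summable a"
    using sum unfolding a_eq by (intro summable_suminf_not_top) (auto simp: a_def)
  have content: "hausdorff_content (boundary_metric T) s \<delta> E \<le> ennreal \<epsilon>" if "0 < \<delta>" "0 < \<epsilon>" for \<delta> \<epsilon>
  proof -
    obtain n1 where n1: "exp (- real n) \<le> \<delta>" if "n1 \<le> n" for n
    proof -
      have "(\<lambda>n. exp (- real n)) \<longlonglongrightarrow> 0"
        using LIMSEQ_realpow_zero[of "exp (-1)"] by (simp add: exp_of_nat_mult[symmetric])
      then have "\<forall>\<^sub>F n in sequentially. exp (- real n) < \<delta>"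
        using \<open>0 < \<delta>\<close> by (rule order_tendstoD)
      then show ?thesis using that unfolding eventually_sequentially by (meson less_imp_le)
    qed
    obtain n2 where n2: "\<And>n. n2 \<le> n \<Longrightarrow> norm (\<Sum>i. a (i + n)) < \<epsilon>"
      using suminf_exist_split[OF \<open>0 < \<epsilon>\<close> \<open>summable a\<close>] by blast
    define n0 where "n0 = max n1 n2"
    \<comment> \<open>Covers are sequences, so cylinders are indexed through \<open>to_nat\<close>;
      an index without an admissible vertex gets the empty set, to which \<open>diam_pow\<close>
      assigns 0.\<close>
    define U where "U i = {t \<in> boundary T. \<exists>u\<in>S. n0 \<le> length u \<and> to_nat u = i \<and> t (length u) = u}" for i
    have U: "U (to_nat u) = (if u \<in> S \<and> n0 \<le> length u then {t \<in> boundary T. t (length u) = u} else {})" for u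
      by (auto simp: U_def)
    have U_other: "U i = {}" if "i \<notin> range (to_nat :: nat list \<Rightarrow> nat)" for i
      using that by (auto simp: U_def)
    have diam: "ediam (boundary_metric T) (U i) \<le> ennreal \<delta>" for i
    proof (cases "i \<in> range (to_nat :: nat list \<Rightarrow> nat)")
      case True
      then obtain u :: "nat list" where i: "i = to_nat u" by auto
      show ?thesis
      proof (cases "u \<in> S \<and> n0 \<le> length u")
        case True
        then have "ediam (boundary_metric T) (U i) \<le> ennreal (exp (- real (length u)))"
          unfolding i by (intro ediam_boundary_le) (auto simp: U)
        also have "\<dots> \<le> ennreal \<delta>" using n1 True by (intro ennreal_leI) (auto simp: n0_def)
        finally show ?thesis .
      next
        case False
        then show ?thesis unfolding i U if_not_P[OF False] by (simp add: ediam_def)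
      qed
    qed (simp add: U_other ediam_def)
    have cover: "E \<subseteq> (\<Union>i. U i)"
    proof
      fix t assume t: "t \<in> E"
      then obtain n where n: "n0 \<le> n" "t n \<in> S" using E(2)[OF t] by (auto simp: INFM_nat_le)
      have "length (t n) = n" using t E(1) boundary_prefix(2)[of t T n n] by blast
      then have "t \<in> U (to_nat (t n))" using n t E(1) by (auto simp: U)
      then show "t \<in> (\<Union>i. U i)" by blast
    qed
    have "hausdorff_content (boundary_metric T) s \<delta> E \<le> (\<Sum>i. diam_pow (boundary_metric T) s (U i))"
      unfolding hausdorff_content_def using diam cover
      by (intro Inf_lower CollectI exI[of _ U] conjI refl) (auto simp: U_def)
    also have "\<dots> = (\<integral>\<^sup>+i. diam_pow (boundary_metric T) s (U i) \<partial>count_space UNIV)"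
      by (rule nn_integral_count_space_nat[symmetric])
    also have "\<dots> = (\<integral>\<^sup>+i. diam_pow (boundary_metric T) s (U i) \<partial>count_space (range (to_nat :: nat list \<Rightarrow> nat)))"
      by (rule nn_integral_count_space_eq) (auto simp: U_other diam_pow_def)
    also have "\<dots> = (\<integral>\<^sup>+u. diam_pow (boundary_metric T) s (U (to_nat u)) \<partial>count_space (UNIV :: nat list set))"
      by (rule nn_integral_bij_count_space[symmetric]) (simp add: bij_betw_def)
    also have "\<dots> \<le> (\<integral>\<^sup>+u. (\<Sum>n. ennreal (exp (- (s * real (n + n0)))) * indicator {u \<in> S. length u = n + n0} u) \<partial>count_space UNIV)"
    proof (rule nn_integral_mono)
      fix u :: "nat list"
      show "diam_pow (boundary_metric T) s (U (to_nat u)) \<le>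
          (\<Sum>n. ennreal (exp (- (s * real (n + n0)))) * indicator {u \<in> S. length u = n + n0} u)"
      proof (cases "u \<in> S \<and> n0 \<le> length u")
        case True
        have "diam_pow (boundary_metric T) s (U (to_nat u)) \<le> ennreal (exp (- (s * real (length u))))"
          using s by (intro diam_pow_boundary_le) (auto simp: U split: if_splits)
        also have "\<dots> = (\<Sum>n\<in>{length u - n0}. ennreal (exp (- (s * real (n + n0)))) * indicator {u \<in> S. length u = n + n0} u)"
          using True by simp
        also have "\<dots> \<le> (\<Sum>n. ennreal (exp (- (s * real (n + n0)))) * indicator {u \<in> S. length u = n + n0} u)"
          by (rule sum_le_suminf) auto
        finally show ?thesis .
      next
        case False
        then show ?thesis unfolding U if_not_P[OF False] by (simp add: diam_pow_def)
      qed
    qed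
    also have "\<dots> = (\<Sum>n. \<integral>\<^sup>+u. ennreal (exp (- (s * real (n + n0)))) * indicator {u \<in> S. length u = n + n0} u \<partial>count_space UNIV)"
      by (rule nn_integral_suminf) simp
    also have "\<dots> = (\<Sum>n. ennreal (a (n + n0)))"
    proof (rule suminf_cong)
      fix n
      show "(\<integral>\<^sup>+u. ennreal (exp (- (s * real (n + n0)))) * indicator {u \<in> S. length u = n + n0} u \<partial>count_space UNIV) = ennreal (a (n + n0))"
        using fin[of "n + n0"] by (simp add: nn_integral_cmult_indicator emeasure_count_space_finite a_eq del: of_nat_add)
    qed
    also have "\<dots> = ennreal (\<Sum>n. a (n + n0))"
    proof (rule suminf_ennreal2)
      show "summable (\<lambda>n. a (n + n0))" using \<open>summable a\<close> by (subst summable_iff_shift)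
    qed (simp add: a_def)
    also have "\<dots> \<le> ennreal \<epsilon>"
      using n2[of n0] by (intro ennreal_leI) (auto simp: n0_def)
    finally show ?thesis .
  qed
  have "hausdorff_content (boundary_metric T) s \<delta> E = 0" if "0 < \<delta>" for \<delta>
  proof -
    have "hausdorff_content (boundary_metric T) s \<delta> E \<le> 0"
    proof (rule ennreal_le_epsilon)
      fix \<epsilon> :: real assume "0 < \<epsilon>"
      from content[OF that this] show "hausdorff_content (boundary_metric T) s \<delta> E \<le> 0 + ennreal \<epsilon>"
        by (simp only: add_0)
    qed
    then show ?thesis by simp
  qed
  then have "(SUP \<delta>\<in>{0<..}. hausdorff_content (boundary_metric T) s \<delta> E) = (SUP \<delta>\<in>{0::real<..}. 0)"
    by (intro SUP_cong) auto
  then show ?thesis by (simp add: hausdorff_measure_def)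
qed

text \<open>A random subtree that reaches level \<open>n\<close> along a given ray with probability \<open>exp (- k n)\<close> hits a
  set of diameter \<open>r\<close> with probability at most \<open>r powr k\<close>. So a set that is hit with positive
  probability has dimension at least \<open>k\<close>.\<close>

lemma hausdorff_measure_pos:
  fixes B :: "'b measure" and op :: "nat list \<Rightarrow> 'b set" and v :: "nat list"
  assumes "prob_space B" and op: "\<And>u. op u \<in> sets B"
    and prob_op: "\<And>u. length v \<le> length u \<Longrightarrow> measure B (op u) \<le> exp (- (k * (real (length u) - real (length v))))"
    and good: "good \<in> sets B" "0 < measure B good"
    and E: "E \<subseteq> boundary T"
    and hit: "\<And>b. b \<in> good \<Longrightarrow> \<exists>t\<in>E. t (length v) = v \<and> (\<forall>n\<ge>length v. b \<in> op (t n))"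
    and s: "0 \<le> s" "s \<le> k"
  shows "hausdorff_measure (boundary_metric T) s E \<noteq> 0"
proof -
  interpret prob_space B by fact
  let ?m = "boundary_metric T"
  let ?c = "exp (k * real (length v))"
  \<comment> \<open>The points \<open>b\<close> for which some ray of \<open>U\<close> through
    \<open>v\<close> is open need not form a measurable set; \<open>bound\<close> encloses them in
    one.\<close>
  let ?H = "\<lambda>U. {b. \<exists>t\<in>U. t (length v) = v \<and> (\<forall>n\<ge>length v. b \<in> op (t n))}"
  have len: "length (t n) = n" if "t \<in> boundary T" for t n
    by (rule boundary_prefix(2)[OF that order_refl])
  have bound: "\<exists>S\<in>sets B. ?H U \<inter> space B \<subseteq> S \<and> emeasure B S \<le> ennreal ?c * diam_pow ?m s U"
    if U: "U \<subseteq> boundary T" for U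
  proof (cases "\<exists>t\<in>U. t (length v) = v")
    case False
    then show ?thesis by (intro bexI[of _ "{}"]) auto
  next
    case True
    then obtain t0 where t0: "t0 \<in> U" "t0 (length v) = v" by blast
    have c1: "1 \<le> ?c" using s by simp
    show ?thesis
    proof (cases "U = {t0}")
      \<comment> \<open>A single ray has diameter 0. For \<open>s > 0\<close> it must be open with
        probability 0, which holds since \<open>k > 0\<close>; for \<open>s = 0\<close> the
        convention in \<open>diam_pow\<close> gives 1.\<close>
      case True
      show ?thesis
      proof (cases "s = 0")
        case s0: True
        have "emeasure B (space B) \<le> ennreal ?c * diam_pow ?m s U"
          using c1 emeasure_space_1 True s0 by (simp add: diam_pow_def)
        then show ?thesis by (intro bexI[of _ "space B"]) auto
      next
        case False
        then have "0 < k" using s by linarith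
        let ?S = "\<Inter>n\<in>{length v..}. op (t0 n)"
        have S: "?S \<in> sets B" using op by (intro sets.countable_INT') auto
        have le: "measure B ?S \<le> exp (- (k * (real n - real (length v))))" if "length v \<le> n" for n
        proof -
          have "measure B ?S \<le> measure B (op (t0 n))"
            using that op by (intro finite_measure_mono) auto
          also have "\<dots> \<le> exp (- (k * (real n - real (length v))))"
            using prob_op[of "t0 n"] len[of t0 n] t0 U that by auto
          finally show ?thesis .
        qed
        have "(\<lambda>n. ?c * exp (- k) ^ n) \<longlonglongrightarrow> ?c * 0"
          using \<open>0 < k\<close> by (intro tendsto_mult tendsto_const LIMSEQ_realpow_zero) auto
        moreover have "exp (- (k * (real n - real (length v)))) = ?c * exp (- k) ^ n" for n
          by (simp add: exp_of_nat_mult[symmetric] exp_add[symmetric] algebra_simps)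
        ultimately have "(\<lambda>n. exp (- (k * (real n - real (length v))))) \<longlonglongrightarrow> 0" by simp
        then have "measure B ?S \<le> 0"
          by (rule LIMSEQ_le_const) (use le in blast)
        then have "emeasure B ?S = 0" by (simp add: emeasure_eq_measure measure_le_0_iff)
        then show ?thesis using S True by (intro bexI[of _ ?S]) auto
      qed
    next
      case False
      then obtain t1 where t1: "t1 \<in> U" "t1 \<noteq> t0" using t0 by blast
      then obtain N where "t1 N \<noteq> t0 N" by auto
      \<comment> \<open>\<open>M\<close> is the first level at which \<open>U\<close> splits. With
        \<open>M = Suc n\<close>, all rays of \<open>U\<close> pass through \<open>t0 n\<close>,
        while the diameter is at least \<open>exp (- n)\<close>.\<close>
      define M where "M = (LEAST N. \<exists>t\<in>U. t N \<noteq> t0 N)"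
      have "\<exists>t\<in>U. t N \<noteq> t0 N" using t1 \<open>t1 N \<noteq> t0 N\<close> by blast
      then have "\<exists>t\<in>U. t M \<noteq> t0 M" unfolding M_def by (rule LeastI)
      then obtain t2 where t2: "t2 \<in> U" "t2 M \<noteq> t0 M" by blast
      have root: "t 0 = []" if "t \<in> U" for t using subsetD[OF U that] by (simp add: boundary_def)
      have "M \<noteq> 0" using t2(2) root[OF t2(1)] root[OF t0(1)] by (intro notI) simp
      then obtain n where n: "M = Suc n" by (cases M) auto
      have agree: "t n = t0 n" if "t \<in> U" for t
        using not_less_Least[of n "\<lambda>N. \<exists>t\<in>U. t N \<noteq> t0 N"] that n by (auto simp: M_def)
      have "ennreal (exp (- (s * real n))) \<le> diam_pow ?m s U"
        using t2 n by (intro diam_pow_boundary_ge[OF U t0(1) t2(1) _ s(1)]) auto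
      then have lower: "ennreal ?c * ennreal (exp (- (s * real n))) \<le> ennreal ?c * diam_pow ?m s U"
        by (rule mult_left_mono) simp
      have exp_le: "exp (- (k * (real n - real (length v)))) \<le> ?c * exp (- (s * real n))"
        using s by (simp add: exp_add[symmetric] algebra_simps mult_right_mono)
      show ?thesis
      proof (cases "length v \<le> n")
        case True
        have "measure B (op (t0 n)) \<le> exp (- (k * (real n - real (length v))))"
          using prob_op[of "t0 n"] len[of t0 n] t0 U True by auto
        also note exp_le
        finally have "emeasure B (op (t0 n)) \<le> ennreal (?c * exp (- (s * real n)))"
          by (simp add: emeasure_eq_measure ennreal_leI)
        also have "\<dots> \<le> ennreal ?c * diam_pow ?m s U"
          using lower by (simp add: ennreal_mult)
        finally have "emeasure B (op (t0 n)) \<le> ennreal ?c * diam_pow ?m s U" .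
        moreover have "?H U \<inter> space B \<subseteq> op (t0 n)" using agree True by force
        ultimately show ?thesis using op by blast
      next
        case False
        \<comment> \<open>If the rays part above \<open>v\<close>, the bound is at least 1 and the
          whole space will do.\<close>
        have "k * real n \<le> k * real (length v)" using False s by (intro mult_left_mono) auto
        then have "1 \<le> exp (- (k * (real n - real (length v))))" by (simp add: algebra_simps)
        also note exp_le
        finally have "emeasure B (space B) \<le> ennreal (?c * exp (- (s * real n)))"
          unfolding emeasure_space_1 ennreal_1[symmetric] by (rule ennreal_leI)
        also have "\<dots> \<le> ennreal ?c * diam_pow ?m s U"
          using lower by (simp add: ennreal_mult)
        finally show ?thesis by (intro bexI[of _ "space B"]) auto
      qed
    qed
  qed
  have "ennreal (exp (- (k * real (length v))) * measure B good) \<le> hausdorff_content ?m s 1 E"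
    unfolding hausdorff_content_def
  proof (rule Inf_greatest)
    fix x
    assume "x \<in> {\<Sum>i. diam_pow ?m s (U i) |U :: nat \<Rightarrow> _. (\<forall>i. U i \<subseteq> mspace ?m \<and> ediam ?m (U i) \<le> ennreal 1) \<and> E \<subseteq> (\<Union>i. U i)}"
    then obtain U :: "nat \<Rightarrow> _" where x: "x = (\<Sum>i. diam_pow ?m s (U i))" and U: "\<And>i. U i \<subseteq> boundary T" "E \<subseteq> (\<Union>i. U i)"
      by auto
    have "\<exists>S. \<forall>i. S i \<in> sets B \<and> ?H (U i) \<inter> space B \<subseteq> S i \<and> emeasure B (S i) \<le> ennreal ?c * diam_pow ?m s (U i)"
      using bound[OF U(1)] by (intro choice) blast
    then obtain S where S: "\<And>i. S i \<in> sets B" "\<And>i. ?H (U i) \<inter> space B \<subseteq> S i"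
      "\<And>i. emeasure B (S i) \<le> ennreal ?c * diam_pow ?m s (U i)" by blast
    have "good \<subseteq> (\<Union>i. S i)"
    proof
      fix b assume b: "b \<in> good"
      then have "b \<in> space B" using good(1) sets.sets_into_space by blast
      moreover obtain t where t: "t \<in> E" "t (length v) = v" "\<forall>n\<ge>length v. b \<in> op (t n)" using hit[OF b] by blast
      moreover obtain i where "t \<in> U i" using t U(2) by blast
      ultimately have "b \<in> ?H (U i) \<inter> space B" by blast
      then show "b \<in> (\<Union>i. S i)" using S(2) by blast
    qed
    then have "emeasure B good \<le> emeasure B (\<Union>i. S i)"
      using S(1) by (intro emeasure_mono) auto
    also have "\<dots> \<le> (\<Sum>i. emeasure B (S i))"
      using S(1) by (intro emeasure_subadditive_countably) auto
    also have "\<dots> \<le> (\<Sum>i. ennreal ?c * diam_pow ?m s (U i))"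
      using S(3) by (intro suminf_le) auto
    also have "\<dots> = ennreal ?c * x" unfolding x by simp
    finally have "ennreal (exp (- (k * real (length v)))) * emeasure B good \<le> ennreal (exp (- (k * real (length v)))) * (ennreal ?c * x)"
      by (rule mult_left_mono) simp
    also have "\<dots> = x"
      by (simp add: mult.assoc[symmetric] ennreal_mult[symmetric] exp_add[symmetric])
    finally show "ennreal (exp (- (k * real (length v))) * measure B good) \<le> x"
      by (simp add: emeasure_eq_measure ennreal_mult)
  qed
  also have "\<dots> \<le> hausdorff_measure ?m s E"
    unfolding hausdorff_measure_def by (rule SUP_upper) simp
  finally have "ennreal (exp (- (k * real (length v))) * measure B good) \<le> hausdorff_measure ?m s E" .
  moreover have "0 < ennreal (exp (- (k * real (length v))) * measure B good)"
    using good(2) by simp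
  ultimately show ?thesis by (metis leD)
qed

section \<open>Almost sure properties\<close>

lemma nn_integral_of_nat_sums:
  assumes "(\<lambda>k. real k * pmf p k) sums r"
  shows "(\<integral>\<^sup>+n. of_nat n \<partial>measure_pmf p) = ennreal r"
proof -
  have "(\<integral>\<^sup>+n. of_nat n \<partial>measure_pmf p) = (\<Sum>n. ennreal (pmf p n) * of_nat n)"
    by (simp add: nn_integral_measure_pmf nn_integral_count_space_nat)
  also have "\<dots> = (\<Sum>n. ennreal (real n * pmf p n))"
    by (intro suminf_cong) (simp add: ennreal_mult' ennreal_of_nat_eq_real_of_nat mult.commute)
  also have "\<dots> = ennreal r"
    by (rule suminf_ennreal_eq) (use assms in auto)
  finally show ?thesis .
qed

section \<open>Percolation on a fixed tree\<close>

abbreviation zipb :: "(nat list \<Rightarrow> fword list) \<Rightarrow> (nat list \<Rightarrow> bool) \<Rightarrow> nat list \<Rightarrow> (fword \<times> bool) list" where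
  "zipb l b \<equiv> attach length zip (l, b)"

lemma length_zipb: "length (zipb l b u) = length (l u)"
  by (simp add: attach_def)

lemma tree_zipb: "tree (zipb l b) = tree l"
  by (simp add: tree_def length_zipb)

lemma edges_zipb:
  assumes "w \<in> tree l"
  shows "edges (zipb l b) w = zip (edges l w) (map (\<lambda>k. b (take (Suc k) w)) [0..<length w])"
proof (rule nth_equalityI)
  fix k assume "k < length (edges (zipb l b) w)"
  then have k: "k < length w" by simp
  then have "w ! k < length (l (take k w))" using assms by (auto simp: tree_def)
  then show "edges (zipb l b) w ! k = zip (edges l w) (map (\<lambda>k. b (take (Suc k) w)) [0..<length w]) ! k"
    using k by (simp add: edges_def attach_def take_Suc_conv_app_nth)
qed simp

lemma map_fst_edges_zipb: "w \<in> tree l \<Longrightarrow> map fst (edges (zipb l b) w) = edges l w"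
  by (simp add: edges_zipb)

lemma shift_zipb: "shift v (zipb l b) = zipb (shift v l) (shift v b)"
  by (simp add: attach_def shift_def fun_eq_iff)

abbreviation bits :: "real \<Rightarrow> (nat list \<Rightarrow> bool) measure" where
  "bits k \<equiv> nonroot (bernoulli_pmf (exp (- k)))"

text \<open>Shifting reindexes independent bits injectively. The measure lives on functions of
  nonroot vertices, and \<open>zipb\<close> never reads the value at the root, so the restriction in
  \<open>?f\<close> is harmless.\<close>

lemma emeasure_bits_shift:
  assumes "{b \<in> space (bits k). zipb l b \<in> S} \<in> sets (bits k)"
  shows "emeasure (bits k) {b \<in> space (bits k). zipb l (shift v b) \<in> S} = emeasure (bits k) {b \<in> space (bits k). zipb l b \<in> S}"
    and "{b \<in> space (bits k). zipb l (shift v b) \<in> S} \<in> sets (bits k)"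
proof -
  let ?I = "{u :: nat list. u \<noteq> []}"
  let ?f = "\<lambda>b. \<lambda>u\<in>?I. b (v @ u)"
  have meas: "?f \<in> measurable (bits k) (bits k)"
    by (rule measurable_restrict) (rule measurable_component_singleton, simp)
  have distr: "distr (bits k) (bits k) ?f = bits k"
    by (rule distr_PiM_reindex) (auto simp: inj_on_def prob_space_measure_pmf)
  have "zipb l (?f b) = zipb l (shift v b)" for b
    by (simp add: attach_def shift_def fun_eq_iff)
  then have eq: "?f -` {b \<in> space (bits k). zipb l b \<in> S} \<inter> space (bits k) = {b \<in> space (bits k). zipb l (shift v b) \<in> S}"
    using measurable_space[OF meas] by auto
  show "{b \<in> space (bits k). zipb l (shift v b) \<in> S} \<in> sets (bits k)"
    using measurable_sets[OF meas assms] unfolding eq .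
  have "emeasure (distr (bits k) (bits k) ?f) {b \<in> space (bits k). zipb l b \<in> S} =
      emeasure (bits k) {b \<in> space (bits k). zipb l (shift v b) \<in> S}"
    unfolding eq[symmetric] by (rule emeasure_distr[OF meas assms])
  then show "emeasure (bits k) {b \<in> space (bits k). zipb l (shift v b) \<in> S} = emeasure (bits k) {b \<in> space (bits k). zipb l b \<in> S}"
    unfolding distr by (rule sym)
qed

section \<open>Almost sure events of the branching walk\<close>

locale branching_setup = free_walk +
  fixes p :: "nat pmf" and r :: real
  assumes no_death: "pmf p 0 = 0" and mean: "(\<lambda>k. real k * pmf p k) sums r" and r: "1 < r"
begin

abbreviation law :: "(nat list \<Rightarrow> fword list) measure" where
  "law \<equiv> vertices (label_law p \<mu>)"

abbreviation open_law :: "real \<Rightarrow> (nat list \<Rightarrow> (fword \<times> bool) list) measure" where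
  "open_law k \<equiv> vertices (label_law p (pair_pmf \<mu> (bernoulli_pmf (exp (- k)))))"

lemma mean_offspring: "(\<integral>\<^sup>+n. of_nat n \<partial>measure_pmf p) = ennreal r"
  using mean by (rule nn_integral_of_nat_sums)

lemma ln_r: "0 < ln r" "exp (ln r) = r"
  using r by simp_all

definition steps_ok :: "(nat list \<Rightarrow> fword list) \<Rightarrow> bool" where
  "steps_ok l \<longleftrightarrow> (\<forall>u. l u \<noteq> [] \<and> set (l u) \<subseteq> steps d)"

lemma AE_steps_ok: "AE l in law. steps_ok l"
proof -
  have "AE l in law. l u \<noteq> [] \<and> set (l u) \<subseteq> steps d" for u
  proof (rule AE_PiM_component[where P = "\<lambda>x. x \<noteq> [] \<and> set x \<subseteq> steps d"])
    show "AE x in measure_pmf (label_law p \<mu>). x \<noteq> [] \<and> set x \<subseteq> steps d"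
      unfolding AE_measure_pmf_iff
    proof
      fix x assume "x \<in> set_pmf (label_law p \<mu>)"
      then obtain n where n: "n \<in> set_pmf p" "x \<in> set_pmf (replicate_pmf n \<mu>)"
        by (auto simp: attach_pmf_def)
      have "n \<noteq> 0" using n(1) no_death by (cases "n = 0") (simp_all add: set_pmf_iff)
      then show "x \<noteq> [] \<and> set x \<subseteq> steps d" using n(2) set_replicate[of x n] by auto
    qed
  qed (simp_all add: prob_space_measure_pmf)
  then show ?thesis unfolding steps_ok_def AE_all_countable by blast
qed

definition speed_words :: "nat \<Rightarrow> real \<Rightarrow> real \<Rightarrow> fword list set" where
  "speed_words n a b = {es. real (length (lp d es)) / real n \<in> {a..b}}"

definition level_sum :: "real \<Rightarrow> real \<Rightarrow> real \<Rightarrow> (nat list \<Rightarrow> fword list) \<Rightarrow> ennreal" where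
  "level_sum a b s l = (\<Sum>n. ennreal (exp (- (s * real n))) * of_nat (card (blocks n (speed_words n a b) l)))"

text \<open>The many-to-one formula turns the expectation of \<open>level_sum\<close> into the
  series of the assumption, and a variable of finite mean is almost surely finite.\<close>

lemma AE_level_sum:
  assumes "(\<Sum>n. ennreal (exp (real n * (ln r - s)) * rate_prob n {a..b})) < \<infinity>"
  shows "AE l in law. level_sum a b s l < \<infinity>"
proof -
  interpret edge_labels "label_law p \<mu>" by unfold_locales
  have meas: "(\<lambda>l. ennreal (exp (- (s * real n))) * of_nat (card (blocks n (speed_words n a b) l))) \<in> borel_measurable law" for n
    by (rule measurable_compose[OF card_blocks_measurable,
          where g = "\<lambda>k. ennreal (exp (- (s * real n))) * of_nat k"]) simp
  have "(\<integral>\<^sup>+l. level_sum a b s l \<partial>law) =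
      (\<Sum>n. \<integral>\<^sup>+l. ennreal (exp (- (s * real n))) * of_nat (card (blocks n (speed_words n a b) l)) \<partial>law)"
    unfolding level_sum_def by (rule nn_integral_suminf) (rule meas)
  also have "\<dots> = (\<Sum>n. ennreal (exp (real n * (ln r - s)) * rate_prob n {a..b}))"
  proof (rule suminf_cong)
    fix n
    have "(\<integral>\<^sup>+l. ennreal (exp (- (s * real n))) * of_nat (card (blocks n (speed_words n a b) l)) \<partial>law) =
        ennreal (exp (- (s * real n))) * (\<integral>\<^sup>+l. of_nat (card (blocks n (speed_words n a b) l)) \<partial>law)"
      by (rule nn_integral_cmult) (rule measurable_compose[OF card_blocks_measurable], simp)
    also have "\<dots> = ennreal (exp (- (s * real n))) * (ennreal r ^ n * ennreal (rate_prob n {a..b}))"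
      unfolding mean_card_blocks mean_offspring rate_prob_def speed_words_def measure_pmf.emeasure_eq_measure ..
    also have "\<dots> = ennreal (exp (- (s * real n)) * (r ^ n * rate_prob n {a..b}))"
      using r by (simp add: ennreal_mult ennreal_power rate_prob_def)
    also have "exp (- (s * real n)) * (r ^ n * rate_prob n {a..b}) = exp (real n * (ln r - s)) * rate_prob n {a..b}"
    proof -
      have "r ^ n = exp (real n * ln r)" using r by (simp add: exp_of_nat_mult)
      then show ?thesis by (simp add: exp_add[symmetric] mult.assoc[symmetric] algebra_simps del: exp_ln)
    qed
    finally show "(\<integral>\<^sup>+l. ennreal (exp (- (s * real n))) * of_nat (card (blocks n (speed_words n a b) l)) \<partial>law) =
        ennreal (exp (real n * (ln r - s)) * rate_prob n {a..b})" .
  qed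
  finally have "(\<integral>\<^sup>+l. level_sum a b s l \<partial>law) \<noteq> \<infinity>" using assms by simp
  moreover have "level_sum a b s \<in> borel_measurable law"
    unfolding level_sum_def by (intro borel_measurable_suminf_order meas)
  ultimately have "AE l in law. level_sum a b s l \<noteq> \<infinity>" by (intro nn_integral_noteq_infinite)
  then show ?thesis by (auto simp: less_top elim: AE_mp)
qed

text \<open>An open block costs the factor \<open>exp (- k)\<close> per edge, so the mean number of
  open blocks is \<open>exp (l * (ln r - k)) * anchor_prob l j\<close>, which
  \<open>types (ln r - k)\<close> compares with 1.\<close>

lemma supercritical:
  assumes i: "i \<in> types (ln r - k)" and k: "0 \<le> k"
  shows "1 < (\<integral>\<^sup>+x. of_nat (card (blocks (fst i) (open_words d (snd i)) x)) \<partial>open_law k)"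
proof -
  let ?l = "fst i" and ?j = "snd i"
  let ?A = "{xs. set xs \<subseteq> steps d \<and> lp d xs \<in> anchored d ?j}"
  have A: "measure_pmf.prob (replicate_pmf ?l \<mu>) ?A = anchor_prob ?l ?j"
    unfolding anchor_prob_def
  proof (rule measure_pmf.finite_measure_eq_AE)
    show "AE x in replicate_pmf ?l \<mu>. x \<in> ?A \<longleftrightarrow> x \<in> {es. lp d es \<in> anchored d ?j}"
      unfolding AE_measure_pmf_iff using set_replicate[of _ ?l] by auto
  qed simp_all
  have "measure_pmf.prob (replicate_pmf ?l (pair_pmf \<mu> (bernoulli_pmf (exp (- k))))) (open_words d ?j) =
      exp (- k) ^ ?l * anchor_prob ?l ?j"
    unfolding open_words_def A[symmetric] by (rule prob_all_open) (use k in auto)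
  then have "(\<integral>\<^sup>+x. of_nat (card (blocks ?l (open_words d ?j) x)) \<partial>open_law k) =
      ennreal r ^ ?l * ennreal (exp (- k) ^ ?l * anchor_prob ?l ?j)"
    unfolding mean_card_blocks mean_offspring measure_pmf.emeasure_eq_measure by (simp only:)
  also have "\<dots> = ennreal (r ^ ?l * (exp (- k) ^ ?l * anchor_prob ?l ?j))"
    using r by (simp add: ennreal_mult ennreal_power anchor_prob_def)
  also have "r ^ ?l * (exp (- k) ^ ?l * anchor_prob ?l ?j) = exp (real ?l * (ln r - k)) * anchor_prob ?l ?j"
  proof -
    have "r ^ ?l = exp (real ?l * ln r)" using r by (simp add: exp_of_nat_mult)
    moreover have "exp (- k) ^ ?l = exp (real ?l * (- k))" by (rule exp_of_nat_mult[symmetric])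
    moreover have "real ?l * (ln r - k) = real ?l * ln r + real ?l * (- k)" by (simp add: algebra_simps)
    ultimately show ?thesis by (simp only: exp_add mult.assoc)
  qed
  finally have eq: "(\<integral>\<^sup>+x. of_nat (card (blocks ?l (open_words d ?j) x)) \<partial>open_law k) =
    ennreal (exp (real ?l * (ln r - k)) * anchor_prob ?l ?j)" .
  have "1 < exp (real ?l * (ln r - k)) * anchor_prob ?l ?j"
    using i by (auto simp: types_def)
  then show ?thesis unfolding eq by (simp flip: ennreal_1 add: ennreal_less_iff)
qed

text \<open>The assumption \<open>trans\<close> of \<open>survival_ray\<close>, for all vertices and
  all pairs of types at once; there are only countably many of them.\<close>

definition transitions :: "real \<Rightarrow> (nat list \<Rightarrow> (fword \<times> bool) list) \<Rightarrow> bool" where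
  "transitions k x \<longleftrightarrow> (\<forall>i\<in>types (ln r - k). \<forall>i'\<in>types (ln r - k). \<forall>u n0.
    shift u x \<in> open_survival d i \<longrightarrow> (\<exists>n\<ge>n0. shift u x \<in> (open_reach d i ^^ n) (open_survival d i')))"

lemma AE_transitions:
  assumes "0 \<le> k"
  shows "AE x in open_law k. transitions k x"
proof -
  interpret edge_labels "label_law p (pair_pmf \<mu> (bernoulli_pmf (exp (- k))))" by unfold_locales
  have "AE x in open_law k. shift u x \<in> open_survival d i \<longrightarrow>
      (\<exists>n\<ge>n0. shift u x \<in> (open_reach d i ^^ n) (open_survival d i'))"
    if i: "i \<in> types (ln r - k)" "i' \<in> types (ln r - k)" for i i' u n0
    by (rule AE_shift, rule survival_reaches[OF supercritical[OF i(1) assms] sets_survival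
        prob_survival_pos[OF supercritical[OF i(2) assms]]])
  then show ?thesis
    unfolding transitions_def AE_ball_countable[OF countableI_type] AE_all_countable by blast
qed

text \<open>A quenched property: the tree \<open>l\<close> is fixed and only the percolation bits
  are random.\<close>

definition open_pos :: "real \<Rightarrow> nat \<times> nat \<Rightarrow> (nat list \<Rightarrow> fword list) \<Rightarrow> bool" where
  "open_pos k i l \<longleftrightarrow> 0 < emeasure (bits k) {b \<in> space (bits k). zipb l b \<in> open_survival d i}"

lemma distr_zipb: "distr (law \<Otimes>\<^sub>M bits k) (open_law k) (attach length zip) = open_law k"
  using distr_attach[of "label_law p \<mu>" "bernoulli_pmf (exp (- k))" length zip]
  unfolding attach_zip_label_law .

lemma sets_zipb_survival:
  "{z \<in> space (law \<Otimes>\<^sub>M bits k). attach length zip z \<in> open_survival d i} \<in> sets (law \<Otimes>\<^sub>M bits k)"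
  "{b \<in> space (bits k). zipb l b \<in> open_survival d i} \<in> sets (bits k)"
proof -
  interpret edge_labels "label_law p (pair_pmf \<mu> (bernoulli_pmf (exp (- k))))" by unfold_locales
  have "attach length zip -` open_survival d i \<inter> space (law \<Otimes>\<^sub>M bits k) \<in> sets (law \<Otimes>\<^sub>M bits k)"
    by (rule measurable_sets[OF measurable_attach sets_survival])
  moreover have "attach length zip -` open_survival d i \<inter> space (law \<Otimes>\<^sub>M bits k) =
      {z \<in> space (law \<Otimes>\<^sub>M bits k). attach length zip z \<in> open_survival d i}" by blast
  ultimately show *: "{z \<in> space (law \<Otimes>\<^sub>M bits k). attach length zip z \<in> open_survival d i} \<in> sets (law \<Otimes>\<^sub>M bits k)"
    by (simp only:)
  have "Pair l -` {z \<in> space (law \<Otimes>\<^sub>M bits k). attach length zip z \<in> open_survival d i} =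
      {b \<in> space (bits k). zipb l b \<in> open_survival d i}"
    by (auto simp: space_pair_measure space_PiM)
  then show "{b \<in> space (bits k). zipb l b \<in> open_survival d i} \<in> sets (bits k)"
    using sets_Pair1[OF *, of l] by (simp only:)
qed

text \<open>By Fubini \<open>open_pos\<close> has positive probability, because open survival has it
  over tree and bits jointly. A tree without leaves always survives with respect to blocks of length
  1 and arbitrary labels, so \<open>survival_reaches\<close> finds a vertex whose subtree has the
  property.\<close>

lemma AE_open_pos:
  assumes k: "0 \<le> k" and i: "i \<in> types (ln r - k)"
  shows "AE l in law. \<exists>w\<in>tree l. open_pos k i (shift w l)"
proof -
  interpret O: edge_labels "label_law p (pair_pmf \<mu> (bernoulli_pmf (exp (- k))))" by unfold_locales
  interpret edge_labels "label_law p \<mu>" by unfold_locales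
  interpret B: prob_space "bits k" by (rule prob_space_nonroot)
  let ?Z = "{z \<in> space (law \<Otimes>\<^sub>M bits k). attach length zip z \<in> open_survival d i}"
  let ?f = "\<lambda>l. emeasure (bits k) (Pair l -` ?Z)"
  have Pair: "Pair l -` ?Z = {b \<in> space (bits k). zipb l b \<in> open_survival d i}" for l
    by (auto simp: space_pair_measure space_PiM)
  have f: "?f \<in> borel_measurable law"
    by (rule B.measurable_emeasure_Pair[OF sets_zipb_survival(1)])
  have G: "{l. open_pos k i l} \<in> sets law"
  proof -
    have "{l \<in> space law. 0 < ?f l} \<in> sets law"
      using f by (rule borel_measurable_less[OF borel_measurable_const])
    then show ?thesis unfolding Pair open_pos_def by simp
  qed
  have "0 < prob {l. open_pos k i l}"
  proof (rule ccontr)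
    assume "\<not> ?thesis"
    then have "{l. open_pos k i l} \<in> null_sets law"
      using G by (simp add: null_sets_def emeasure_eq_measure zero_less_measure_iff)
    then have "AE l in law. \<not> open_pos k i l"
      by (rule AE_I') auto
    then have "AE l in law. ?f l = 0"
      unfolding Pair open_pos_def by (simp add: not_less)
    then have "(\<integral>\<^sup>+l. ?f l \<partial>law) = 0"
      using f by (simp add: nn_integral_0_iff_AE)
    then have "emeasure (law \<Otimes>\<^sub>M bits k) ?Z = 0"
      by (simp add: B.emeasure_pair_measure_alt[OF sets_zipb_survival(1)])
    moreover have Z: "attach length zip -` open_survival d i \<inter> space (law \<Otimes>\<^sub>M bits k) = ?Z" by blast
    have "emeasure (distr (law \<Otimes>\<^sub>M bits k) (open_law k) (attach length zip)) (open_survival d i) =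
        emeasure (law \<Otimes>\<^sub>M bits k) ?Z"
      unfolding Z[symmetric] by (rule emeasure_distr[OF measurable_attach O.sets_survival])
    ultimately have "emeasure (open_law k) (open_survival d i) = 0"
      unfolding distr_zipb by simp
    then show False
      using O.prob_survival_pos[OF supercritical[OF i k]] by (simp add: O.emeasure_eq_measure)
  qed
  moreover have "1 < (\<integral>\<^sup>+l. of_nat (card (blocks 1 UNIV l)) \<partial>law)"
  proof -
    have "(\<integral>\<^sup>+l. of_nat (card (blocks 1 UNIV l)) \<partial>law) = ennreal r"
      unfolding mean_card_blocks mean_offspring by simp
    then show ?thesis using r ennreal_less_iff[of 1 r] by simp
  qed
  ultimately have reach: "AE l in law. l \<in> survival 1 UNIV \<longrightarrow> (\<exists>n\<ge>0. l \<in> (reach 1 UNIV ^^ n) {l. open_pos k i l})"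
    using G by (intro survival_reaches)
  have survives: "l \<in> survival 1 UNIV" if "steps_ok l" for l
  proof -
    have "shift u l \<in> (reach 1 UNIV ^^ n) UNIV" for u n
    proof (induction n arbitrary: u)
      case (Suc n)
      have "[0] \<in> blocks 1 UNIV (shift u l)"
        using that by (simp add: blocks_def tree_def shift_def steps_ok_def)
      moreover have "shift [0] (shift u l) \<in> (reach 1 UNIV ^^ n) UNIV"
        unfolding shift_shift by (rule Suc.IH)
      ultimately show ?case unfolding funpow.simps comp_def reach_def[of _ _ "(reach 1 UNIV ^^ n) UNIV"] by blast
    qed simp
    from this[of "[]"] show ?thesis by (simp add: survival_def)
  qed
  show ?thesis
    using reach AE_steps_ok
  proof eventually_elim
    case (elim l)
    then obtain n where "l \<in> (reach 1 UNIV ^^ n) {l. open_pos k i l}" using survives by blast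
    from reach_path[OF this] show ?case by blast
  qed
qed

text \<open>Everything that is later asked of the tree, with rational parameters and countably many
  types and vertices. Requiring \<open>open_pos\<close> somewhere below every vertex
  \<open>u\<close> is what yields density.\<close>

definition good :: "(nat list \<Rightarrow> fword list) \<Rightarrow> bool" where
  "good l \<longleftrightarrow> steps_ok l \<and>
    (\<forall>a\<in>\<rat>. \<forall>b\<in>\<rat>. \<forall>s\<in>\<rat>. (\<Sum>n. ennreal (exp (real n * (ln r - s)) * rate_prob n {a..b})) < \<infinity> \<longrightarrow>
      level_sum a b s l < \<infinity>) \<and>
    (\<forall>k\<in>\<rat>. 0 \<le> k \<longrightarrow> (AE b in bits k. transitions k (zipb l b)) \<and>
      (\<forall>i\<in>types (ln r - k). \<forall>u. \<exists>w\<in>tree (shift u l). open_pos k i (shift w (shift u l))))"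

lemma AE_good: "AE l in law. good l"
proof -
  interpret edge_labels "label_law p \<mu>" by unfold_locales
  have 1: "AE l in law. (\<Sum>n. ennreal (exp (real n * (ln r - s)) * rate_prob n {a..b})) < \<infinity> \<longrightarrow> level_sum a b s l < \<infinity>" for a b s
    using AE_level_sum[of s a b] by (cases "(\<Sum>n. ennreal (exp (real n * (ln r - s)) * rate_prob n {a..b})) < \<infinity>") auto
  have 2: "AE l in law. AE b in bits k. transitions k (zipb l b)" if "0 \<le> k" for k
  proof -
    interpret B: prob_space "bits k" by (rule prob_space_nonroot)
    interpret PP: pair_sigma_finite law "bits k" ..
    have "AE z in law \<Otimes>\<^sub>M bits k. transitions k (attach length zip z)"
      by (rule AE_distrD[OF measurable_attach], subst distr_zipb, rule AE_transitions[OF that])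
    then show ?thesis by (rule PP.AE_pair)
  qed
  have 3: "AE l in law. \<exists>w\<in>tree (shift u l). open_pos k i (shift w (shift u l))"
    if "0 \<le> k" "i \<in> types (ln r - k)" for k i u
    using AE_open_pos[OF that] by (rule AE_shift)
  have 23: "AE l in law. 0 \<le> k \<longrightarrow> (AE b in bits k. transitions k (zipb l b)) \<and>
      (\<forall>i\<in>types (ln r - k). \<forall>u. \<exists>w\<in>tree (shift u l). open_pos k i (shift w (shift u l)))" for k
  proof (cases "0 \<le> k")
    case True
    have "AE l in law. \<forall>i\<in>types (ln r - k). \<forall>u. \<exists>w\<in>tree (shift u l). open_pos k i (shift w (shift u l))"
      using 3[OF True] by (simp only: AE_ball_countable[OF countableI_type] AE_all_countable) blast
    with 2[OF True] show ?thesis by eventually_elim blast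
  qed simp
  show ?thesis
    unfolding good_def
    by (intro AE_conjI AE_steps_ok) (simp_all only: AE_ball_countable[OF countable_rat] 1 23 ball_triv, auto)
qed

end

section \<open>The multifractal spectrum\<close>

lemma position_edges:
  assumes "u \<in> tree (labels z)"
  shows "position d (snd z) u = lp d (edges (labels z) u)"
  unfolding position_def edges_labels[OF assms] One_nat_def map_Suc_upt[symmetric] map_map comp_def ..

text \<open>The word length changes by at most 1 per step, so \<open>f n / n\<close> cannot jump over an interval.\<close>

lemma visits_interval:
  fixes f :: "nat \<Rightarrow> real"
  assumes step: "\<And>n. \<bar>f (Suc n) - f n\<bar> \<le> 1" and range: "\<And>n. 0 \<le> f n" "\<And>n. f n \<le> real n"
    and lim: "liminf (\<lambda>n. ereal (f n / real n)) = ereal \<alpha>" "limsup (\<lambda>n. ereal (f n / real n)) = ereal \<beta>"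
    and q: "\<alpha> \<le> q" "q \<le> \<beta>" and ab: "a < q" "q < b"
  shows "\<exists>\<^sub>\<infinity>n. f n / real n \<in> {a..b}"
proof (rule ccontr)
  assume "\<not> ?thesis"
  then have "\<forall>\<^sub>\<infinity>n. f n / real n \<notin> {a..b}" by (simp add: INFM_iff_infinite MOST_iff_cofinite)
  then obtain n1 where n1: "\<And>n. n1 \<le> n \<Longrightarrow> f n / real n \<notin> {a..b}"
    unfolding MOST_nat_le by blast
  have "(\<lambda>n. 2 / real n) \<longlonglongrightarrow> 0" by (rule lim_const_over_n)
  then have "\<forall>\<^sub>F n in sequentially. 2 / real n < b - a"
    by (rule order_tendstoD) (use ab in simp)
  then obtain n2 where n2: "\<And>n. n2 \<le> n \<Longrightarrow> 2 / real n < b - a"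
    unfolding eventually_sequentially by blast
  define m where "m = max (max n1 n2) 1"
  \<comment> \<open>One step changes the speed by at most \<open>2 / n\<close>, eventually less than
    the length of the interval, so a speed that avoids the interval stays on one side of it.\<close>
  have small: "\<bar>f (Suc n) / real (Suc n) - f n / real n\<bar> < b - a" if "m \<le> n" for n
  proof -
    have n: "0 < real n" "n2 \<le> n" using that by (auto simp: m_def)
    have "f (Suc n) / real (Suc n) - f n / real n = (f (Suc n) - f n) / real (Suc n) - f n / real n * (1 / real (Suc n))"
    proof -
      have "f n / real n - f n / real n * (1 / real (Suc n)) = f n / real (Suc n)"
        using n(1) by (simp add: divide_simps) (simp add: algebra_simps)
      then show ?thesis by (simp add: diff_divide_distrib)
    qed
    moreover have "\<bar>(f (Suc n) - f n) / real (Suc n)\<bar> \<le> 1 / real (Suc n)"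
      unfolding abs_divide abs_of_nat using step[of n] by (intro divide_right_mono) auto
    moreover have "0 \<le> f n / real n * (1 / real (Suc n))" "f n / real n * (1 / real (Suc n)) \<le> 1 * (1 / real (Suc n))"
      using range[of n] n by (auto intro!: mult_right_mono simp: divide_le_eq)
    moreover have "1 / real (Suc n) + 1 / real (Suc n) \<le> 2 / real n"
      using n(1) by (simp add: frac_le)
    ultimately show ?thesis using n2[OF n(2)] by linarith
  qed
  have avoid: "f n / real n < a \<or> b < f n / real n" if "m \<le> n" for n
    using n1[of n] that by (auto simp: m_def not_le)
  consider "f m / real m < a" | "b < f m / real m" using avoid[of m] by auto
  then show False
  proof cases
    case 1
    have "f n / real n < a" if "m \<le> n" for n
      using that
    proof (induction n rule: dec_induct)
      case (step n)
      then show ?case using small[of n] avoid[of "Suc n"] by linarith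
    qed (rule 1)
    then have "\<forall>\<^sub>F n in sequentially. ereal (f n / real n) \<le> ereal a"
      unfolding eventually_sequentially by (intro exI[of _ m]) (auto intro: less_imp_le)
    then have "limsup (\<lambda>n. ereal (f n / real n)) \<le> ereal a" by (rule Limsup_bounded)
    then show False using lim q ab by simp
  next
    case 2
    have "b < f n / real n" if "m \<le> n" for n
      using that
    proof (induction n rule: dec_induct)
      case (step n)
      then show ?case using small[of n] avoid[of "Suc n"] by linarith
    qed (rule 2)
    then have "\<forall>\<^sub>F n in sequentially. ereal b \<le> ereal (f n / real n)"
      unfolding eventually_sequentially by (intro exI[of _ m]) (auto intro: less_imp_le)
    then have "ereal b \<le> liminf (\<lambda>n. ereal (f n / real n))" by (rule Liminf_bounded)
    then show False using lim q ab by simp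
  qed
qed

text \<open>The bit of an edge sits at its lower end, so the edges on the path to \<open>u\<close>
  below level \<open>m\<close> are the prefixes of lengths \<open>Suc m\<close> to \<open>n\<close>,
  that is \<open>n - m\<close> distinct coordinates.\<close>

lemma prob_bits_open:
  assumes t: "length u = n" and k: "0 \<le> k" "m \<le> n"
  defines "S \<equiv> {b \<in> space (bits k). \<forall>j. m \<le> j \<and> j < n \<longrightarrow> b (take (Suc j) u)}"
  shows "S \<in> sets (bits k)" "measure (bits k) S = exp (- (k * (real n - real m)))"
proof -
  interpret product_prob_space "\<lambda>_. measure_pmf (bernoulli_pmf (exp (- k)))" "{u :: nat list. u \<noteq> []}" by unfold_locales
  define J where "J = (\<lambda>j. take (Suc j) u) ` {m..<n}"
  have inj: "inj_on (\<lambda>j. take (Suc j) u) {m..<n}"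
  proof (rule inj_onI)
    fix i j assume ij: "i \<in> {m..<n}" "j \<in> {m..<n}" "take (Suc i) u = take (Suc j) u"
    have "length (take (Suc i) u) = length (take (Suc j) u)" using ij(3) by simp
    then show "i = j" using ij(1,2) t by simp
  qed
  have J: "J \<subseteq> {u. u \<noteq> []}" "finite J" "card J = n - m"
    using inj t by (auto simp: J_def card_image)
  have S: "S = {b \<in> space (bits k). \<forall>j\<in>J. b j \<in> {True}}"
    by (auto simp: S_def J_def)
  show "S \<in> sets (bits k)"
    unfolding S by (rule sets_Collect_single' sets.sets_Collect_finite_All)+ (use J in auto)
  have "emeasure (bits k) S = (\<Prod>j\<in>J. emeasure (measure_pmf (bernoulli_pmf (exp (- k)))) {True})"
    unfolding S by (rule emeasure_PiM_Collect[OF J(1,2)]) simp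
  also have "\<dots> = ennreal (exp (- k)) ^ (n - m)"
    using k J(3) by (simp add: emeasure_pmf_single)
  also have "\<dots> = ennreal (exp (- (k * (real n - real m))))"
    using k(2) by (simp add: ennreal_power exp_of_nat_mult[symmetric] of_nat_diff mult.commute)
  finally show "measure (bits k) S = exp (- (k * (real n - real m)))"
    by (simp add: emeasure_eq_measure)
qed

section \<open>The spectrum of a fixed good tree\<close>

locale spectrum = branching_setup + free_walk_ldp +
  fixes C :: real
  assumes L_C: "L C = 0" and C_range: "0 \<le> C" "C \<le> 1"
begin

context
  fixes z :: "(nat list \<Rightarrow> nat) \<times> (nat list \<Rightarrow> fword)"
  assumes good: "good (labels z)"
begin

abbreviation lab where "lab \<equiv> labels z"

abbreviation T where "T \<equiv> tree lab"

abbreviation E where "E \<equiv> E_set d T (snd z)"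

abbreviation height :: "nat list \<Rightarrow> real" where
  "height u \<equiv> real (length (lp d (edges lab u)))"

lemma steps_edges: "u \<in> T \<Longrightarrow> set (edges lab u) \<subseteq> steps d"
proof
  fix s assume u: "u \<in> T" and "s \<in> set (edges lab u)"
  then obtain k where k: "k < length u" "s = lab (take k u) ! (u ! k)" by (auto simp: edges_def)
  then have "u ! k < length (lab (take k u))" using u by (auto simp: tree_def)
  then have "s \<in> set (lab (take k u))" using k by simp
  then show "s \<in> steps d" using good by (auto simp: good_def steps_ok_def)
qed

lemma E_eq: "E \<alpha> \<beta> = {t \<in> boundary T.
    liminf (\<lambda>n. ereal (height (t n) / real n)) = ereal \<alpha> \<and> limsup (\<lambda>n. ereal (height (t n) / real n)) = ereal \<beta>}"
proof -
  have "real (fnorm d (position d (snd z) (t n))) = height (t n)" if "t \<in> boundary T" for t n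
  proof -
    have "t n \<in> T" using that by (simp add: boundary_def)
    then show ?thesis by (simp only: position_edges lp_fnorm[OF steps_edges])
  qed
  then show ?thesis unfolding E_set_def by (intro Collect_cong conj_cong refl) simp_all
qed

lemma height_ray:
  assumes t: "t \<in> boundary T"
  shows "\<bar>height (t (Suc n)) - height (t n)\<bar> \<le> 1" "0 \<le> height (t n)" "height (t n) \<le> real n"
proof -
  have T: "t n \<in> T" for n using t by (simp add: boundary_def)
  have len: "length (t n) = n" by (rule boundary_prefix(2)[OF t order_refl])
  obtain k where k: "t (Suc n) = t n @ [k]" using t by (auto simp: boundary_def)
  have e: "edges lab (t (Suc n)) = edges lab (t n) @ edges (shift (t n) lab) [k]"
    unfolding k by (rule edges_append)
  have "set (edges (shift (t n) lab) [k]) \<subseteq> steps d"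
    using steps_edges[OF T[of "Suc n"]] unfolding e by simp
  from lp_length_append[OF steps_edges[OF T[of n]] this]
  show "\<bar>height (t (Suc n)) - height (t n)\<bar> \<le> 1" unfolding e by simp
  show "height (t n) \<le> real n"
    using lp_length_le[OF steps_edges[OF T[of n]]] len by simp
qed simp

lemma level_sum_finite:
  assumes "a \<in> \<rat>" "b \<in> \<rat>" "s \<in> \<rat>" "(\<Sum>n. ennreal (exp (real n * (ln r - s)) * rate_prob n {a..b})) < \<infinity>"
  shows "level_sum a b s lab < \<infinity>"
  using good assms unfolding good_def by blast

lemma blocks_speed: "blocks n (speed_words n a b) lab = {u \<in> T. length u = n \<and> height u / real (length u) \<in> {a..b}}"
  by (auto simp: blocks_def speed_words_def)

text \<open>At \<open>s = 0\<close> the level sum counts the vertices of speed near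
  \<open>q\<close>. If it is finite there are none at deep levels, whereas a ray of
  \<open>E \<alpha> \<beta>\<close> passes such vertices infinitely often by
  \<open>visits_interval\<close>.\<close>

lemma E_rate_le:
  assumes t: "t \<in> E \<alpha> \<beta>" and q: "\<alpha> \<le> q" "q \<le> \<beta>"
  shows "L q \<le> ereal (ln r)"
proof (rule ccontr)
  assume "\<not> ?thesis"
  then have "ereal (ln r) < L q" by simp
  then obtain c where c: "ereal (ln r) < ereal c" "ereal c < L q" using ereal_dense2 by blast
  obtain a b where ab: "a \<in> \<rat>" "b \<in> \<rat>" "a < q" "q < b"
    "(\<Sum>n. ennreal (exp (real n * ln r) * rate_prob n {a..b})) < \<infinity>"
    using rate_prob_summable[OF c(2), of "ln r"] c(1) by auto
  have "level_sum a b 0 lab < \<infinity>"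
    using ab by (intro level_sum_finite) simp_all
  then have "(\<Sum>n. ennreal (real (card (blocks n (speed_words n a b) lab)))) \<noteq> Orderings.top"
    by (simp add: level_sum_def ennreal_of_nat_eq_real_of_nat)
  then have "summable (\<lambda>n. real (card (blocks n (speed_words n a b) lab)))"
    by (intro summable_suminf_not_top) simp_all
  then have "(\<lambda>n. real (card (blocks n (speed_words n a b) lab))) \<longlonglongrightarrow> 0"
    by (rule summable_LIMSEQ_zero)
  then have "\<forall>\<^sub>F n in sequentially. real (card (blocks n (speed_words n a b) lab)) < 1"
    by (rule order_tendstoD) simp
  then obtain m where m: "\<And>n. m \<le> n \<Longrightarrow> card (blocks n (speed_words n a b) lab) = 0"
    unfolding eventually_sequentially by auto
  have tb: "t \<in> boundary T" and lim: "liminf (\<lambda>n. ereal (height (t n) / real n)) = ereal \<alpha>"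
    "limsup (\<lambda>n. ereal (height (t n) / real n)) = ereal \<beta>"
    using t unfolding E_eq by auto
  have "\<exists>\<^sub>\<infinity>n. height (t n) / real n \<in> {a..b}"
    by (rule visits_interval[OF height_ray[OF tb] lim q ab(3,4)])
  then obtain n where n: "m \<le> n" "height (t n) / real n \<in> {a..b}" unfolding INFM_nat_le by blast
  have "length (t n) = n" by (rule boundary_prefix(2)[OF tb order_refl])
  then have "t n \<in> blocks n (speed_words n a b) lab"
    using n(2) tb unfolding blocks_speed by (simp add: boundary_def)
  then show False using m[OF n(1)] finite_blocks[of n "speed_words n a b" lab] by auto
qed

lemma hausdorff_dim_le_rate:
  assumes F: "F \<subseteq> boundary T" and x: "0 \<le> x"
    and visits: "\<And>s. s \<in> \<rat> \<Longrightarrow> x < s \<Longrightarrow> \<exists>a\<in>\<rat>. \<exists>b\<in>\<rat>. (\<forall>t\<in>F. \<exists>\<^sub>\<infinity>n. height (t n) / real n \<in> {a..b}) \<and>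
      (\<Sum>n. ennreal (exp (real n * (ln r - s)) * rate_prob n {a..b})) < \<infinity>"
  shows "hausdorff_dim (boundary_metric T) F \<le> ereal x"
proof (rule ccontr)
  assume "\<not> ?thesis"
  then have "ereal x < hausdorff_dim (boundary_metric T) F" by simp
  then obtain y where y: "ereal x < ereal y" "ereal y < hausdorff_dim (boundary_metric T) F"
    using ereal_dense2 by blast
  obtain s where s: "s \<in> \<rat>" "x < s" "s < y" using Rats_dense_in_real[of x y] y(1) by auto
  obtain a b where ab: "a \<in> \<rat>" "b \<in> \<rat>" "\<forall>t\<in>F. \<exists>\<^sub>\<infinity>n. height (t n) / real n \<in> {a..b}"
    "(\<Sum>n. ennreal (exp (real n * (ln r - s)) * rate_prob n {a..b})) < \<infinity>"
    using visits[OF s(1,2)] by blast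
  define S where "S = {u \<in> T. height u / real (length u) \<in> {a..b}}"
  have S: "{u \<in> S. length u = n} = blocks n (speed_words n a b) lab" for n
    unfolding blocks_speed by (auto simp: S_def)
  have "hausdorff_measure (boundary_metric T) s F = 0"
  proof (rule hausdorff_measure_zero[OF _ F])
    show "0 < s" using s x by simp
    fix t assume t: "t \<in> F"
    then have tb: "t \<in> boundary T" using F by blast
    have inf: "\<exists>\<^sub>\<infinity>n. height (t n) / real n \<in> {a..b}" using ab(3) t by blast
    have "t n \<in> S" if "height (t n) / real n \<in> {a..b}" for n
      using that tb boundary_prefix(2)[OF tb order_refl, of n] by (simp add: S_def boundary_def)
    with inf show "\<exists>\<^sub>\<infinity>n. t n \<in> S" by (rule INFM_mono)
  next
    show "finite {u \<in> S. length u = n}" for n unfolding S by (rule finite_blocks)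
    show "(\<Sum>n. ennreal (exp (- (s * real n))) * of_nat (card {u \<in> S. length u = n})) < \<infinity>"
      unfolding S using level_sum_finite[OF ab(1,2) s(1) ab(4)] by (simp add: level_sum_def)
  qed
  then have "hausdorff_dim (boundary_metric T) F \<le> ereal s"
    using s x by (intro hausdorff_dim_le) auto
  also have "\<dots> < ereal y" using s by simp
  finally show False using y(2) by simp
qed

lemma hausdorff_dim_E_le:
  assumes q: "\<alpha> \<le> q" "q \<le> \<beta>" and Lq: "L q = ereal x" "x \<le> ln r"
  shows "hausdorff_dim (boundary_metric T) (E \<alpha> \<beta>) \<le> ereal (ln r - x)"
proof (rule hausdorff_dim_le_rate)
  show "E \<alpha> \<beta> \<subseteq> boundary T" unfolding E_eq by blast
  show "0 \<le> ln r - x" using Lq(2) by simp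
  fix s assume "s \<in> \<rat>" "ln r - x < s"
  \<comment> \<open>The window between \<open>ln r - s\<close> and \<open>x\<close> makes the
    weighted counts near \<open>q\<close> summable for every \<open>s\<close> above the claimed
    dimension.\<close>
  then obtain c where c: "ln r - s < c" "c < x" using dense[of "ln r - s" x] by auto
  then have "ereal c < L q" using Lq by simp
  from rate_prob_summable[OF this c(1)] obtain a b where ab: "a \<in> \<rat>" "b \<in> \<rat>" "a < q" "q < b"
    "(\<Sum>n. ennreal (exp (real n * (ln r - s)) * rate_prob n {a..b})) < \<infinity>" by blast
  have "\<exists>\<^sub>\<infinity>n. height (t n) / real n \<in> {a..b}" if "t \<in> E \<alpha> \<beta>" for t
  proof -
    have tb: "t \<in> boundary T" and lim: "liminf (\<lambda>n. ereal (height (t n) / real n)) = ereal \<alpha>"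
      "limsup (\<lambda>n. ereal (height (t n) / real n)) = ereal \<beta>"
      using that unfolding E_eq by auto
    show ?thesis by (rule visits_interval[OF height_ray[OF tb] lim q ab(3,4)])
  qed
  with ab show "\<exists>a\<in>\<rat>. \<exists>b\<in>\<rat>. (\<forall>t\<in>E \<alpha> \<beta>. \<exists>\<^sub>\<infinity>n. height (t n) / real n \<in> {a..b}) \<and>
      (\<Sum>n. ennreal (exp (real n * (ln r - s)) * rate_prob n {a..b})) < \<infinity>" by blast
qed

text \<open>All speeds lie in \<open>{0..1}\<close>, so that interval is visited at every level, and
  bounding its probability by 1 leaves a geometric series.\<close>

lemma hausdorff_dim_boundary_le: "hausdorff_dim (boundary_metric T) (boundary T) \<le> ereal (ln r)"
proof (rule hausdorff_dim_le_rate)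
  show "0 \<le> ln r" using ln_r by simp
  fix s assume s: "s \<in> \<rat>" "ln r < s"
  have "\<exists>\<^sub>\<infinity>n. height (t n) / real n \<in> {0..1}" if "t \<in> boundary T" for t
  proof -
    have "height (t n) / real n \<in> {0..1}" for n
      using height_ray(2,3)[OF that, of n] by (cases "n = 0") (auto simp: divide_le_eq)
    then show ?thesis by (simp add: INFM_nat)
  qed
  moreover have "(\<Sum>n. ennreal (exp (real n * (ln r - s)) * rate_prob n {0..1})) < \<infinity>"
  proof -
    have "summable (\<lambda>n. exp (ln r - s) ^ n)"
      using s by (intro summable_geometric) simp
    then have "summable (\<lambda>n. exp (real n * (ln r - s)) * rate_prob n {0..1})"
    proof (rule summable_comparison_test'[where N = 0])
      fix n :: nat
      have "exp (real n * (ln r - s)) * rate_prob n {0..1} \<le> exp (real n * (ln r - s)) * 1"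
        using rate_prob_le_one by (intro mult_left_mono) auto
      also have "\<dots> = exp (ln r - s) ^ n" by (simp only: exp_of_nat_mult mult_1_right)
      finally show "norm (exp (real n * (ln r - s)) * rate_prob n {0..1}) \<le> exp (ln r - s) ^ n"
        by (simp add: rate_prob_def)
    qed
    then show ?thesis by (subst suminf_ennreal2) (auto simp: rate_prob_def)
  qed
  ultimately show "\<exists>a\<in>\<rat>. \<exists>b\<in>\<rat>. (\<forall>t\<in>boundary T. \<exists>\<^sub>\<infinity>n. height (t n) / real n \<in> {a..b}) \<and>
      (\<Sum>n. ennreal (exp (real n * (ln r - s)) * rate_prob n {a..b})) < \<infinity>"
    by (intro bexI[of _ 0] bexI[of _ 1]) auto
qed simp

text \<open>The tree being good, \<open>open_pos\<close> supplies a vertex \<open>v\<close> below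
  \<open>u\<close> where an open type survives with positive probability over the bits. Outside a
  null set of bits the transitions hold too, and every remaining choice gives a ray by
  \<open>survival_ray\<close>. It is open only below \<open>v\<close>, since nothing is known about
  the bits above.\<close>

lemma percolated_ray:
  assumes k: "k \<in> \<rat>" "0 \<le> k" "k < ln r"
    and \<alpha>: "0 \<le> \<alpha>" "\<alpha> \<le> \<beta>" "\<beta> \<le> 1" "L \<alpha> \<le> ereal (ln r - k)" "L \<beta> \<le> ereal (ln r - k)"
    and u: "u \<in> T"
  obtains v A where "\<exists>w. v = u @ w" "A \<in> sets (bits k)" "0 < measure (bits k) A"
    "\<forall>b\<in>A. \<exists>t\<in>E \<alpha> \<beta>. t (length v) = v \<and>
      (\<forall>n\<ge>length v. \<forall>j. length v \<le> j \<and> j < n \<longrightarrow> b (take (Suc j) (t n)))"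
proof -
  interpret B: prob_space "bits k" by (rule prob_space_nonroot)
  let ?h = "ln r - k"
  have h: "0 < ?h" using k by simp
  have dense: "\<exists>i\<in>types ?h. \<bar>real (snd i) / real (fst i) - \<gamma>\<bar> < \<epsilon>" if "\<gamma> \<in> {\<alpha>, \<beta>}" "0 < \<epsilon>" for \<gamma> \<epsilon>
  proof -
    have "L \<gamma> \<le> ereal ?h" "0 \<le> \<gamma>" "\<gamma> \<le> 1" using that \<alpha> by auto
    from types_dense[OF h this \<open>0 < \<epsilon>\<close> L_C] obtain l j where "(l, j) \<in> types ?h" "\<bar>real j / real l - \<gamma>\<bar> < \<epsilon>" .
    then show ?thesis by force
  qed
  obtain i where i: "i \<in> types ?h" using dense[of \<alpha> 1] by auto
  have trans: "AE b in bits k. transitions k (zipb lab b)"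
    and "\<exists>w\<in>tree (shift u lab). open_pos k i (shift w (shift u lab))"
    using good k(1,2) i unfolding good_def by blast+
  then obtain w where w: "w \<in> tree (shift u lab)" "open_pos k i (shift (u @ w) lab)" by auto
  define v where "v = u @ w"
  have v: "v \<in> T" using u w(1) by (simp add: v_def tree_append)
  define A0 where "A0 = {b \<in> space (bits k). shift v (zipb lab b) \<in> open_survival d i}"
  have A0: "A0 \<in> sets (bits k)" "0 < emeasure (bits k) A0"
  proof -
    have meas: "{b \<in> space (bits k). zipb (shift v lab) b \<in> open_survival d i} \<in> sets (bits k)"
      by (rule sets_zipb_survival(2))
    show "A0 \<in> sets (bits k)"
      unfolding A0_def shift_zipb by (rule emeasure_bits_shift(2)[OF meas])
    show "0 < emeasure (bits k) A0"
      unfolding A0_def shift_zipb emeasure_bits_shift(1)[OF meas]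
      using w(2) by (simp only: open_pos_def v_def)
  qed
  obtain N where N: "{b \<in> space (bits k). \<not> transitions k (zipb lab b)} \<subseteq> N" "emeasure (bits k) N = 0" "N \<in> sets (bits k)"
    using AE_E[OF trans] by blast
  define A where "A = A0 - N"
  have "emeasure (bits k) A = emeasure (bits k) A0"
    unfolding A_def using A0(1) N by (intro emeasure_Diff_null_set) (simp add: null_sets_def)
  then have A: "A \<in> sets (bits k)" "0 < measure (bits k) A"
    using A0 N(3) by (simp_all add: A_def B.emeasure_eq_measure)
  show ?thesis
  proof (rule that[of v A])
    show "\<exists>w. v = u @ w" by (simp add: v_def)
  next
    show "\<forall>b\<in>A. \<exists>t\<in>E \<alpha> \<beta>. t (length v) = v \<and>
      (\<forall>n\<ge>length v. \<forall>j. length v \<le> j \<and> j < n \<longrightarrow> b (take (Suc j) (t n)))"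
    proof
    fix b assume b: "b \<in> A"
    then have "b \<in> space (bits k)" and surv: "shift v (zipb lab b) \<in> open_survival d i" and "b \<notin> N"
      by (auto simp: A_def A0_def)
    then have tr: "transitions k (zipb lab b)" using N(1) by blast
    have "v \<in> tree (zipb lab b)" using v by (simp only: tree_zipb)
    moreover have "set (map fst (edges (zipb lab b) v)) \<subseteq> steps d"
      unfolding map_fst_edges_zipb[OF v] by (rule steps_edges[OF v])
    ultimately obtain t where t: "t \<in> boundary (tree (zipb lab b))" "t (length v) = v"
      "\<And>N. list_all snd (drop (length v) (edges (zipb lab b) (t N)))"
      "liminf (\<lambda>N. ereal (real (length (pos d (edges (zipb lab b) (t N)))) / real N)) = ereal \<alpha>"
      "limsup (\<lambda>N. ereal (real (length (pos d (edges (zipb lab b) (t N)))) / real N)) = ereal \<beta>"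
    proof (rule survival_ray[OF _ _ i surv _ _ \<alpha>(2) dense])
      show "\<exists>n\<ge>n0. shift u (zipb lab b) \<in> (open_reach d i ^^ n) (open_survival d i')"
        if "i \<in> types ?h" "i' \<in> types ?h" "shift u (zipb lab b) \<in> open_survival d i" for u i i' n0
        using tr that unfolding transitions_def by blast
    qed (auto dest: types_range)
    have tb: "t \<in> boundary T" using t(1) by (simp only: tree_zipb)
    then have tT: "t n \<in> T" for n by (simp add: boundary_def)
    have tE: "t \<in> E \<alpha> \<beta>"
      unfolding E_eq using tb t(4,5) by (simp add: map_fst_edges_zipb[OF tT])
    have "b (take (Suc j) (t n))" if "length v \<le> j" "j < n" for j n
    proof -
      have len: "length (t n) = n" by (rule boundary_prefix(2)[OF tb order_refl])
      have "snd (drop (length v) (edges (zipb lab b) (t n)) ! (j - length v))"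
        using t(3)[of n, unfolded list_all_length, rule_format, of "j - length v"] that len by simp
      then show ?thesis
        using that len by (simp add: edges_zipb[OF tT])
    qed
    then show "\<exists>t\<in>E \<alpha> \<beta>. t (length v) = v \<and>
      (\<forall>n\<ge>length v. \<forall>j. length v \<le> j \<and> j < n \<longrightarrow> b (take (Suc j) (t n)))"
      using tE t(2) by blast
    qed
  qed (rule A)+
qed

text \<open>At \<open>k = 0\<close> almost surely every edge is kept, and the positive probability
  of \<open>A\<close> only serves to exhibit one choice of bits.\<close>

lemma ray_through:
  assumes "0 \<le> \<alpha>" "\<alpha> \<le> \<beta>" "\<beta> \<le> 1" "L \<alpha> \<le> ereal (ln r)" "L \<beta> \<le> ereal (ln r)" and u: "u \<in> T"
  obtains t where "t \<in> E \<alpha> \<beta>" "t (length u) = u"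
proof -
  obtain v A where v: "\<exists>w. v = u @ w" and A: "A \<in> sets (bits 0)" "0 < measure (bits 0) A"
    "\<forall>b\<in>A. \<exists>t\<in>E \<alpha> \<beta>. t (length v) = v \<and>
      (\<forall>n\<ge>length v. \<forall>j. length v \<le> j \<and> j < n \<longrightarrow> b (take (Suc j) (t n)))"
    using percolated_ray[of 0 \<alpha> \<beta> u] assms ln_r by auto
  have "A \<noteq> {}" using A(2) by (intro notI) simp
  then obtain b where "b \<in> A" by blast
  with A(3) obtain t where t: "t \<in> E \<alpha> \<beta>" "t (length v) = v" by blast
  then have "t \<in> boundary T" unfolding E_eq by blast
  then have "t (length u) = take (length u) (t (length v))"
    using v by (intro boundary_prefix(1)) auto
  then have "t (length u) = u" using t(2) v by auto
  with t(1) show ?thesis by (rule that)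
qed

lemma hausdorff_dim_E_ge:
  assumes k: "k \<in> \<rat>" "0 \<le> k" "k < ln r"
    and \<alpha>: "0 \<le> \<alpha>" "\<alpha> \<le> \<beta>" "\<beta> \<le> 1" "L \<alpha> \<le> ereal (ln r - k)" "L \<beta> \<le> ereal (ln r - k)"
  shows "ereal k \<le> hausdorff_dim (boundary_metric T) (E \<alpha> \<beta>)"
proof (rule hausdorff_dim_ge)
  fix s assume s: "0 \<le> s" "s \<le> k"
  obtain v A where "\<exists>w. v = [] @ w" and A: "A \<in> sets (bits k)" "0 < measure (bits k) A"
    "\<forall>b\<in>A. \<exists>t\<in>E \<alpha> \<beta>. t (length v) = v \<and>
      (\<forall>n\<ge>length v. \<forall>j. length v \<le> j \<and> j < n \<longrightarrow> b (take (Suc j) (t n)))"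
    by (rule percolated_ray[OF k \<alpha> Nil_tree], rule that)
  \<comment> \<open>Openness is asked only between \<open>v\<close> and \<open>u\<close>, as
    \<open>percolated_ray\<close> provides it; this is why the exponent in
    \<open>hausdorff_measure_pos\<close> counts levels from \<open>length v\<close>.\<close>
  define op where "op u = (if length v \<le> length u
    then {b \<in> space (bits k). \<forall>j. length v \<le> j \<and> j < length u \<longrightarrow> b (take (Suc j) u)} else {})" for u
  show "hausdorff_measure (boundary_metric T) s (E \<alpha> \<beta>) \<noteq> 0"
  proof (rule hausdorff_measure_pos[where op = op and B = "bits k" and v = v and k = k and good = A])
    show "prob_space (bits k)" by (rule prob_space_nonroot)
    show "op u \<in> sets (bits k)" for u
    proof (cases "length v \<le> length u")
      case True
      then show ?thesis unfolding op_def if_P[OF True] by (intro prob_bits_open(1)[OF refl k(2)])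
    next
      case False
      show ?thesis unfolding op_def if_not_P[OF False] by (rule sets.empty_sets)
    qed
    show "measure (bits k) (op u) \<le> exp (- (k * (real (length u) - real (length v))))" if "length v \<le> length u" for u
      unfolding op_def if_P[OF that] prob_bits_open(2)[OF refl k(2) that] by (rule order_refl)
    show "E \<alpha> \<beta> \<subseteq> boundary T" unfolding E_eq by blast
    fix b assume b: "b \<in> A"
    from bspec[OF A(3) b] obtain t where t: "t \<in> E \<alpha> \<beta>" "t (length v) = v"
      "\<And>n j. length v \<le> n \<Longrightarrow> length v \<le> j \<Longrightarrow> j < n \<Longrightarrow> b (take (Suc j) (t n))" by blast
    have "b \<in> space (bits k)" using b A(1) sets.sets_into_space by blast
    moreover have "length (t n) = n" for n
      using t(1) boundary_prefix(2)[of t T n n] unfolding E_eq by blast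
    ultimately have "b \<in> op (t n)" if "length v \<le> n" for n
      using that t(3) unfolding op_def by simp
    with t(1,2) show "\<exists>t\<in>E \<alpha> \<beta>. t (length v) = v \<and> (\<forall>n\<ge>length v. b \<in> op (t n))" by blast
  qed (use A s in auto)
qed

lemma I_setD:
  assumes "q \<in> I_set L r"
  obtains x where "L q = ereal x" "0 \<le> x" "x \<le> ln r" "0 \<le> q" "q \<le> 1"
proof -
  have q: "0 \<le> q" "q \<le> 1" "L q \<le> ereal (ln r)" using assms by (auto simp: I_set_def)
  obtain x where "L q = ereal x" using q(3) L_nonneg[of q] by (cases "L q") auto
  then show ?thesis using that[of x] q L_nonneg[of q] by simp
qed

lemma E_nonempty_iff:
  assumes "0 \<le> \<alpha>" "\<alpha> \<le> \<beta>" "\<beta> \<le> 1"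
  shows "E \<alpha> \<beta> \<noteq> {} \<longleftrightarrow> {\<alpha>..\<beta>} \<subseteq> I_set L r"
proof
  assume "E \<alpha> \<beta> \<noteq> {}"
  then obtain t where t: "t \<in> E \<alpha> \<beta>" by blast
  show "{\<alpha>..\<beta>} \<subseteq> I_set L r"
  proof
    fix q assume "q \<in> {\<alpha>..\<beta>}"
    then show "q \<in> I_set L r" using E_rate_le[OF t, of q] assms by (simp add: I_set_def)
  qed
next
  assume "{\<alpha>..\<beta>} \<subseteq> I_set L r"
  then have "\<alpha> \<in> I_set L r" "\<beta> \<in> I_set L r" using assms by auto
  then have "L \<alpha> \<le> ereal (ln r)" "L \<beta> \<le> ereal (ln r)" by (simp_all add: I_set_def)
  from ray_through[OF assms this Nil_tree] show "E \<alpha> \<beta> \<noteq> {}" by blast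
qed

text \<open>A ray of the set passes through every vertex by \<open>ray_through\<close>, hence
  through the vertices of any given ray at arbitrarily deep levels.\<close>

lemma E_dense:
  assumes "0 \<le> \<alpha>" "\<alpha> \<le> \<beta>" "\<beta> \<le> 1" "{\<alpha>..\<beta>} \<subseteq> I_set L r"
  shows "mtopology_of (boundary_metric T) closure_of E \<alpha> \<beta> = boundary T"
proof -
  interpret Metric_space "boundary T" ray_dist by (rule Metric_space_boundary)
  have "\<alpha> \<in> I_set L r" "\<beta> \<in> I_set L r" using assms by auto
  then have L: "L \<alpha> \<le> ereal (ln r)" "L \<beta> \<le> ereal (ln r)" by (simp_all add: I_set_def)
  have "\<exists>t'\<in>E \<alpha> \<beta>. t' \<in> mball t e" if t: "t \<in> boundary T" and "0 < e" for t e
  proof -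
    have "(\<lambda>n. exp (- real n)) \<longlonglongrightarrow> 0"
      using LIMSEQ_realpow_zero[of "exp (-1)"] by (simp add: exp_of_nat_mult[symmetric])
    then have "\<forall>\<^sub>F n in sequentially. exp (- real n) < e"
      using \<open>0 < e\<close> by (rule order_tendstoD)
    then obtain n where n: "exp (- real n) < e" unfolding eventually_sequentially by blast
    have tn: "t n \<in> T" "length (t n) = n"
      using t boundary_prefix(2)[OF t order_refl] by (auto simp: boundary_def)
    obtain t' where t': "t' \<in> E \<alpha> \<beta>" "t' (length (t n)) = t n"
      by (rule ray_through[OF assms(1-3) L tn(1)])
    have t'b: "t' \<in> boundary T" using t'(1) unfolding E_eq by blast
    have "t n = t' n" using t'(2) unfolding tn(2) by (rule sym)
    from ray_dist_le[OF t t'b this] n have "ray_dist t t' < e" by (rule le_less_trans)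
    then have "t' \<in> mball t e" using t t'b by (simp only: in_mball)
    with t'(1) show ?thesis by blast
  qed
  then have "mtopology closure_of E \<alpha> \<beta> = boundary T"
    unfolding metric_closure_of by blast
  then show ?thesis by (simp add: boundary_metric_def)
qed

lemma hausdorff_dim_E:
  assumes "0 \<le> \<alpha>" "\<alpha> \<le> \<beta>" "\<beta> \<le> 1" "{\<alpha>..\<beta>} \<subseteq> I_set L r"
  shows "hausdorff_dim (boundary_metric T) (E \<alpha> \<beta>) = ereal (ln r) - max (L \<alpha>) (L \<beta>)"
proof -
  have \<alpha>: "\<alpha> \<in> I_set L r" and \<beta>: "\<beta> \<in> I_set L r" using assms by auto
  from \<alpha> obtain x where x: "L \<alpha> = ereal x" "0 \<le> x" "x \<le> ln r" by (rule I_setD)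
  from \<beta> obtain y where y: "L \<beta> = ereal y" "0 \<le> y" "y \<le> ln r" by (rule I_setD)
  let ?dim = "hausdorff_dim (boundary_metric T) (E \<alpha> \<beta>)"
  have "?dim \<le> ereal (ln r - x)" "?dim \<le> ereal (ln r - y)"
    using hausdorff_dim_E_le[of \<alpha> \<alpha> \<beta> x] hausdorff_dim_E_le[of \<alpha> \<beta> \<beta> y] x y assms by simp_all
  then have upper: "?dim \<le> ereal (ln r - max x y)" by (simp add: max_def)
  have lower: "ereal (ln r - max x y) \<le> ?dim"
  proof (rule ccontr)
    assume "\<not> ?thesis"
    then have "?dim < ereal (ln r - max x y)" by simp
    \<comment> \<open>Nonnegativity of the dimension makes the rational \<open>k\<close> chosen
      above it an admissible percolation parameter.\<close>
    moreover have "0 \<le> ?dim" by (rule hausdorff_dim_nonneg)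
    ultimately obtain w where w: "?dim = ereal w" "0 \<le> w" "w < ln r - max x y"
      by (cases ?dim) auto
    obtain k where k: "k \<in> \<rat>" "w < k" "k < ln r - max x y" using Rats_dense_in_real[OF w(3)] by blast
    have "ereal k \<le> ?dim"
      using k w(2) x y assms by (intro hausdorff_dim_E_ge) (auto simp: max_def split: if_splits)
    then show False using w(1) k(2) by simp
  qed
  have "ereal (ln r) - max (L \<alpha>) (L \<beta>) = ereal (ln r - max x y)"
    by (simp add: x y max_def)
  then show ?thesis using upper lower by (simp add: antisym)
qed

theorem spectrum_good:
  "(\<forall>\<alpha> \<beta>. 0 \<le> \<alpha> \<and> \<alpha> \<le> \<beta> \<and> \<beta> \<le> 1 \<longrightarrow>
      (E \<alpha> \<beta> \<noteq> {} \<longleftrightarrow> {\<alpha>..\<beta>} \<subseteq> I_set L r) \<and>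
      ({\<alpha>..\<beta>} \<subseteq> I_set L r \<longrightarrow>
        mtopology_of (boundary_metric T) closure_of E \<alpha> \<beta> = boundary T \<and>
        hausdorff_dim (boundary_metric T) (E \<alpha> \<beta>) = ereal (ln r) - max (L \<alpha>) (L \<beta>))) \<and>
   (\<forall>\<alpha>\<in>I_set L r. hausdorff_dim (boundary_metric T) (E \<alpha> \<alpha>) = ereal (ln r) - L \<alpha>) \<and>
   hausdorff_dim (boundary_metric T) (boundary T) = hausdorff_dim (boundary_metric T) (E C C)"
proof (intro conjI allI impI ballI)
  fix \<alpha> assume \<alpha>: "\<alpha> \<in> I_set L r"
  then have "{\<alpha>..\<alpha>} \<subseteq> I_set L r" "0 \<le> \<alpha>" "\<alpha> \<le> 1" by (auto simp: I_set_def)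
  then show "hausdorff_dim (boundary_metric T) (E \<alpha> \<alpha>) = ereal (ln r) - L \<alpha>"
    using hausdorff_dim_E[of \<alpha> \<alpha>] by simp
next
  \<comment> \<open>Since \<open>L C = 0\<close>, the dimension of \<open>E C C\<close> equals the
    upper bound \<open>ln r\<close> for the whole boundary.\<close>
  have "{C..C} \<subseteq> I_set L r" using C_range ln_r by (simp add: I_set_def L_C)
  then have C: "hausdorff_dim (boundary_metric T) (E C C) = ereal (ln r)"
    using hausdorff_dim_E[of C C] C_range by (simp add: L_C)
  show "hausdorff_dim (boundary_metric T) (boundary T) = hausdorff_dim (boundary_metric T) (E C C)"
  proof (rule antisym)
    show "hausdorff_dim (boundary_metric T) (boundary T) \<le> hausdorff_dim (boundary_metric T) (E C C)"
      unfolding C by (rule hausdorff_dim_boundary_le)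
    show "hausdorff_dim (boundary_metric T) (E C C) \<le> hausdorff_dim (boundary_metric T) (boundary T)"
      by (rule hausdorff_dim_mono) (auto simp: E_set_def)
  qed
qed (use E_nonempty_iff E_dense hausdorff_dim_E in auto)

end

end

section \<open>Transfer from the given random variables\<close>

lemma (in free_walk) rate_prob_eq:
  assumes X: "has_law P X (\<Pi>\<^sub>M n\<in>UNIV. measure_pmf \<mu>)"
  shows "measure P {\<omega> \<in> space P. real (fnorm d (walk d (X \<omega>) n)) / real n \<in> B} = rate_prob n B"
    and "{\<omega> \<in> space P. real (fnorm d (walk d (X \<omega>) n)) / real n \<in> B} \<in> sets P"
proof -
  let ?S = "\<Pi>\<^sub>M n\<in>(UNIV :: nat set). measure_pmf \<mu>"
  let ?B = "{es. real (fnorm d (lp d es)) / real n \<in> B}"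
  let ?A = "{x \<in> space ?S. map (\<lambda>k. x k) [0..<n] \<in> ?B}"
  have meas: "X \<in> measurable P ?S" and distr: "distr P ?S X = ?S"
    using X by (auto simp: has_law_def)
  have A: "?A \<in> sets ?S" by (rule emeasure_map_coordinates(2)) simp_all
  have pre: "X -` ?A \<inter> space P = {\<omega> \<in> space P. real (fnorm d (walk d (X \<omega>) n)) / real n \<in> B}"
    using measurable_space[OF meas] by (auto simp: walk_def)
  show "{\<omega> \<in> space P. real (fnorm d (walk d (X \<omega>) n)) / real n \<in> B} \<in> sets P"
    unfolding pre[symmetric] by (rule measurable_sets[OF meas A])
  have "emeasure P {\<omega> \<in> space P. real (fnorm d (walk d (X \<omega>) n)) / real n \<in> B} = emeasure (distr P ?S X) ?A"
    unfolding pre[symmetric] by (rule emeasure_distr[OF meas A, symmetric])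
  also have "\<dots> = emeasure (measure_pmf (replicate_pmf n \<mu>)) ?B"
    unfolding distr by (rule emeasure_map_coordinates(1)) simp_all
  finally have "measure P {\<omega> \<in> space P. real (fnorm d (walk d (X \<omega>) n)) / real n \<in> B} = measure_pmf.prob (replicate_pmf n \<mu>) ?B"
    by (simp add: measure_def)
  also have "\<dots> = rate_prob n B"
    unfolding rate_prob_def
  proof (rule measure_pmf.finite_measure_eq_AE)
    show "AE es in replicate_pmf n \<mu>. es \<in> ?B \<longleftrightarrow> es \<in> {es. real (length (lp d es)) / real n \<in> B}"
      unfolding AE_measure_pmf_iff using set_replicate[of _ n] lp_fnorm by simp
  qed simp_all
  finally show "measure P {\<omega> \<in> space P. real (fnorm d (walk d (X \<omega>) n)) / real n \<in> B} = rate_prob n B" .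
qed

text \<open>If \<open>L C\<close> were positive, the probabilities of speeds near \<open>C\<close>
  would be summable, and by Borel-Cantelli the speed would eventually leave a neighbourhood of
  \<open>C\<close>, against the almost sure convergence. The bounds on \<open>C\<close> hold because
  the length never exceeds the number of steps.\<close>

lemma (in free_walk_ldp) rate_zero_at_speed:
  assumes P: "prob_space P" and X: "has_law P X (\<Pi>\<^sub>M n\<in>UNIV. measure_pmf \<mu>)"
    and lim: "AE \<omega> in P. (\<lambda>n. real (fnorm d (walk d (X \<omega>) n)) / real n) \<longlonglongrightarrow> C"
  shows "L C = 0" "0 \<le> C" "C \<le> 1"
proof -
  interpret prob_space P by fact
  let ?W = "\<lambda>n \<omega>. real (fnorm d (walk d (X \<omega>) n)) / real n"
  have tail: False if ab: "a < C" "C < b" and sum: "(\<Sum>n. ennreal (rate_prob n {a..b})) < \<infinity>" for a b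
  proof -
    define A where "A n = {\<omega> \<in> space P. ?W n \<omega> \<in> {a..b}}" for n
    have A: "A n \<in> sets P" "measure P (A n) = rate_prob n {a..b}" for n
      unfolding A_def by (rule rate_prob_eq(2)[OF X], rule rate_prob_eq(1)[OF X])
    have "summable (\<lambda>n. measure P (A n))"
      unfolding A(2) using sum by (intro summable_suminf_not_top) (auto simp: rate_prob_def)
    then have "AE \<omega> in P. \<forall>\<^sub>F n in sequentially. \<omega> \<in> space P - A n"
      using A(1) by (intro borel_cantelli_AE1) (auto simp: emeasure_eq_measure)
    with lim have "AE \<omega> in P. False"
    proof eventually_elim
      case (elim \<omega>)
      have "\<forall>\<^sub>F n in sequentially. a < ?W n \<omega>" "\<forall>\<^sub>F n in sequentially. ?W n \<omega> < b"
        using elim(1) ab by (auto intro: order_tendstoD)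
      with elim(2) have "\<forall>\<^sub>F n in sequentially. False"
        by eventually_elim (auto simp: A_def)
      then show False by simp
    qed
    then show False by simp
  qed
  show "L C = 0"
  proof (rule ccontr)
    assume "L C \<noteq> 0"
    then have "0 < L C" using L_nonneg[of C] by (simp add: less_le)
    then obtain c where c: "(0::ereal) < ereal c" "ereal c < L C" using ereal_dense2 by blast
    have "0 < c" using c(1) by simp
    from rate_prob_summable[OF c(2) this] obtain a b where "a < C" "C < b"
      "(\<Sum>n. ennreal (exp (real n * 0) * rate_prob n {a..b})) < \<infinity>" .
    then show False using tail[of a b] by simp
  qed
  have "AE \<omega> in P. \<forall>n. X \<omega> n \<in> steps d"
  proof -
    have "AE x in (\<Pi>\<^sub>M n\<in>UNIV. measure_pmf \<mu>). x n \<in> steps d" for n :: nat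
      by (rule AE_PiM_component[where P = "\<lambda>s. s \<in> steps d"])
        (use support in \<open>auto simp: prob_space_measure_pmf AE_measure_pmf_iff\<close>)
    then have "AE x in (\<Pi>\<^sub>M n\<in>UNIV. measure_pmf \<mu>). \<forall>n::nat. x n \<in> steps d"
      by (simp add: AE_all_countable)
    note steps = this
    have meas: "X \<in> measurable P (\<Pi>\<^sub>M n\<in>UNIV. measure_pmf \<mu>)"
      and distr: "distr P (\<Pi>\<^sub>M n\<in>UNIV. measure_pmf \<mu>) X = (\<Pi>\<^sub>M n\<in>UNIV. measure_pmf \<mu>)"
      using X by (auto simp: has_law_def)
    show ?thesis
      by (rule AE_distrD[OF meas], subst distr, rule steps)
  qed
  with lim have "AE \<omega> in P. 0 \<le> C \<and> C \<le> 1"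
  proof eventually_elim
    case (elim \<omega>)
    have "?W n \<omega> \<le> 1" for n
    proof -
      have s: "set (map (X \<omega>) [0..<n]) \<subseteq> steps d" using elim(2) by auto
      have "fnorm d (walk d (X \<omega>) n) \<le> n"
        unfolding walk_def lp_fnorm[OF s] using lp_length_le[OF s] by simp
      then show ?thesis by (cases "n = 0") (auto simp: divide_le_eq)
    qed
    then have "C \<le> 1" by (intro LIMSEQ_le_const2[OF elim(1)]) blast
    moreover have "0 \<le> C" by (rule LIMSEQ_le_const[OF elim(1)]) auto
    ultimately show ?case by simp
  qed
  then show "0 \<le> C" "C \<le> 1" by auto
qed

text \<open>Positions read steps only at nonempty prefixes of \<open>u\<close>, so restricting the
  steps to nonroot vertices changes none of them.\<close>

lemma position_restrict: "position d (restrict y {u. u \<noteq> []}) u = position d y u"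
  unfolding position_def by (rule arg_cong[where f = "list_prod (free_group d)"], rule map_cong) auto

theorem theorem1p3:
  fixes d :: nat and \<mu> :: "fword pmf"
    and P :: "'w measure" and X :: "'w \<Rightarrow> nat \<Rightarrow> fword"
    and C :: real and L :: "real \<Rightarrow> ereal"
    and p :: "nat pmf" and r :: real
    and M :: "'o measure" and N :: "'o \<Rightarrow> nat list \<Rightarrow> nat" and Y :: "'o \<Rightarrow> nat list \<Rightarrow> fword"
  assumes "d \<ge> 2"
    and "set_pmf \<mu> \<subseteq> free_gens d \<union> {\<one>\<^bsub>free_group d\<^esub>}"
    and "\<And>a. a \<in> free_gens d \<Longrightarrow> pmf \<mu> a = pmf \<mu> (inv\<^bsub>free_group d\<^esub> a) \<and> pmf \<mu> a > 0"
    and "prob_space P"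
    and "has_law P X (\<Pi>\<^sub>M n\<in>UNIV. measure_pmf \<mu>)"
    and "AE \<omega> in P. (\<lambda>n. real (fnorm d (walk d (X \<omega>) n)) / real n) \<longlonglongrightarrow> C"
    and "ldp_rate_function P (\<lambda>n \<omega>. real (fnorm d (walk d (X \<omega>) n)) / real n) L"
    and "pmf p 0 = 0"
    and "\<exists>s>0. summable (\<lambda>k. exp (s * real k) * pmf p k)"
    and "(\<lambda>k. real k * pmf p k) sums r"
    and "1 < r"
    and "prob_space M"
    and "has_law M (\<lambda>\<omega>. (N \<omega>, restrict (Y \<omega>) {u. u \<noteq> []})) (branching_walk_law p \<mu>)"
  shows "AE \<omega> in M.
    (let T = gw_tree (N \<omega>); m = boundary_metric T; E = E_set d T (Y \<omega>) in
      (\<forall>\<alpha> \<beta>. 0 \<le> \<alpha> \<and> \<alpha> \<le> \<beta> \<and> \<beta> \<le> 1 \<longrightarrow>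
         (E \<alpha> \<beta> \<noteq> {} \<longleftrightarrow> {\<alpha>..\<beta>} \<subseteq> I_set L r) \<and>
         ({\<alpha>..\<beta>} \<subseteq> I_set L r \<longrightarrow>
            mtopology_of m closure_of E \<alpha> \<beta> = boundary T \<and>
            hausdorff_dim m (E \<alpha> \<beta>) = ereal (ln r) - max (L \<alpha>) (L \<beta>))) \<and>
      (\<forall>\<alpha>\<in>I_set L r. hausdorff_dim m (E \<alpha> \<alpha>) = ereal (ln r) - L \<alpha>) \<and>
      hausdorff_dim m (boundary T) = hausdorff_dim m (E C C))"
proof -
  have one: "\<one>\<^bsub>free_group d\<^esub> = []" by (simp add: free_group_def)
  interpret free_walk d \<mu>
  proof
    show "2 \<le> d" by (rule assms(1))
    show "set_pmf \<mu> \<subseteq> steps d" using assms(2) unfolding one .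
    show "0 < pmf \<mu> a" if "a \<in> free_gens d" for a using assms(3)[OF that] by blast
  qed
  note rate = rate_prob_eq(1)[OF assms(5)]
  note ldp = assms(7)[unfolded ldp_rate_function_def rate]
  interpret free_walk_ldp d \<mu> L
  proof
    show "0 \<le> L x" for x using ldp by blast
    show "closed {x. L x \<le> c}" for c using ldp by blast
    \<comment> \<open>Open sets equal their interior and closed sets their closure, so the bounds
      for Borel sets specialise.\<close>
    show "- (INF x\<in>B. L x) \<le> liminf (\<lambda>n. ln_ereal (rate_prob n B) / ereal (real n))" if "open B" for B
      using ldp borel_open[OF that] interior_open[OF that] by metis
    show "limsup (\<lambda>n. ln_ereal (rate_prob n B) / ereal (real n)) \<le> - (INF x\<in>B. L x)" if "closed B" for B
      using ldp borel_closed[OF that] closure_closed[OF that] by metis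
  qed
  interpret spectrum d \<mu> p r L C
    using assms(8,10,11) rate_zero_at_speed[OF assms(4,5,6)] by unfold_locales
  let ?z = "\<lambda>\<omega>. (N \<omega>, restrict (Y \<omega>) {u. u \<noteq> []})"
  have meas: "?z \<in> measurable M (vertices p \<Otimes>\<^sub>M nonroot \<mu>)"
    and distr: "distr M (vertices p \<Otimes>\<^sub>M nonroot \<mu>) ?z = vertices p \<Otimes>\<^sub>M nonroot \<mu>"
    using assms(13) unfolding has_law_def branching_walk_law_def by auto
  \<comment> \<open>Goodness is pulled back twice: from i.i.d. labels to pairs of offspring numbers
    and steps, then to the given probability space.\<close>
  have "AE z in vertices p \<Otimes>\<^sub>M nonroot \<mu>. good (labels z)"
    by (rule AE_distrD[OF measurable_attach], subst distr_attach, rule AE_good)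
  then have "AE \<omega> in M. good (labels (?z \<omega>))"
    by (intro AE_distrD[OF meas]) (simp only: distr)
  then show ?thesis
  proof eventually_elim
    case (elim \<omega>)
    have eq: "E_set d (gw_tree (N \<omega>)) (restrict (Y \<omega>) {u. u \<noteq> []}) = E_set d (gw_tree (N \<omega>)) (Y \<omega>)"
      unfolding E_set_def position_restrict ..
    show ?case
      using spectrum_good[OF elim] unfolding Let_def tree_labels fst_conv snd_conv eq .
  qed
qed

end
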